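(* A finite simple undirected graph $G$ is identified by $C^2$ if and only if its flip is a bouquet forest.
   Context: Graphs are finite, undirected, without loops. $C^k$ is the $k$-variable fragment of first-order logic (in the language of graphs, with edge relation $E$) extended by counting quantifiers $\exists^{\ge t}$ for all $t\in\mathbb N$; variables may be reused. A graph $G$ is identified by $C^2$ if there is a $C^2$-sentence $\varphi$ such that every graph satisfying $\varphi$ is isomorphic to $G$; for vertex-colored graphs the signature additionally has one unary predicate per color and isomorphisms must preserve colors. The $C^2$-type of a vertex is the set of $C^2$-formulas with one free variable it satisfies; the $C^2$-coloring $\chi$ of $G$ colors each vertex by its $C^2$-type, and the induced partition (the $C^2$-partition) is the coarsest equitable partition of $G$ (a partition $\Pi$ is equitable if for all $P,Q\in\Pi$ any two vertices of $P$ have the same number of neighbors in $Q$). For sets $P,Q$ let $[P,Q]=\{\{v,w\}: v\ne w, v\in P, w\in Q\}$. The flip of $G$ is the vertex-colored graph $(F,\chi)$ with $V(F)=V(G)$ and $E(F)=E(G)\,\Delta\,([P_1,Q_1]\cup\dots\cup[P_t,Q_t])$, where $(P_i,Q_i)$ ranges over all pairs of (not necessarily distinct) $C^2$-partition classes of $G$ with $|[P_i,Q_i]\cap E(G)|>|[P_i,Q_i]\setminus E(G)|$. A bouquet is obtained from a tree $T$ with a designated vertex $v$ by taking five disjoint copies $(T_1,v_1),\dots,(T_5,v_5)$ of $(T,v)$ and adding the edges of a $5$-cycle on $\{v_1,\dots,v_5\}$. A bouquet forest is a disjoint union of vertex-colored trees and pairwise non-isomorphic vertex-colored bouquets (the flip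 $(F,\chi)$ is regarded as a vertex-colored graph). *)

theory Defs
  imports Main "HOL-Library.Disjoint_Sets"
begin

record 'a graph =
  verts :: "'a set"
  edges :: "'a set set"

record ('a, 'c) colored_graph = "'a graph" +
  color :: "'a \<Rightarrow> 'c"

text \<open>Predicates on graphs are stated for \<open>graph_scheme\<close>; applied to a colored graph they
  disregard the coloring.\<close>

definition simple_graph :: "('a, 'm) graph_scheme \<Rightarrow> bool" where
  "simple_graph G \<longleftrightarrow> finite (verts G) \<and> (\<forall>e\<in>edges G. e \<subseteq> verts G \<and> card e = 2)"

definition graph_iso :: "('a \<Rightarrow> 'b) \<Rightarrow> ('a, 'm) graph_scheme \<Rightarrow> ('b, 'n) graph_scheme \<Rightarrow> bool" where
  "graph_iso f G H \<longleftrightarrow> bij_betw f (verts G) (verts H) \<and>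
    (\<forall>v\<in>verts G. \<forall>w\<in>verts G. {v, w} \<in> edges G \<longleftrightarrow> {f v, f w} \<in> edges H)"

definition isomorphic :: "('a, 'm) graph_scheme \<Rightarrow> ('b, 'n) graph_scheme \<Rightarrow> bool" where
  "isomorphic G H \<longleftrightarrow> (\<exists>f. graph_iso f G H)"

definition color_isomorphic :: "('a, 'c) colored_graph \<Rightarrow> ('b, 'c) colored_graph \<Rightarrow> bool" where
  "color_isomorphic G H \<longleftrightarrow>
    (\<exists>f. graph_iso f G H \<and> (\<forall>v\<in>verts G. color H (f v) = color G v))"

definition connected_graph :: "('a, 'm) graph_scheme \<Rightarrow> bool" where
  "connected_graph G \<longleftrightarrow> (\<forall>v\<in>verts G. \<forall>w\<in>verts G. (v, w) \<in> {(x, y). {x, y} \<in> edges G}\<^sup>*)"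

definition cycle_in :: "('a, 'm) graph_scheme \<Rightarrow> 'a list \<Rightarrow> bool" where
  "cycle_in G vs \<longleftrightarrow> length vs \<ge> 3 \<and> distinct vs \<and> set vs \<subseteq> verts G \<and>
    (\<forall>i<length vs. {vs ! i, vs ! ((i + 1) mod length vs)} \<in> edges G)"

definition tree :: "('a, 'm) graph_scheme \<Rightarrow> bool" where
  "tree T \<longleftrightarrow> simple_graph T \<and> verts T \<noteq> {} \<and> connected_graph T \<and> (\<nexists>vs. cycle_in T vs)"

text \<open>Variables are natural numbers, and \<open>ExGe t x \<phi>\<close> is the counting quantifier ``there are
  at least \<open>t\<close> many \<open>x\<close> with \<open>\<phi>\<close>''; the ordinary existential quantifier is \<open>ExGe 1\<close>.\<close>

datatype fm =
    Edge nat nat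
  | Equal nat nat
  | Neg fm
  | And fm fm
  | ExGe nat nat fm

primrec fm_vars :: "fm \<Rightarrow> nat set" where
  "fm_vars (Edge x y) = {x, y}"
| "fm_vars (Equal x y) = {x, y}"
| "fm_vars (Neg \<phi>) = fm_vars \<phi>"
| "fm_vars (And \<phi> \<psi>) = fm_vars \<phi> \<union> fm_vars \<psi>"
| "fm_vars (ExGe t x \<phi>) = insert x (fm_vars \<phi>)"

primrec free_vars :: "fm \<Rightarrow> nat set" where
  "free_vars (Edge x y) = {x, y}"
| "free_vars (Equal x y) = {x, y}"
| "free_vars (Neg \<phi>) = free_vars \<phi>"
| "free_vars (And \<phi> \<psi>) = free_vars \<phi> \<union> free_vars \<psi>"
| "free_vars (ExGe t x \<phi>) = free_vars \<phi> - {x}"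

definition C :: "nat \<Rightarrow> fm set" where
  "C k = {\<phi>. fm_vars \<phi> \<subseteq> {..<k}}"

primrec sat :: "('a, 'm) graph_scheme \<Rightarrow> (nat \<Rightarrow> 'a) \<Rightarrow> fm \<Rightarrow> bool" where
  "sat G s (Edge x y) \<longleftrightarrow> {s x, s y} \<in> edges G"
| "sat G s (Equal x y) \<longleftrightarrow> s x = s y"
| "sat G s (Neg \<phi>) \<longleftrightarrow> \<not> sat G s \<phi>"
| "sat G s (And \<phi> \<psi>) \<longleftrightarrow> sat G s \<phi> \<and> sat G s \<psi>"
| "sat G s (ExGe t x \<phi>) \<longleftrightarrow> t \<le> card {a \<in> verts G. sat G (s(x := a)) \<phi>}"

text \<open>For sentences, the only formulas this is applied to, the assignment is irrelevant.\<close>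

definition models :: "('a, 'm) graph_scheme \<Rightarrow> fm \<Rightarrow> bool" where
  "models G \<phi> \<longleftrightarrow> (\<forall>s. sat G s \<phi>)"

text \<open>Every finite graph has an isomorphic copy with vertices in \<open>nat\<close>, so \<open>H\<close> represents all
  finite simple graphs.\<close>

definition identified_by_C :: "nat \<Rightarrow> 'a graph \<Rightarrow> bool" where
  "identified_by_C k G \<longleftrightarrow>
    (\<exists>\<phi>\<in>C k. free_vars \<phi> = {} \<and> models G \<phi> \<and>
      (\<forall>H :: nat graph. simple_graph H \<and> models H \<phi> \<longrightarrow> isomorphic H G))"

text \<open>The free variable of a formula in a type is taken to be the variable \<open>0\<close>.\<close>

definition C2_type :: "'a graph \<Rightarrow> 'a \<Rightarrow> fm set" where
  "C2_type G v = {\<phi> \<in> C 2. free_vars \<phi> \<subseteq> {0} \<and> sat G (\<lambda>_. v) \<phi>}"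

definition C2_partition :: "'a graph \<Rightarrow> 'a set set" where
  "C2_partition G = {{w \<in> verts G. C2_type G w = C2_type G v} | v. v \<in> verts G}"

definition pairs_between :: "'a set \<Rightarrow> 'a set \<Rightarrow> 'a set set" where
  "pairs_between P Q = {{v, w} | v w. v \<noteq> w \<and> v \<in> P \<and> w \<in> Q}"

definition flipped_pairs :: "'a graph \<Rightarrow> 'a set set" where
  "flipped_pairs G = \<Union> {pairs_between P Q | P Q. P \<in> C2_partition G \<and> Q \<in> C2_partition G \<and>
    card (pairs_between P Q \<inter> edges G) > card (pairs_between P Q - edges G)}"

definition flip :: "'a graph \<Rightarrow> ('a, fm set) colored_graph" where
  "flip G = \<lparr>verts = verts G,
             edges = (edges G - flipped_pairs G) \<union> (flipped_pairs G - edges G),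
             color = C2_type G\<rparr>"

definition bouquet_of :: "('a, 'm) graph_scheme \<Rightarrow> 'a \<Rightarrow> ('a \<times> nat) graph" where
  "bouquet_of T v = \<lparr>verts = verts T \<times> {..<5},
     edges = {{(x, i), (y, i)} | x y i. {x, y} \<in> edges T \<and> i < 5} \<union>
             {{(v, i), (v, (i + 1) mod 5)} | i. i < 5}\<rparr>"

text \<open>A bouquet contains copies of the tree it is made from, so one may take the tree to have
  vertices in the same type.\<close>

definition bouquet :: "('a, 'm) graph_scheme \<Rightarrow> bool" where
  "bouquet B \<longleftrightarrow> simple_graph B \<and>
    (\<exists>(T :: 'a graph) v. tree T \<and> v \<in> verts T \<and> isomorphic (bouquet_of T v) B)"

definition induced :: "('a, 'c) colored_graph \<Rightarrow> 'a set \<Rightarrow> ('a, 'c) colored_graph" where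
  "induced G S = \<lparr>verts = S, edges = {e \<in> edges G. e \<subseteq> S}, color = color G\<rparr>"

text \<open>\<open>F\<close> is the disjoint union of its subgraphs induced by the blocks of \<open>\<S>\<close>.\<close>

definition bouquet_forest :: "('a, 'c) colored_graph \<Rightarrow> bool" where
  "bouquet_forest F \<longleftrightarrow>
    (\<exists>\<S>. partition_on (verts F) \<S> \<and> (\<forall>e\<in>edges F. \<exists>S\<in>\<S>. e \<subseteq> S) \<and>
      (\<forall>S\<in>\<S>. tree (induced F S) \<or> bouquet (induced F S)) \<and>
      (\<forall>S\<in>\<S>. \<forall>S'\<in>\<S>. S \<noteq> S' \<and> bouquet (induced F S) \<and> bouquet (induced F S') \<longrightarrow>
        \<not> color_isomorphic (induced F S) (induced F S')))"

end

theory Submission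
  imports Defs
begin

text \<open>
  Everything takes place on a fixed vertex set \<open>V\<close> with a fixed colouring \<open>c\<close>. A relation is
  \<^emph>\<open>equitable\<close> with degrees \<open>D\<close> if every vertex of colour \<open>i\<close> has exactly \<open>D i j\<close> neighbours of
  colour \<open>j\<close>. By the bijective pebble game, \<open>G\<close> is identified by \<open>C\<^sup>2\<close> iff all equitable relations with
  the degrees of \<open>G\<close> are isomorphic (\<^emph>\<open>rigidity\<close>), and passing to the flip does not affect rigidity.
  In the flip every degree is at most half of its maximum.

  Call a colour class a leaf class if each of its vertices has total degree one, with its neighbour
  in another class. Deleting leaf classes as long as possible leaves a graph in which rigidity and
  being a bouquet forest can both be compared with the same condition: what is left is a disjoint
  union of edgeless classes, of perfect matchings inside a class, and of classes that are 5-cycles.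
  Isomorphisms, trees and bouquets extend over the deleted leaf classes.

  If the condition fails, a second realization of the degrees is found as follows. Two suitable
  regular (or biregular) graphs deal with a class of inner degree at least two and with a pair of
  classes of mutual degrees at least two. Otherwise, starting from a largest offending class, follow
  classes joined by perfect matchings to obtain either a cycle of matchings, whose monodromy can be
  changed, or a path both of whose ends induce a non-trivial regular graph on the same set; permuting
  one of these two graphs changes the number of pairs on which they agree.
\<close>

text \<open>Counting the edges between two classes from both sides shows that a largest class has
  outgoing degrees at most the returning ones. As the two cannot both be 2 or more, the outgoing
  degree is 1. If the returning degree is 1 too, the classes have equal size and are joined by a
  perfect matching; otherwise the larger class is partitioned by common neighbours, which is a
  non-trivial regular graph on it. So a walk through largest offending classes ends there or closes
  up.

  The obstacle is that an isomorphism between two realizations may permute every class. A change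
  between two classes is visible only in a number that survives all such permutations; therefore two
  structures are brought to the same class along the path and their agreements are counted.

  The flip provides the room: degrees of at most half the maximum make these regular graphs neither
  edgeless nor complete, and give matched classes a second vertex. It also explains the number five:
  among all \<open>k \<ge> 2\<close> and \<open>n \<ge> 2 * k + 1\<close> with \<open>n * k\<close>
  even, only \<open>k = 2\<close>, \<open>n = 5\<close> admits just one \<open>k\<close>-regular
  graph on \<open>n\<close> vertices.\<close>

section \<open>Bijections from cardinalities, adjacency and equitable relations\<close>

text \<open>Glues bijections between fibres of equal size. It supplies the answer in the pebble
  game, the renaming of a model and the matching of leaves.\<close>

lemma fiber_bij:
  fixes f :: "'a \<Rightarrow> 'k" and g :: "'b \<Rightarrow> 'k"
  assumes fin: "finite A" "finite B"
    and card: "\<And>k. card {a \<in> A. f a = k} = card {b \<in> B. g b = k}"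
  shows "\<exists>h. bij_betw h A B \<and> (\<forall>a\<in>A. g (h a) = f a)"
proof -
  have "\<exists>h. bij_betw h {a \<in> A. f a = k} {b \<in> B. g b = k}" for k
    by (rule finite_same_card_bij) (use fin card in simp_all)
  then have "\<forall>k. \<exists>h. bij_betw h {a \<in> A. f a = k} {b \<in> B. g b = k}" by blast
  from choice[OF this] obtain h where h: "\<And>k. bij_betw (h k) {a \<in> A. f a = k} {b \<in> B. g b = k}"
    by blast
  define h' where "h' a = h (f a) a" for a
  have mem: "h' a \<in> B \<and> g (h' a) = f a" if "a \<in> A" for a
    using bij_betwE[OF h[of "f a"]] that unfolding h'_def by auto
  have "inj_on h' A"
  proof (rule inj_onI)
    fix x y assume xy: "x \<in> A" "y \<in> A" "h' x = h' y"
    then have "f x = f y" using mem by metis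
    moreover have "inj_on (h (f x)) {a \<in> A. f a = f x}" using h by (simp add: bij_betw_def)
    ultimately show "x = y" using xy unfolding h'_def by (auto dest: inj_onD)
  qed
  moreover have "B \<subseteq> h' ` A"
  proof
    fix b assume "b \<in> B"
    then have "b \<in> h (g b) ` {a \<in> A. f a = g b}"
      using h[of "g b"] unfolding bij_betw_def by auto
    then obtain a where "a \<in> A" "f a = g b" "b = h (g b) a" by blast
    then have "b = h' a" "a \<in> A" unfolding h'_def by metis+
    then show "b \<in> h' ` A" by blast
  qed
  ultimately have "bij_betw h' A B"
    unfolding bij_betw_def using mem by auto
  with mem show ?thesis by blast
qed

lemma bij_betw_card_Collect:
  assumes "bij_betw h A B" "\<And>a. a \<in> A \<Longrightarrow> P a \<longleftrightarrow> Q (h a)"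
  shows "card {a \<in> A. P a} = card {b \<in> B. Q b}"
proof -
  have "bij_betw h {a \<in> A. P a} {b \<in> B. Q b}"
    using assms unfolding bij_betw_def inj_on_def by auto
  then show ?thesis by (rule bij_betw_same_card)
qed

definition adj :: "('a, 'm) graph_scheme \<Rightarrow> 'a \<Rightarrow> 'a \<Rightarrow> bool" where
  "adj G x y \<longleftrightarrow> {x, y} \<in> edges G"

lemma adj_sym: "adj G x y \<Longrightarrow> adj G y x"
  by (simp add: adj_def insert_commute)

lemma simple_graph_adj:
  assumes "simple_graph G" "adj G x y"
  shows "x \<noteq> y" "x \<in> verts G" "y \<in> verts G"
proof -
  have "{x, y} \<subseteq> verts G" "card {x, y} = 2"
    using assms by (auto simp: simple_graph_def adj_def)
  then show "x \<noteq> y" "x \<in> verts G" "y \<in> verts G" by auto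
qed

lemma simple_graph_edgeE:
  assumes "simple_graph G" "e \<in> edges G"
  obtains x y where "e = {x, y}" "adj G x y"
proof -
  have "card e = 2" using assms by (auto simp: simple_graph_def)
  then obtain x y where "e = {x, y}" by (auto simp: card_2_iff)
  with assms that show ?thesis by (auto simp: adj_def)
qed

text \<open>The matrix \<open>D\<close> is a parameter and not computed from \<open>E\<close>, so
  that different relations with the same degrees can be compared on one coloured vertex set.\<close>

definition equitable :: "'a set \<Rightarrow> ('a \<Rightarrow> 'c) \<Rightarrow> ('c \<Rightarrow> 'c \<Rightarrow> nat) \<Rightarrow> ('a \<Rightarrow> 'a \<Rightarrow> bool) \<Rightarrow> bool" where
  "equitable V c D E \<longleftrightarrow> finite V \<and> (\<forall>x y. E x y \<longrightarrow> E y x \<and> x \<noteq> y \<and> x \<in> V \<and> y \<in> V) \<and>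
    (\<forall>x\<in>V. \<forall>j. card {y \<in> V. c y = j \<and> E x y} = D (c x) j)"

text \<open>Stands in for being identified: beyond class sizes and degrees a two-variable sentence
  can fix nothing.\<close>

definition rigid :: "'a set \<Rightarrow> ('a \<Rightarrow> 'c) \<Rightarrow> ('c \<Rightarrow> 'c \<Rightarrow> nat) \<Rightarrow> bool" where
  "rigid V c D \<longleftrightarrow> (\<forall>E E'. equitable V c D E \<longrightarrow> equitable V c D E' \<longrightarrow>
    (\<exists>g. bij_betw g V V \<and> (\<forall>x\<in>V. c (g x) = c x) \<and>
      (\<forall>x\<in>V. \<forall>y\<in>V. E x y \<longleftrightarrow> E' (g x) (g y))))"

subsection \<open>Two-variable counting logic\<close>

lemma sat_cong:
  "(\<And>x. x \<in> free_vars \<phi> \<Longrightarrow> s x = t x) \<Longrightarrow> sat G s \<phi> \<longleftrightarrow> sat G t \<phi>"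
proof (induction \<phi> arbitrary: s t)
  case (ExGe n x \<phi>)
  have "sat G (s(x := a)) \<phi> \<longleftrightarrow> sat G (t(x := a)) \<phi>" for a
    using ExGe.prems by (intro ExGe.IH) auto
  then show ?case by simp
next
  case (And \<phi> \<psi>)
  have "sat G s \<phi> \<longleftrightarrow> sat G t \<phi>" "sat G s \<psi> \<longleftrightarrow> sat G t \<psi>"
    using And.prems by (intro And.IH, simp)+
  then show ?case by simp
next
  case (Neg \<phi>)
  have "sat G s \<phi> \<longleftrightarrow> sat G t \<phi>" using Neg.prems by (intro Neg.IH) simp
  then show ?case by simp
qed simp_all

text \<open>Two vertices (or pairs) that look the same with respect to colourings with equal
  parameters cannot be separated in the bijective 2-pebble game.\<close>

lemma game:
  fixes G :: "('a, 'm) graph_scheme" and H :: "('b, 'n) graph_scheme"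
    and cG :: "'a \<Rightarrow> 'c" and cH :: "'b \<Rightarrow> 'c"
  assumes G: "simple_graph G" and H: "simple_graph H"
    and size: "\<And>j. card {x \<in> verts G. cG x = j} = card {x \<in> verts H. cH x = j}"
    and deg: "\<And>x y j. x \<in> verts G \<Longrightarrow> y \<in> verts H \<Longrightarrow> cG x = cH y \<Longrightarrow>
      card {z \<in> verts G. cG z = j \<and> adj G x z} = card {z \<in> verts H. cH z = j \<and> adj H y z}"
  shows "\<phi> \<in> C 2 \<Longrightarrow> s 0 \<in> verts G \<Longrightarrow> s 1 \<in> verts G \<Longrightarrow> t 0 \<in> verts H \<Longrightarrow> t 1 \<in> verts H \<Longrightarrow>
    cG (s 0) = cH (t 0) \<Longrightarrow> cG (s 1) = cH (t 1) \<Longrightarrow> (s 0 = s 1 \<longleftrightarrow> t 0 = t 1) \<Longrightarrow>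
    (adj G (s 0) (s 1) \<longleftrightarrow> adj H (t 0) (t 1)) \<Longrightarrow> sat G s \<phi> \<longleftrightarrow> sat H t \<phi>"
proof (induction \<phi> arbitrary: s t)
  case (Edge x y)
  have v: "x = 0 \<or> x = 1" "y = 0 \<or> y = 1" using Edge(1) by (auto simp: C_def)
  have "\<not> adj G a a" "\<not> adj H b b" for a b using simple_graph_adj G H by metis+
  then show ?case using v Edge by (auto simp: adj_def insert_commute)
next
  case (Equal x y)
  have "x = 0 \<or> x = 1" "y = 0 \<or> y = 1" using Equal(1) by (auto simp: C_def)
  then show ?case using Equal.prems(8) by (metis sat.simps(2))
next
  case (Neg \<phi>)
  have "\<phi> \<in> C 2" using Neg.prems(1) by (auto simp: C_def)
  from Neg.IH[OF this Neg.prems(2-9)] show ?case by simp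
next
  case (And \<phi> \<psi>)
  have "\<phi> \<in> C 2" "\<psi> \<in> C 2" using And.prems(1) by (auto simp: C_def)
  from And.IH(1)[OF this(1) And.prems(2-9)] And.IH(2)[OF this(2) And.prems(2-9)]
  show ?case by simp
next
  case (ExGe n x \<phi>)
  have \<phi>: "\<phi> \<in> C 2" and x: "x = 0 \<or> x = 1" using ExGe.prems(1) by (auto simp: C_def)
  \<comment> \<open>The pebble on \<open>o'\<close> stays on the board while the one on
    \<open>x\<close> is moved.\<close>
  define o' where "o' = (1 - x :: nat)"
  define u where "u = s o'"
  define w where "w = t o'"
  have u: "u \<in> verts G" "w \<in> verts H" "cG u = cH w"
    using ExGe.prems x unfolding u_def w_def o'_def by auto
  have finG: "finite (verts G)" "finite (verts H)" using G H by (auto simp: simple_graph_def)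
  have irr: "\<not> adj G a a" "\<not> adj H b b" for a b using simple_graph_adj G H by metis+
  \<comment> \<open>Duplicator's bijection. Vertices are sorted by colour, by equality with the
    remaining pebble and by adjacency to it. The fibres over \<open>True, True\<close> are empty,
    those over \<open>True, False\<close> have at most one element, those over
    \<open>False, True\<close> are counted by degrees, and the last kind is the rest of a colour
    class.\<close>
  have "\<exists>h. bij_betw h (verts G) (verts H) \<and> (\<forall>a\<in>verts G.
      (cH (h a), h a = w, adj H w (h a)) = (cG a, a = u, adj G u a))"
  proof (rule fiber_bij[OF finG])
    fix k :: "'c \<times> bool \<times> bool"
    obtain j p q where k: "k = (j, p, q)" by (cases k)
    let ?A = "\<lambda>p q. {a \<in> verts G. (cG a, a = u, adj G u a) = (j, p, q)}"
    let ?B = "\<lambda>p q. {b \<in> verts H. (cH b, b = w, adj H w b) = (j, p, q)}"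
    have TT: "?A True True = {}" "?B True True = {}" using irr by auto
    have TF: "?A True False = (if cG u = j then {u} else {})"
      "?B True False = (if cG u = j then {w} else {})" using irr u by auto
    have FT: "?A False True = {z \<in> verts G. cG z = j \<and> adj G u z}"
      "?B False True = {z \<in> verts H. cH z = j \<and> adj H w z}" using irr by auto
    have FTc: "card (?A False True) = card (?B False True)" unfolding FT using u deg by blast
    have "{x \<in> verts G. cG x = j} = ?A True False \<union> (?A False True \<union> ?A False False)" using irr by auto
    moreover have "card (?A True False \<union> (?A False True \<union> ?A False False)) =
        card (?A True False) + (card (?A False True) + card (?A False False))"
      using finG(1) by (intro trans[OF card_Un_disjoint] arg_cong2[of _ _ _ _ "(+)"] card_Un_disjoint refl) auto
    ultimately have 1: "card {x \<in> verts G. cG x = j} =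
        card (?A True False) + (card (?A False True) + card (?A False False))" by (simp only:)
    have "{x \<in> verts H. cH x = j} = ?B True False \<union> (?B False True \<union> ?B False False)" using irr by auto
    moreover have "card (?B True False \<union> (?B False True \<union> ?B False False)) =
        card (?B True False) + (card (?B False True) + card (?B False False))"
      using finG(2) by (intro trans[OF card_Un_disjoint] arg_cong2[of _ _ _ _ "(+)"] card_Un_disjoint refl) auto
    ultimately have 2: "card {x \<in> verts H. cH x = j} =
        card (?B True False) + (card (?B False True) + card (?B False False))" by (simp only:)
    have TFc: "card (?A True False) = card (?B True False)" unfolding TF by simp
    have "card (?A False False) = card (?B False False)" using 1 2 size[of j] TFc FTc by linarith
    then have "card (?A p q) = card (?B p q)"
      using TT TFc FTc by (cases p; cases q) (simp_all only: card.empty)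
    then show "card {a \<in> verts G. (cG a, a = u, adj G u a) = k} =
        card {b \<in> verts H. (cH b, b = w, adj H w b) = k}" unfolding k .
  qed
  then obtain h where h: "bij_betw h (verts G) (verts H)"
    and hp: "\<And>a. a \<in> verts G \<Longrightarrow> cH (h a) = cG a \<and> (h a = w \<longleftrightarrow> a = u) \<and> (adj H w (h a) \<longleftrightarrow> adj G u a)"
    by auto
  have "sat G (s(x := a)) \<phi> \<longleftrightarrow> sat H (t(x := h a)) \<phi>" if a: "a \<in> verts G" for a
  proof -
    have ha: "h a \<in> verts H" using h a by (auto simp: bij_betw_def)
    show ?thesis
      using x
    proof
      assume [simp]: "x = 0"
      show ?thesis
        by (rule ExGe.IH[OF \<phi>]) (use a ha u hp[OF a] in \<open>auto simp: u_def w_def o'_def dest: adj_sym\<close>)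
    next
      assume [simp]: "x = 1"
      show ?thesis
        by (rule ExGe.IH[OF \<phi>]) (use a ha u hp[OF a] in \<open>auto simp: u_def w_def o'_def dest: adj_sym\<close>)
    qed
  qed
  then have "card {a \<in> verts G. sat G (s(x := a)) \<phi>} = card {b \<in> verts H. sat H (t(x := b)) \<phi>}"
    by (rule bij_betw_card_Collect[OF h])
  then show ?case by simp
qed

text \<open>Since \<open>f\<close> is a bijection only on the vertices, every variable has to be
  assigned a vertex.\<close>

lemma sat_iso:
  assumes "graph_iso f G H" "s ` UNIV \<subseteq> verts G"
  shows "sat G s \<phi> \<longleftrightarrow> sat H (f \<circ> s) \<phi>"
  using assms(2)
proof (induction \<phi> arbitrary: s)
  case (Equal x y)
  have "s x \<in> verts G" "s y \<in> verts G" using Equal.prems by auto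
  then show ?case using assms(1) by (auto simp: graph_iso_def bij_betw_def inj_on_def)
next
  case (Edge x y)
  have "s x \<in> verts G" "s y \<in> verts G" using Edge.prems by auto
  then show ?case using assms(1) by (auto simp: graph_iso_def)
next
  case (ExGe n x \<phi>)
  have bij: "bij_betw f (verts G) (verts H)" using assms by (auto simp: graph_iso_def)
  have "sat G (s(x := a)) \<phi> \<longleftrightarrow> sat H ((f \<circ> s)(x := f a)) \<phi>" if "a \<in> verts G" for a
  proof -
    have "(f \<circ> s)(x := f a) = f \<circ> s(x := a)" by auto
    moreover have "s(x := a) ` UNIV \<subseteq> verts G" using ExGe.prems that by auto
    ultimately show ?thesis using ExGe.IH by metis
  qed
  then have "card {a \<in> verts G. sat G (s(x := a)) \<phi>} = card {b \<in> verts H. sat H ((f \<circ> s)(x := b)) \<phi>}"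
    by (rule bij_betw_card_Collect[OF bij])
  then show ?case by (simp only: sat.simps)
qed auto

section \<open>Formulas for type classes and degrees\<close>

text \<open>A class formula speaks about variable 0, but a degree formula needs it for the
  neighbour, which is variable 1. Exchanging the two variables everywhere, bound occurrences
  included, does this substitution without a third variable.\<close>

definition swap01 :: "nat \<Rightarrow> nat" where
  "swap01 x = (if x = 0 then 1 else if x = 1 then 0 else x)"

primrec swap_fm :: "fm \<Rightarrow> fm" where
  "swap_fm (Edge x y) = Edge (swap01 x) (swap01 y)"
| "swap_fm (Equal x y) = Equal (swap01 x) (swap01 y)"
| "swap_fm (Neg \<phi>) = Neg (swap_fm \<phi>)"
| "swap_fm (And \<phi> \<psi>) = And (swap_fm \<phi>) (swap_fm \<psi>)"
| "swap_fm (ExGe n x \<phi>) = ExGe n (swap01 x) (swap_fm \<phi>)"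

lemma swap01_inj: "swap01 x = swap01 y \<longleftrightarrow> x = y"
  by (auto simp: swap01_def split: if_splits)

lemma sat_swap: "sat G s (swap_fm \<phi>) \<longleftrightarrow> sat G (s \<circ> swap01) \<phi>"
proof (induction \<phi> arbitrary: s)
  case (ExGe n x \<phi>)
  have "(s(swap01 x := a)) \<circ> swap01 = (s \<circ> swap01)(x := a)" for a
    by (auto simp: fun_eq_iff swap01_inj)
  then show ?case by (simp only: swap_fm.simps sat.simps ExGe.IH)
next
  case (Neg \<phi>)
  then show ?case by simp
next
  case (And \<phi> \<psi>)
  then show ?case by simp
qed simp_all

lemma vars_swap: "fm_vars (swap_fm \<phi>) = swap01 ` fm_vars \<phi>"
  by (induction \<phi>) auto

lemma free_vars_swap: "free_vars (swap_fm \<phi>) = swap01 ` free_vars \<phi>"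
  by (induction \<phi>) (auto simp: swap01_inj)

lemma swap_C2: "\<phi> \<in> C 2 \<Longrightarrow> swap_fm \<phi> \<in> C 2"
  by (auto simp: C_def vars_swap swap01_def subset_iff)

text \<open>The fold starts with a closed formula true in every graph: at least zero vertices
  satisfy anything.\<close>

definition conj_fm :: "fm list \<Rightarrow> fm" where
  "conj_fm xs = foldr And xs (ExGe 0 0 (Equal 0 0))"

lemma sat_conj_fm [simp]: "sat G s (conj_fm xs) \<longleftrightarrow> (\<forall>\<phi>\<in>set xs. sat G s \<phi>)"
  by (induction xs) (auto simp: conj_fm_def)

lemma conj_fm_C2: "set xs \<subseteq> C 2 \<Longrightarrow> conj_fm xs \<in> C 2"
  by (induction xs) (auto simp: conj_fm_def C_def)

lemma free_vars_conj_fm [simp]: "free_vars (conj_fm xs) = (\<Union>\<phi>\<in>set xs. free_vars \<phi>)"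
  by (induction xs) (auto simp: conj_fm_def)

definition exactly_fm :: "nat \<Rightarrow> nat \<Rightarrow> fm \<Rightarrow> fm" where
  "exactly_fm n x \<phi> = And (ExGe n x \<phi>) (Neg (ExGe (Suc n) x \<phi>))"

lemma sat_exactly_fm [simp]:
  "sat G s (exactly_fm n x \<phi>) \<longleftrightarrow> card {a \<in> verts G. sat G (s(x := a)) \<phi>} = n"
  by (auto simp: exactly_fm_def)

definition forall_fm :: "nat \<Rightarrow> fm \<Rightarrow> fm" where
  "forall_fm x \<phi> = Neg (ExGe 1 x (Neg \<phi>))"

lemma sat_forall_fm [simp]:
  "finite (verts G) \<Longrightarrow> sat G s (forall_fm x \<phi>) \<longleftrightarrow> (\<forall>a\<in>verts G. sat G (s(x := a)) \<phi>)"
  by (auto simp: forall_fm_def not_le card_eq_0_iff)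

lemma free_vars_exactly_fm [simp]: "free_vars (exactly_fm n x \<phi>) = free_vars \<phi> - {x}"
  by (auto simp: exactly_fm_def)

lemma free_vars_forall_fm [simp]: "free_vars (forall_fm x \<phi>) = free_vars \<phi> - {x}"
  by (auto simp: forall_fm_def)

lemma C2_intros:
  "x < 2 \<Longrightarrow> \<phi> \<in> C 2 \<Longrightarrow> exactly_fm n x \<phi> \<in> C 2"
  "x < 2 \<Longrightarrow> \<phi> \<in> C 2 \<Longrightarrow> forall_fm x \<phi> \<in> C 2"
  "\<phi> \<in> C 2 \<Longrightarrow> Neg \<phi> \<in> C 2"
  "\<phi> \<in> C 2 \<Longrightarrow> \<psi> \<in> C 2 \<Longrightarrow> And \<phi> \<psi> \<in> C 2"
  "x < 2 \<Longrightarrow> y < 2 \<Longrightarrow> Edge x y \<in> C 2"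
  by (auto simp: exactly_fm_def forall_fm_def C_def)

lemma sat_free0:
  assumes "free_vars \<phi> \<subseteq> {0}"
  shows "sat G s \<phi> \<longleftrightarrow> sat G (\<lambda>_. s 0) \<phi>"
  using assms by (intro sat_cong) auto

text \<open>A type is an infinite set of formulas, but within one finite graph a single formula
  suffices: for each vertex of another type take a formula separating it from \<open>v\<close>,
  negated if necessary, and form the conjunction. It belongs to the type of \<open>v\<close> itself
  and so holds at all vertices of that type.\<close>

lemma class_formula:
  fixes G :: "'a graph"
  assumes "finite (verts G)"
  shows "\<exists>\<theta>\<in>C 2. free_vars \<theta> \<subseteq> {0} \<and>
    (\<forall>w\<in>verts G. sat G (\<lambda>_. w) \<theta> \<longleftrightarrow> C2_type G w = C2_type G v)"
proof -
  let ?W = "{w \<in> verts G. C2_type G w \<noteq> C2_type G v}"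
  have "\<exists>\<psi>\<in>C 2. free_vars \<psi> \<subseteq> {0} \<and> sat G (\<lambda>_. v) \<psi> \<and> \<not> sat G (\<lambda>_. w) \<psi>"
    if "w \<in> ?W" for w
  proof -
    from that obtain \<psi> where "\<psi> \<in> C 2" "free_vars \<psi> \<subseteq> {0}" "sat G (\<lambda>_. v) \<psi> \<noteq> sat G (\<lambda>_. w) \<psi>"
      unfolding C2_type_def by blast
    note \<psi> = this
    show ?thesis
    proof (cases "sat G (\<lambda>_. v) \<psi>")
      case True
      then show ?thesis using \<psi> by blast
    next
      case False
      then have "Neg \<psi> \<in> C 2 \<and> free_vars (Neg \<psi>) \<subseteq> {0} \<and> sat G (\<lambda>_. v) (Neg \<psi>) \<and> \<not> sat G (\<lambda>_. w) (Neg \<psi>)"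
        using \<psi> C2_intros(3) by simp
      then show ?thesis by blast
    qed
  qed
  then obtain \<psi> where \<psi>: "\<And>w. w \<in> ?W \<Longrightarrow> \<psi> w \<in> C 2 \<and> free_vars (\<psi> w) \<subseteq> {0} \<and>
      sat G (\<lambda>_. v) (\<psi> w) \<and> \<not> sat G (\<lambda>_. w) (\<psi> w)" by metis
  obtain ws where ws: "set ws = ?W" using assms finite_list[of ?W] by auto
  define \<theta> where "\<theta> = conj_fm (map \<psi> ws)"
  have \<psi>': "\<forall>w\<in>set ws. \<psi> w \<in> C 2 \<and> free_vars (\<psi> w) \<subseteq> {0} \<and>
      sat G (\<lambda>_. v) (\<psi> w) \<and> \<not> sat G (\<lambda>_. w) (\<psi> w)"
    using \<psi> ws by blast
  have "set (map \<psi> ws) \<subseteq> C 2" using \<psi>' unfolding set_map by blast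
  then have \<theta>1: "\<theta> \<in> C 2" unfolding \<theta>_def by (rule conj_fm_C2)
  have "(\<Union>\<phi>\<in>\<psi> ` set ws. free_vars \<phi>) \<subseteq> {0}" using \<psi>' by blast
  then have \<theta>2: "free_vars \<theta> \<subseteq> {0}" unfolding \<theta>_def free_vars_conj_fm set_map .
  have \<theta>3: "sat G s \<theta> \<longleftrightarrow> (\<forall>w\<in>set ws. sat G s (\<psi> w))" for s unfolding \<theta>_def by simp
  have "sat G (\<lambda>_. v) \<theta>" unfolding \<theta>3 using \<psi>' by blast
  with \<theta>1 \<theta>2 have mem: "\<theta> \<in> C2_type G v" unfolding C2_type_def by blast
  have "sat G (\<lambda>_. w) \<theta>" if "C2_type G w = C2_type G v" for w
  proof -
    have "\<theta> \<in> C2_type G w" unfolding that by (rule mem)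
    then show ?thesis unfolding C2_type_def by blast
  qed
  moreover have "\<not> sat G (\<lambda>_. w) \<theta>" if "w \<in> ?W" for w
    unfolding \<theta>3 using that \<psi>' ws by blast
  ultimately show ?thesis using \<theta>1 \<theta>2 by blast
qed

text \<open>Given a formula for the type \<open>j\<close>, the number of neighbours of type
  \<open>j\<close> can be stated with two variables, so it is determined by the type.\<close>

lemma C2_type_degree:
  fixes G :: "'a graph"
  assumes G: "simple_graph G" and x: "x \<in> verts G" and y: "y \<in> verts G"
    and xy: "C2_type G x = C2_type G y"
  shows "card {z \<in> verts G. C2_type G z = j \<and> adj G x z} = card {z \<in> verts G. C2_type G z = j \<and> adj G y z}"
proof (cases "\<exists>v\<in>verts G. C2_type G v = j")
  case True
  then obtain v where v: "C2_type G v = j" by blast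
  obtain \<theta> where \<theta>: "\<theta> \<in> C 2" "free_vars \<theta> \<subseteq> {0}"
      "\<And>w. w \<in> verts G \<Longrightarrow> sat G (\<lambda>_. w) \<theta> \<longleftrightarrow> C2_type G w = j"
    using class_formula[of G v] G v by (auto simp: simple_graph_def)
  define n where "n = card {z \<in> verts G. C2_type G z = j \<and> adj G x z}"
  define \<phi> where "\<phi> = exactly_fm n 1 (And (Edge 0 1) (swap_fm \<theta>))"
  have sw: "sat G s (swap_fm \<theta>) \<longleftrightarrow> sat G (\<lambda>_. s 1) \<theta>" for s
    using sat_free0[OF \<theta>(2), of G "s \<circ> swap01"] by (simp add: sat_swap swap01_def)
  have *: "sat G (\<lambda>_. u) \<phi> \<longleftrightarrow> card {z \<in> verts G. C2_type G z = j \<and> adj G u z} = n" for u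
  proof -
    have "{a \<in> verts G. sat G ((\<lambda>_. u)(1 := a)) (And (Edge 0 1) (swap_fm \<theta>))} =
        {z \<in> verts G. C2_type G z = j \<and> adj G u z}"
      using \<theta>(3) by (auto simp: sw adj_def)
    then show ?thesis unfolding \<phi>_def sat_exactly_fm by simp
  qed
  have "\<phi> \<in> C 2" "free_vars \<phi> \<subseteq> {0}" using \<theta>
    by (auto simp: \<phi>_def free_vars_swap swap01_def intro!: C2_intros swap_C2)
  then have "sat G (\<lambda>_. x) \<phi> \<longleftrightarrow> sat G (\<lambda>_. y) \<phi>"
    using xy unfolding C2_type_def by blast
  moreover have "sat G (\<lambda>_. x) \<phi>" unfolding * n_def ..
  ultimately have "card {z \<in> verts G. C2_type G z = j \<and> adj G y z} = n" by (simp only: *)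
  then show ?thesis by (simp only: n_def)
next
  case False
  then have "{z \<in> verts G. C2_type G z = j \<and> adj G x z} = {}"
    "{z \<in> verts G. C2_type G z = j \<and> adj G y z} = {}" by auto
  then show ?thesis by (simp only:)
qed

section \<open>Identification by a sentence and rigidity\<close>

lemma equitableD:
  assumes "equitable V c D E"
  shows "finite V" "E x y \<Longrightarrow> E y x" "\<not> E x x" "E x y \<Longrightarrow> x \<in> V" "E x y \<Longrightarrow> y \<in> V"
    "x \<in> V \<Longrightarrow> card {y \<in> V. c y = j \<and> E x y} = D (c x) j"
  using assms unfolding equitable_def by blast+

lemma graph_iso_adj:
  "graph_iso f G H \<longleftrightarrow> bij_betw f (verts G) (verts H) \<and>
    (\<forall>v\<in>verts G. \<forall>w\<in>verts G. adj G v w \<longleftrightarrow> adj H (f v) (f w))"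
  by (simp add: graph_iso_def adj_def)

lemma graph_iso_comp: "graph_iso f G H \<Longrightarrow> graph_iso g H K \<Longrightarrow> graph_iso (g \<circ> f) G K"
  unfolding graph_iso_def by (auto intro: bij_betw_trans simp: bij_betw_apply)

definition graph_of :: "'a set \<Rightarrow> ('a \<Rightarrow> 'a \<Rightarrow> bool) \<Rightarrow> 'a graph" where
  "graph_of V E = \<lparr>verts = V, edges = {{x, y} | x y. E x y}\<rparr>"

lemma adj_graph_of:
  assumes "\<And>x y. E x y \<Longrightarrow> E y x"
  shows "adj (graph_of V E) x y \<longleftrightarrow> E x y"
  using assms by (auto simp: adj_def graph_of_def doubleton_eq_iff)

lemma verts_graph_of [simp]: "verts (graph_of V E) = V"
  by (simp add: graph_of_def)

lemma simple_graph_of: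
  assumes "finite V" "\<And>x y. E x y \<Longrightarrow> x \<noteq> y \<and> x \<in> V \<and> y \<in> V"
  shows "simple_graph (graph_of V E)"
  using assms by (fastforce simp: simple_graph_def graph_of_def)

lemma equitable_graph_of:
  assumes "equitable V c D E"
  shows "simple_graph (graph_of V E)" "adj (graph_of V E) = E"
proof -
  show "simple_graph (graph_of V E)"
    using equitableD[OF assms] by (intro simple_graph_of) metis+
  show "adj (graph_of V E) = E"
    using equitableD(2)[OF assms] by (intro ext adj_graph_of)
qed

lemma equitable_adj:
  assumes "simple_graph G" "\<And>x j. x \<in> verts G \<Longrightarrow> card {y \<in> verts G. c y = j \<and> adj G x y} = D (c x) j"
  shows "equitable (verts G) c D (adj G)"
  using assms simple_graph_adj[OF assms(1)] unfolding equitable_def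
  by (auto simp: simple_graph_def dest: adj_sym)

text \<open>The graph with edge relation \<open>E\<close> has the classes and degrees of
  \<open>G\<close>, so by the pebble game it satisfies the identifying sentence. The resulting
  isomorphism preserves types because it preserves formulas and each vertex satisfies the same
  formulas in both graphs.\<close>

lemma identified_imp_iso:
  fixes G :: "'a graph"
  assumes G: "simple_graph G" and id: "identified_by_C 2 G"
    and eG: "equitable (verts G) (C2_type G) D (adj G)"
    and eE: "equitable (verts G) (C2_type G) D E"
  shows "\<exists>g. bij_betw g (verts G) (verts G) \<and> (\<forall>x\<in>verts G. C2_type G (g x) = C2_type G x) \<and>
      (\<forall>x\<in>verts G. \<forall>y\<in>verts G. E x y \<longleftrightarrow> adj G (g x) (g y))"
proof (cases "verts G = {}")
  case True
  then show ?thesis by (auto intro: exI[of _ id])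
next
  case False
  then obtain v where v: "v \<in> verts G" by blast
  let ?H = "graph_of (verts G) E"
  have H: "simple_graph ?H" and adjH: "adj ?H = E" using equitable_graph_of[OF eE] by auto
  obtain \<phi> where \<phi>: "\<phi> \<in> C 2" "free_vars \<phi> = {}" "models G \<phi>"
    and iso: "\<And>H :: nat graph. simple_graph H \<Longrightarrow> models H \<phi> \<Longrightarrow> isomorphic H G"
    using id unfolding identified_by_C_def by blast
  have fin: "finite (verts G)" using G by (simp add: simple_graph_def)
  \<comment> \<open>Identification quantifies over graphs on the natural numbers, so the graph is
    copied there.\<close>
  then obtain b :: "'a \<Rightarrow> nat" where b: "inj_on b (verts G)"
    using finite_imp_inj_to_nat_seg by blast
  let ?E = "\<lambda>m n. \<exists>x y. E x y \<and> m = b x \<and> n = b y"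
  let ?K = "graph_of (b ` verts G) ?E"
  have K: "simple_graph ?K"
    using equitableD[OF eE] b fin by (intro simple_graph_of) (auto simp: inj_on_def, metis)
  have adjK: "adj ?K m n \<longleftrightarrow> ?E m n" for m n
    using equitableD(2)[OF eE] by (intro adj_graph_of) blast
  have bK: "graph_iso b ?H ?K"
    unfolding graph_iso_adj adjH adjK verts_graph_of
  proof (intro conjI ballI iffI)
    show "bij_betw b (verts G) (b ` verts G)" using b by (simp add: bij_betw_def)
    fix x y assume xy: "x \<in> verts G" "y \<in> verts G"
    show "\<exists>x' y'. E x' y' \<and> b x = b x' \<and> b y = b y'" if "E x y" using that by blast
    assume "\<exists>x' y'. E x' y' \<and> b x = b x' \<and> b y = b y'"
    then obtain x' y' where "E x' y'" "b x = b x'" "b y = b y'" by blast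
    moreover from this have "x = x'" "y = y'"
      using b xy equitableD(4,5)[OF eE] by (auto dest: inj_onD)
    ultimately show "E x y" by simp
  qed
  have gm: "sat ?H (\<lambda>_. x) \<psi> \<longleftrightarrow> sat G (\<lambda>_. x) \<psi>" if "x \<in> verts G" "\<psi> \<in> C 2" for x \<psi>
    by (rule game[OF H G, where cG = "C2_type G" and cH = "C2_type G"])
      (use that in \<open>simp_all add: adjH equitableD(3,6)[OF eE] equitableD(3,6)[OF eG]\<close>)
  have "sat ?K s \<phi>" for s
  proof -
    have "sat G (\<lambda>_. v) \<phi>" using \<phi>(3) by (simp add: models_def)
    then have "sat ?H (\<lambda>_. v) \<phi>" using gm v \<phi>(1) by blast
    then have "sat ?K (b \<circ> (\<lambda>_. v)) \<phi>" using sat_iso[OF bK] v by auto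
    then show ?thesis using sat_cong[of \<phi> "b \<circ> (\<lambda>_. v)" s] \<phi>(2) by blast
  qed
  then have "models ?K \<phi>" by (simp add: models_def)
  with iso K obtain f where "graph_iso f ?K G" unfolding isomorphic_def by blast
  with bK have g: "graph_iso (f \<circ> b) ?H G" by (rule graph_iso_comp)
  let ?g = "f \<circ> b"
  have bij: "bij_betw ?g (verts G) (verts G)" using g by (simp add: graph_iso_def)
  have "C2_type G (?g x) = C2_type G x" if x: "x \<in> verts G" for x
  proof -
    have "sat G (\<lambda>_. ?g x) \<psi> \<longleftrightarrow> sat G (\<lambda>_. x) \<psi>" if "\<psi> \<in> C 2" for \<psi>
    proof -
      have "sat ?H (\<lambda>_. x) \<psi> \<longleftrightarrow> sat G (?g \<circ> (\<lambda>_. x)) \<psi>" by (rule sat_iso[OF g]) (use x in auto)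
      with gm[OF x that] show ?thesis by (simp add: comp_def)
    qed
    then show ?thesis by (auto simp: C2_type_def)
  qed
  moreover have "\<forall>x\<in>verts G. \<forall>y\<in>verts G. E x y \<longleftrightarrow> adj G (?g x) (?g y)"
    using g unfolding graph_iso_adj adjH by simp
  ultimately show ?thesis using bij by blast
qed

text \<open>Both relations are compared with one fixed \<open>E0\<close>, and one map is composed
  with the inverse of the other.\<close>

lemma rigidI_base:
  assumes "\<And>E. equitable V c D E \<Longrightarrow> \<exists>g. bij_betw g V V \<and> (\<forall>x\<in>V. c (g x) = c x) \<and>
      (\<forall>x\<in>V. \<forall>y\<in>V. E x y \<longleftrightarrow> E0 (g x) (g y))"
  shows "rigid V c D"
  unfolding rigid_def
proof (intro allI impI)
  fix E E' assume "equitable V c D E" "equitable V c D E'"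
  note eq = this
  obtain g where g: "bij_betw g V V" "\<forall>x\<in>V. c (g x) = c x" "\<forall>x\<in>V. \<forall>y\<in>V. E x y \<longleftrightarrow> E0 (g x) (g y)"
    using assms[OF eq(1)] by blast
  obtain h where h: "bij_betw h V V" "\<forall>x\<in>V. c (h x) = c x" "\<forall>x\<in>V. \<forall>y\<in>V. E' x y \<longleftrightarrow> E0 (h x) (h y)"
    using assms[OF eq(2)] by blast
  let ?k = "the_inv_into V h"
  have k: "bij_betw ?k V V" by (rule bij_betw_the_inv_into[OF h(1)])
  have kk: "?k (g x) \<in> V" "h (?k (g x)) = g x" if "x \<in> V" for x
    using bij_betw_apply[OF k bij_betw_apply[OF g(1) that]]
      f_the_inv_into_f_bij_betw[OF h(1)] bij_betw_apply[OF g(1) that] by blast+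
  have "bij_betw (?k \<circ> g) V V" using g(1) k by (rule bij_betw_trans)
  moreover have "c ((?k \<circ> g) x) = c x" if "x \<in> V" for x
    using bspec[OF h(2) kk(1)[OF that]] kk(2)[OF that] g(2) that by simp
  moreover have "E x y \<longleftrightarrow> E' ((?k \<circ> g) x) ((?k \<circ> g) y)" if "x \<in> V" "y \<in> V" for x y
    using h(3) kk[OF that(1)] kk[OF that(2)] g(3) that by simp
  ultimately show "\<exists>g. bij_betw g V V \<and> (\<forall>x\<in>V. c (g x) = c x) \<and>
      (\<forall>x\<in>V. \<forall>y\<in>V. E x y \<longleftrightarrow> E' (g x) (g y))" by blast
qed

text \<open>The sentence says that the class formulas split the vertices into classes of the right
  sizes with degrees \<open>D\<close>. In a model other than \<open>G\<close> these formulas need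
  not define types; they only serve as labels. Moving the edges of the model to the vertices of
  \<open>G\<close> along a bijection respecting the labels yields an equitable relation, to which
  rigidity applies.\<close>

lemma rigid_imp_identified:
  fixes G :: "'a graph"
  assumes G: "simple_graph G" and rig: "rigid (verts G) (C2_type G) D"
    and eG: "equitable (verts G) (C2_type G) D (adj G)"
  shows "identified_by_C 2 G"
proof -
  let ?V = "verts G" and ?c = "C2_type G"
  have fin: "finite ?V" using G by (simp add: simple_graph_def)
  obtain cs where cs: "set cs = ?c ` ?V" using finite_list[of "?c ` ?V"] fin by auto
  have "\<forall>i\<in>set cs. \<exists>\<theta>. \<theta> \<in> C 2 \<and> free_vars \<theta> \<subseteq> {0} \<and> (\<forall>w\<in>?V. sat G (\<lambda>_. w) \<theta> \<longleftrightarrow> ?c w = i)"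
    using class_formula[OF fin] unfolding cs by blast
  then obtain \<theta> where \<theta>: "\<And>i. i \<in> set cs \<Longrightarrow> \<theta> i \<in> C 2" "\<And>i. i \<in> set cs \<Longrightarrow> free_vars (\<theta> i) \<subseteq> {0}"
    "\<And>i w. i \<in> set cs \<Longrightarrow> w \<in> ?V \<Longrightarrow> sat G (\<lambda>_. w) (\<theta> i) \<longleftrightarrow> ?c w = i" by metis
  define n where "n i = card {w \<in> ?V. ?c w = i}" for i
  define \<phi>1 where "\<phi>1 = forall_fm 0 (Neg (conj_fm (map (\<lambda>i. Neg (\<theta> i)) cs)))"
  \<comment> \<open>The diagonal pairs receive the empty conjunction, which is true.\<close>
  define \<phi>2 where "\<phi>2 = conj_fm (map (\<lambda>(i, j). if i = j then conj_fm [] else forall_fm 0 (Neg (And (\<theta> i) (\<theta> j))))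
    (List.product cs cs))"
  define \<phi>3 where "\<phi>3 = conj_fm (map (\<lambda>i. exactly_fm (n i) 0 (\<theta> i)) cs)"
  define \<phi>4 where "\<phi>4 = conj_fm (map (\<lambda>(i, j). forall_fm 0 (Neg (And (\<theta> i)
    (Neg (exactly_fm (D i j) 1 (And (Edge 0 1) (swap_fm (\<theta> j)))))))) (List.product cs cs))"
  define \<phi> where "\<phi> = conj_fm [\<phi>1, \<phi>2, \<phi>3, \<phi>4]"
  have C2: "\<phi> \<in> C 2"
    unfolding \<phi>_def \<phi>1_def \<phi>2_def \<phi>3_def \<phi>4_def using \<theta>(1)
    by (auto intro!: conj_fm_C2 C2_intros swap_C2)
  have free: "free_vars \<phi> = {}"
    using \<theta>(2) unfolding \<phi>_def \<phi>1_def \<phi>2_def \<phi>3_def \<phi>4_def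
    by (fastforce simp: free_vars_swap swap01_def split: if_splits)
  have sat\<theta>: "sat H (s(0 := a)) (\<theta> i) \<longleftrightarrow> sat H (\<lambda>_. a) (\<theta> i)"
      "sat H (s(0 := a, Suc 0 := b)) (swap_fm (\<theta> i)) \<longleftrightarrow> sat H (\<lambda>_. b) (\<theta> i)"
    if "i \<in> set cs" for H :: "('b, 'm) graph_scheme" and s a b i
    using sat_free0[OF \<theta>(2)[OF that], of H "s(0 := a)"]
      sat_free0[OF \<theta>(2)[OF that], of H "(s(0 := a, Suc 0 := b)) \<circ> swap01"]
    by (simp_all only: sat_swap) (simp_all add: swap01_def)
  have sat\<phi>: "sat H s \<phi> \<longleftrightarrow> (\<forall>a\<in>verts H. \<exists>i\<in>set cs. sat H (\<lambda>_. a) (\<theta> i)) \<and>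
      (\<forall>i\<in>set cs. \<forall>j\<in>set cs. i \<noteq> j \<longrightarrow> (\<forall>a\<in>verts H. \<not> (sat H (\<lambda>_. a) (\<theta> i) \<and> sat H (\<lambda>_. a) (\<theta> j)))) \<and>
      (\<forall>i\<in>set cs. card {a \<in> verts H. sat H (\<lambda>_. a) (\<theta> i)} = n i) \<and>
      (\<forall>i\<in>set cs. \<forall>j\<in>set cs. \<forall>a\<in>verts H. sat H (\<lambda>_. a) (\<theta> i) \<longrightarrow>
         card {b \<in> verts H. adj H a b \<and> sat H (\<lambda>_. b) (\<theta> j)} = D i j)"
    if "finite (verts H)" for H :: "('b, 'm) graph_scheme" and s
  proof -
    have 1: "sat H s \<phi>1 \<longleftrightarrow> (\<forall>a\<in>verts H. \<exists>i\<in>set cs. sat H (\<lambda>_. a) (\<theta> i))"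
      unfolding \<phi>1_def by (simp add: that sat\<theta>(1) cong: conj_cong)
    have 2: "sat H s \<phi>2 \<longleftrightarrow> (\<forall>i\<in>set cs. \<forall>j\<in>set cs. i \<noteq> j \<longrightarrow>
        (\<forall>a\<in>verts H. \<not> (sat H (\<lambda>_. a) (\<theta> i) \<and> sat H (\<lambda>_. a) (\<theta> j))))"
      unfolding \<phi>2_def by (auto simp: that sat\<theta>(1))
    have 3: "sat H s \<phi>3 \<longleftrightarrow> (\<forall>i\<in>set cs. card {a \<in> verts H. sat H (\<lambda>_. a) (\<theta> i)} = n i)"
      unfolding \<phi>3_def by (simp add: that sat\<theta>(1) cong: conj_cong)
    have 4: "sat H s \<phi>4 \<longleftrightarrow> (\<forall>i\<in>set cs. \<forall>j\<in>set cs. \<forall>a\<in>verts H. sat H (\<lambda>_. a) (\<theta> i) \<longrightarrow>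
         card {b \<in> verts H. adj H a b \<and> sat H (\<lambda>_. b) (\<theta> j)} = D i j)"
      unfolding \<phi>4_def by (auto simp: that sat\<theta> adj_def)
    show ?thesis unfolding \<phi>_def using 1 2 3 4 by simp
  qed
  have "sat G s \<phi>" for s
  proof -
    have "{b \<in> ?V. adj G a b \<and> sat G (\<lambda>_. b) (\<theta> j)} = {b \<in> ?V. ?c b = j \<and> adj G a b}"
      if "j \<in> set cs" for a j using \<theta>(3) that by auto
    then show ?thesis
      unfolding sat\<phi>[OF fin] using \<theta>(3) cs equitableD(6)[OF eG]
      by (auto simp: n_def intro!: arg_cong[of _ _ card])
  qed
  then have "models G \<phi>" by (simp add: models_def)
  moreover have "isomorphic H G" if H: "simple_graph H" and mod: "models H \<phi>" for H :: "nat graph"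
  proof -
    have finH: "finite (verts H)" using H by (simp add: simple_graph_def)
    have "sat H (\<lambda>_. 0) \<phi>" using mod by (simp add: models_def)
    note sH = this[unfolded sat\<phi>[OF finH]]
    note sH1 = conjunct1[OF sH] and sH2 = conjunct1[OF conjunct2[OF sH]]
      and sH3 = conjunct1[OF conjunct2[OF conjunct2[OF sH]]]
      and sH4 = conjunct2[OF conjunct2[OF conjunct2[OF sH]]]
    define cH where "cH a = (SOME i. i \<in> set cs \<and> sat H (\<lambda>_. a) (\<theta> i))" for a
    have "cH a \<in> set cs \<and> sat H (\<lambda>_. a) (\<theta> (cH a))" if "a \<in> verts H" for a
      unfolding cH_def by (rule someI_ex) (use sH that in blast)
    note cH0 = this
    have cH2: "cH a \<in> set cs" if "a \<in> verts H" for a using cH0[OF that] by blast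
    have cH1: "sat H (\<lambda>_. a) (\<theta> i) \<longleftrightarrow> cH a = i" if "a \<in> verts H" "i \<in> set cs" for a i
    proof
      assume "sat H (\<lambda>_. a) (\<theta> i)"
      then show "cH a = i" using sH2 cH0[OF that(1)] that by blast
    qed (use cH0[OF that(1)] in blast)
    have "\<exists>h. bij_betw h (verts H) ?V \<and> (\<forall>a\<in>verts H. ?c (h a) = cH a)"
    proof (rule fiber_bij[OF finH fin])
      fix k
      show "card {a \<in> verts H. cH a = k} = card {b \<in> ?V. ?c b = k}"
      proof (cases "k \<in> set cs")
        case True
        then have "{a \<in> verts H. cH a = k} = {a \<in> verts H. sat H (\<lambda>_. a) (\<theta> k)}" using cH1 by auto
        then show ?thesis using sH3 True by (simp add: n_def)
      next
        case False
        have "{a \<in> verts H. cH a = k} = {}" "{b \<in> ?V. ?c b = k} = {}"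
          using False cH2 cs by blast+
        then show ?thesis by (simp only: card.empty)
      qed
    qed
    then obtain h where h: "bij_betw h (verts H) ?V" "\<And>a. a \<in> verts H \<Longrightarrow> ?c (h a) = cH a" by blast
    let ?k = "the_inv_into (verts H) h"
    have k: "bij_betw ?k ?V (verts H)" by (rule bij_betw_the_inv_into[OF h(1)])
    have hk: "h (?k x) = x" if "x \<in> ?V" for x by (rule f_the_inv_into_f_bij_betw[OF h(1) that])
    have kh: "?k (h x) = x" if "x \<in> verts H" for x
      using h(1) that by (simp add: bij_betw_def the_inv_into_f_f)
    have kV: "?k x \<in> verts H" if "x \<in> ?V" for x by (rule bij_betw_apply[OF k that])
    have ck: "cH (?k x) = ?c x" if "x \<in> ?V" for x using h(2)[OF kV[OF that]] hk[OF that] by simp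
    \<comment> \<open>The edges of the model, read on the vertices of \<open>G\<close>.\<close>
    define E where "E x y \<longleftrightarrow> x \<in> ?V \<and> y \<in> ?V \<and> adj H (?k x) (?k y)" for x y
    have "equitable ?V ?c D E"
      unfolding equitable_def
    proof (intro conjI allI ballI impI fin)
      fix x j assume x: "x \<in> ?V"
      have "card {y \<in> ?V. ?c y = j \<and> E x y} = card {b \<in> verts H. cH b = j \<and> adj H (?k x) b}"
        by (rule bij_betw_card_Collect[OF k]) (use ck x in \<open>auto simp: E_def\<close>)
      also have "\<dots> = D (?c x) j"
      proof (cases "j \<in> set cs")
        case True
        have "{b \<in> verts H. cH b = j \<and> adj H (?k x) b} =
            {b \<in> verts H. adj H (?k x) b \<and> sat H (\<lambda>_. b) (\<theta> j)}" using cH1 True by auto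
        moreover have "?c x \<in> set cs" using x cs by simp
        moreover have "sat H (\<lambda>_. ?k x) (\<theta> (?c x))" using cH0[OF kV[OF x]] ck[OF x] by simp
        ultimately show ?thesis using sH4 kV[OF x] True by simp
      next
        case False
        then have "{b \<in> verts H. cH b = j \<and> adj H (?k x) b} = {}" "{y \<in> ?V. ?c y = j \<and> adj G x y} = {}"
          using cH2 cs by blast+
        then show ?thesis using equitableD(6)[OF eG x, of j] by (simp only: card.empty)
      qed
      finally show "card {y \<in> ?V. ?c y = j \<and> E x y} = D (?c x) j" .
    qed (use simple_graph_adj[OF H] in \<open>auto simp: E_def dest: adj_sym\<close>)
    with rig eG obtain g where g: "bij_betw g ?V ?V" "\<forall>x\<in>?V. \<forall>y\<in>?V. E x y \<longleftrightarrow> adj G (g x) (g y)"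
      unfolding rigid_def by blast
    have "graph_iso (g \<circ> h) H G"
      unfolding graph_iso_adj
    proof (intro conjI ballI)
      show "bij_betw (g \<circ> h) (verts H) ?V" using h(1) g(1) by (rule bij_betw_trans)
      fix v w assume vw: "v \<in> verts H" "w \<in> verts H"
      then have "h v \<in> ?V" "h w \<in> ?V" using bij_betw_apply[OF h(1)] by blast+
      then show "adj H v w \<longleftrightarrow> adj G ((g \<circ> h) v) ((g \<circ> h) w)"
        using bspec[OF bspec[OF g(2)], of "h v" "h w"] kh[OF vw(1)] kh[OF vw(2)] by (simp add: E_def)
    qed
    then show ?thesis by (auto simp: isomorphic_def)
  qed
  ultimately show ?thesis unfolding identified_by_C_def using C2 free by blast
qed

subsection \<open>Flips\<close>

definition flip_rel :: "'a set \<Rightarrow> ('a \<Rightarrow> 'c) \<Rightarrow> ('c \<Rightarrow> 'c \<Rightarrow> bool) \<Rightarrow> ('a \<Rightarrow> 'a \<Rightarrow> bool) \<Rightarrow> 'a \<Rightarrow> 'a \<Rightarrow> bool" where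
  "flip_rel V c f E x y \<longleftrightarrow> x \<in> V \<and> y \<in> V \<and> x \<noteq> y \<and> E x y \<noteq> f (c x) (c y)"

definition flip_deg :: "'a set \<Rightarrow> ('a \<Rightarrow> 'c) \<Rightarrow> ('c \<Rightarrow> 'c \<Rightarrow> bool) \<Rightarrow> ('c \<Rightarrow> 'c \<Rightarrow> nat) \<Rightarrow> 'c \<Rightarrow> 'c \<Rightarrow> nat" where
  "flip_deg V c f D i j = (if f i j then card {y \<in> V. c y = j} - (if i = j then 1 else 0) - D i j else D i j)"

lemma equitable_flip:
  assumes E: "equitable V c D E" and f: "\<And>i j. f i j \<longleftrightarrow> f j i"
  shows "equitable V c (flip_deg V c f D) (flip_rel V c f E)"
  unfolding equitable_def
proof (intro conjI allI impI ballI)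
  show fin: "finite V" using equitableD(1)[OF E] .
  fix x y assume "flip_rel V c f E x y"
  then show "flip_rel V c f E y x" "x \<noteq> y" "x \<in> V" "y \<in> V"
    using f[of "c x" "c y"] equitableD(2)[OF E] by (auto simp: flip_rel_def)
next
  have fin: "finite V" using equitableD(1)[OF E] .
  fix x j assume x: "x \<in> V"
  let ?A = "{y \<in> V. c y = j}" and ?N = "{y \<in> V. c y = j \<and> E x y}"
  show "card {y \<in> V. c y = j \<and> flip_rel V c f E x y} = flip_deg V c f D (c x) j"
  proof (cases "f (c x) j")
    case False
    then have "{y \<in> V. c y = j \<and> flip_rel V c f E x y} = ?N"
      using x equitableD(3)[OF E] by (auto simp: flip_rel_def)
    then show ?thesis using False equitableD(6)[OF E x, of j] by (simp add: flip_deg_def)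
  next
    case True
    then have "{y \<in> V. c y = j \<and> flip_rel V c f E x y} = ?A - {x} - ?N"
      using x by (auto simp: flip_rel_def)
    moreover have "?N \<subseteq> ?A - {x}" using equitableD(3)[OF E] by auto
    moreover have "card (?A - {x}) = card ?A - (if c x = j then 1 else 0)"
      using x fin by auto
    ultimately show ?thesis
      using True fin equitableD(6)[OF E x, of j] by (simp add: card_Diff_subset flip_deg_def)
  qed
qed

lemma equitable_cong:
  assumes "equitable V c D E" "\<And>x j. x \<in> V \<Longrightarrow> D (c x) j = D' (c x) j"
  shows "equitable V c D' E"
  using assms unfolding equitable_def by simp

text \<open>Flipping depends on colours only, so a colour-preserving bijection that matches the
  flipped relations matches the relations themselves.\<close>

lemma rigid_transfer:
  assumes "rigid V c D" "\<And>E. equitable V c D' E \<Longrightarrow> equitable V c D (flip_rel V c f E)"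
  shows "rigid V c D'"
  unfolding rigid_def
proof (intro allI impI)
  fix E E' assume E: "equitable V c D' E" "equitable V c D' E'"
  obtain g where g: "bij_betw g V V" "\<forall>x\<in>V. c (g x) = c x"
    "\<forall>x\<in>V. \<forall>y\<in>V. flip_rel V c f E x y \<longleftrightarrow> flip_rel V c f E' (g x) (g y)"
    using assms(1) assms(2)[OF E(1)] assms(2)[OF E(2)] unfolding rigid_def by blast
  have "E x y \<longleftrightarrow> E' (g x) (g y)" if xy: "x \<in> V" "y \<in> V" for x y
  proof (cases "x = y")
    case True
    then show ?thesis using equitableD(3)[OF E(1)] equitableD(3)[OF E(2)] by simp
  next
    case False
    then have "g x \<noteq> g y" using g(1) xy by (auto simp: bij_betw_def dest: inj_onD)
    moreover have "g x \<in> V" "g y \<in> V" using bij_betw_apply[OF g(1)] xy by blast+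
    ultimately show ?thesis using g(2,3) xy False unfolding flip_rel_def by (metis (mono_tags))
  qed
  with g show "\<exists>g. bij_betw g V V \<and> (\<forall>x\<in>V. c (g x) = c x) \<and>
      (\<forall>x\<in>V. \<forall>y\<in>V. E x y \<longleftrightarrow> E' (g x) (g y))" by blast
qed

text \<open>Flipping twice restores the degrees. The truncated subtractions are exact because a
  vertex has at most as many neighbours of a colour as there are other vertices of that colour; the
  realization \<open>E0\<close> is the source of this bound.\<close>

lemma rigid_flip:
  assumes E0: "equitable V c D E0" and f: "\<And>i j. f i j \<longleftrightarrow> f j i"
  shows "rigid V c (flip_deg V c f D) \<longleftrightarrow> rigid V c D"
proof
  assume r: "rigid V c (flip_deg V c f D)"
  show "rigid V c D" by (rule rigid_transfer[OF r equitable_flip[OF _ f]])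
next
  assume r: "rigid V c D"
  show "rigid V c (flip_deg V c f D)"
  proof (rule rigid_transfer[OF r])
    fix E assume "equitable V c (flip_deg V c f D) E"
    then have *: "equitable V c (flip_deg V c f (flip_deg V c f D)) (flip_rel V c f E)"
      using f by (rule equitable_flip)
    have "flip_deg V c f (flip_deg V c f D) (c x) j = D (c x) j" if x: "x \<in> V" for x j
    proof -
      have fin: "finite V" using equitableD(1)[OF E0] .
      have "D (c x) j = card {y \<in> V. c y = j \<and> E0 x y}" using equitableD(6)[OF E0 x] by simp
      also have "\<dots> \<le> card ({y \<in> V. c y = j} - {x})"
        using equitableD(3)[OF E0] fin by (intro card_mono) auto
      also have "\<dots> = card {y \<in> V. c y = j} - (if c x = j then 1 else 0)"
        using x fin by auto
      finally show ?thesis unfolding flip_deg_def by auto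
    qed
    then show "equitable V c D (flip_rel V c f E)" by (rule equitable_cong[OF *])
  qed
qed

section \<open>Degrees in the flip\<close>

text \<open>Half of the largest possible degree, which is the class size, or one less inside a
  class. Adding 1 on the left avoids a subtraction.\<close>

definition minority :: "'a set \<Rightarrow> ('a \<Rightarrow> 'c) \<Rightarrow> ('c \<Rightarrow> 'c \<Rightarrow> nat) \<Rightarrow> bool" where
  "minority V c D \<longleftrightarrow> (\<forall>x\<in>V. \<forall>y\<in>V. 2 * D (c x) (c y) + (if c x = c y then 1 else 0) \<le> card {z \<in> V. c z = c y})"

lemma card_pairs_in_class:
  assumes E: "equitable V c D E"
  shows "card {(x, y). x \<in> V \<and> y \<in> V \<and> c x = i \<and> c y = j \<and> E x y} = card {x \<in> V. c x = i} * D i j"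
proof -
  have fin: "finite V" using equitableD(1)[OF E] .
  have "{(x, y). x \<in> V \<and> y \<in> V \<and> c x = i \<and> c y = j \<and> E x y} =
      (SIGMA x:{x \<in> V. c x = i}. {y \<in> V. c y = j \<and> E x y})" by auto
  also have "card \<dots> = (\<Sum>x\<in>{x \<in> V. c x = i}. card {y \<in> V. c y = j \<and> E x y})"
    using fin by (intro card_SigmaI) auto
  also have "\<dots> = (\<Sum>x\<in>{x \<in> V. c x = i}. D i j)"
    using equitableD(6)[OF E] by (intro sum.cong) auto
  finally show ?thesis by simp
qed

text \<open>Double counting of the edges between two classes.\<close>

lemma degree_symmetry:
  assumes E: "equitable V c D E"
  shows "card {x \<in> V. c x = i} * D i j = card {x \<in> V. c x = j} * D j i"
proof -
  let ?A = "\<lambda>i j. {(x, y). x \<in> V \<and> y \<in> V \<and> c x = i \<and> c y = j \<and> E x y}"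
  have "bij_betw prod.swap (?A i j) (?A j i)"
    using equitableD(2)[OF E] by (auto simp: bij_betw_def inj_on_def image_iff)
  then have "card (?A i j) = card (?A j i)" by (rule bij_betw_same_card)
  then show ?thesis by (simp add: card_pairs_in_class[OF E])
qed

text \<open>The handshake lemma. It handles pairs inside one class here and gives the parity for
  regular graphs later.\<close>

lemma card_ordered_pairs:
  assumes fin: "finite V" and sym: "\<And>x y. R x y \<Longrightarrow> R y x" and irr: "\<And>x. \<not> R x x"
    and V: "\<And>x y. R x y \<Longrightarrow> x \<in> V \<and> y \<in> V"
  shows "card {(x, y). R x y} = 2 * card {{x, y} | x y. R x y}"
proof -
  let ?P = "{{x, y} | x y. R x y}"
  let ?F = "\<lambda>e. {(x, y). R x y \<and> {x, y} = e}"
  have finP: "finite ?P" by (rule finite_subset[of _ "Pow V"]) (use V fin in auto)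
  have finR: "finite {(x, y). R x y}" by (rule finite_subset[of _ "V \<times> V"]) (use V fin in auto)
  have "{(x, y). R x y} = (\<Union>e\<in>?P. ?F e)" by auto
  also have "card \<dots> = (\<Sum>e\<in>?P. card (?F e))"
    using finP by (intro card_UN_disjoint) (auto intro!: finite_subset[OF _ finR])
  also have "\<dots> = (\<Sum>e\<in>?P. 2)"
  proof (rule sum.cong)
    fix e assume "e \<in> ?P"
    then obtain x y where e: "e = {x, y}" and xy: "R x y" by blast
    then have "?F e = {(x, y), (y, x)}" using sym by (auto simp: doubleton_eq_iff)
    moreover have "x \<noteq> y" using xy irr by blast
    ultimately show "card (?F e) = 2" by simp
  qed simp
  finally show ?thesis by simp
qed

definition majority :: "'a graph \<Rightarrow> fm set \<Rightarrow> fm set \<Rightarrow> bool" where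
  "majority G i j \<longleftrightarrow> (let B = pairs_between {w \<in> verts G. C2_type G w = i} {w \<in> verts G. C2_type G w = j}
    in card (B \<inter> edges G) > card (B - edges G))"

lemma pairs_between_commute: "pairs_between P Q = pairs_between Q P"
  by (auto simp: pairs_between_def insert_commute)

lemma majority_commute: "majority G i j \<longleftrightarrow> majority G j i"
  by (simp add: majority_def pairs_between_commute[of "{w \<in> verts G. C2_type G w = i}"])

text \<open>A pair determines the classes of its ends up to order, so membership in the union over
  all pairs of classes comes down to these two.\<close>

lemma flipped_pairs_iff:
  assumes "x \<in> verts G" "y \<in> verts G" "x \<noteq> y"
  shows "{x, y} \<in> flipped_pairs G \<longleftrightarrow> majority G (C2_type G x) (C2_type G y)"
proof
  let ?cl = "\<lambda>i. {w \<in> verts G. C2_type G w = i}"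
  assume "{x, y} \<in> flipped_pairs G"
  then obtain P Q where PQ: "P \<in> C2_partition G" "Q \<in> C2_partition G" "{x, y} \<in> pairs_between P Q"
    "card (pairs_between P Q \<inter> edges G) > card (pairs_between P Q - edges G)"
    unfolding flipped_pairs_def by blast
  from PQ(1,2) obtain v w where vw: "P = ?cl (C2_type G v)" "Q = ?cl (C2_type G w)"
    unfolding C2_partition_def by blast
  from PQ(3) have "x \<in> P \<and> y \<in> Q \<or> x \<in> Q \<and> y \<in> P"
    by (auto simp: pairs_between_def doubleton_eq_iff)
  then have "P = ?cl (C2_type G x) \<and> Q = ?cl (C2_type G y) \<or> Q = ?cl (C2_type G x) \<and> P = ?cl (C2_type G y)"
    unfolding vw by auto
  then show "majority G (C2_type G x) (C2_type G y)"
    using PQ(4) pairs_between_commute[of P Q] unfolding majority_def Let_def by auto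
next
  assume *: "majority G (C2_type G x) (C2_type G y)"
  let ?P = "{w \<in> verts G. C2_type G w = C2_type G x}" and ?Q = "{w \<in> verts G. C2_type G w = C2_type G y}"
  have "?P \<in> C2_partition G" "?Q \<in> C2_partition G" using assms by (auto simp: C2_partition_def)
  moreover have "{x, y} \<in> pairs_between ?P ?Q" using assms by (auto simp: pairs_between_def)
  ultimately show "{x, y} \<in> flipped_pairs G"
    unfolding flipped_pairs_def using * unfolding majority_def Let_def by blast
qed

lemma flipped_pairsE:
  assumes "e \<in> flipped_pairs G"
  obtains x y where "e = {x, y}" "x \<in> verts G" "y \<in> verts G" "x \<noteq> y"
  using assms unfolding flipped_pairs_def C2_partition_def pairs_between_def by blast

lemma adj_flip:
  assumes G: "simple_graph G"
  shows "adj (flip G) = flip_rel (verts G) (C2_type G) (majority G) (adj G)"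
proof (intro ext)
  fix x y
  show "adj (flip G) x y = flip_rel (verts G) (C2_type G) (majority G) (adj G) x y"
  proof (cases "x \<in> verts G \<and> y \<in> verts G \<and> x \<noteq> y")
    case True
    then have "{x, y} \<in> flipped_pairs G \<longleftrightarrow> majority G (C2_type G x) (C2_type G y)"
      by (intro flipped_pairs_iff) auto
    then show ?thesis using True by (auto simp: flip_def adj_def flip_rel_def)
  next
    case False
    have "{x, y} \<notin> edges G" using simple_graph_adj[OF G] False by (auto simp: adj_def)
    moreover have "{x, y} \<notin> flipped_pairs G"
      using False by (auto elim!: flipped_pairsE simp: doubleton_eq_iff)
    ultimately show ?thesis using False by (auto simp: flip_def adj_def flip_rel_def)
  qed
qed

lemma simple_graph_flip:
  assumes "simple_graph G"
  shows "simple_graph (flip G)"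
  using assms by (auto simp: simple_graph_def flip_def elim!: flipped_pairsE)

lemma verts_flip [simp]: "verts (flip G) = verts G" and color_flip [simp]: "color (flip G) = C2_type G"
  by (simp_all add: flip_def)

text \<open>After the flip, edges make up at most half of the pairs between two classes. All
  vertices of a class have the same degree, so the bound on the total bounds each degree.\<close>

lemma flip_minority:
  assumes G: "simple_graph G"
    and E: "equitable (verts G) (C2_type G) D (adj (flip G))"
  shows "minority (verts G) (C2_type G) D"
  unfolding minority_def
proof (intro ballI)
  let ?V = "verts G" and ?c = "C2_type G" and ?F = "adj (flip G)"
  fix x y assume xy: "x \<in> ?V" "y \<in> ?V"
  let ?i = "?c x" and ?j = "?c y"
  let ?P = "{w \<in> ?V. ?c w = ?i}" and ?Q = "{w \<in> ?V. ?c w = ?j}"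
  let ?B = "pairs_between ?P ?Q"
  have fin: "finite ?V" using G by (simp add: simple_graph_def)
  have irr: "\<not> ?F v v" for v using equitableD(3)[OF E] .
  have finP: "finite ?P" "finite ?Q" using fin by auto
  have finB: "finite ?B" by (rule finite_subset[of _ "Pow ?V"]) (use fin in \<open>auto simp: pairs_between_def\<close>)
  have flip: "{v, w} \<in> edges (flip G) \<longleftrightarrow> ({v, w} \<in> edges G) \<noteq> majority G ?i ?j"
    if "v \<in> ?P" "w \<in> ?Q" "v \<noteq> w" for v w
    using that adj_flip[OF G] by (simp add: adj_def[symmetric] flip_rel_def)
  have B: "card (?B \<inter> edges (flip G)) \<le> card (?B - edges (flip G))"
  proof (cases "majority G ?i ?j")
    case True
    then have "?B \<inter> edges (flip G) = ?B - edges G" "?B - edges (flip G) = ?B \<inter> edges G"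
      using flip unfolding pairs_between_def by blast+
    then show ?thesis using True by (simp add: majority_def Let_def)
  next
    case False
    then have "?B \<inter> edges (flip G) = ?B \<inter> edges G" "?B - edges (flip G) = ?B - edges G"
      using flip unfolding pairs_between_def by blast+
    then show ?thesis using False by (simp add: majority_def Let_def)
  qed
  have "card ?B = card (?B \<inter> edges (flip G)) + card (?B - edges (flip G))"
    using card_Int_Diff[OF finB] by (simp add: Int_commute)
  with B have B2: "2 * card (?B \<inter> edges (flip G)) \<le> card ?B" by simp
  have memB: "e \<in> ?B \<inter> edges (flip G) \<longleftrightarrow> (\<exists>v w. e = {v, w} \<and> v \<in> ?P \<and> w \<in> ?Q \<and> ?F v w)" for e
  proof
    assume "e \<in> ?B \<inter> edges (flip G)"
    then show "\<exists>v w. e = {v, w} \<and> v \<in> ?P \<and> w \<in> ?Q \<and> ?F v w"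
      unfolding pairs_between_def adj_def by blast
  next
    assume "\<exists>v w. e = {v, w} \<and> v \<in> ?P \<and> w \<in> ?Q \<and> ?F v w"
    then obtain v w where vw: "e = {v, w}" "v \<in> ?P" "w \<in> ?Q" "?F v w" by blast
    then have "v \<noteq> w" using irr by blast
    with vw(1-3) have "e \<in> ?B" unfolding pairs_between_def by blast
    then show "e \<in> ?B \<inter> edges (flip G)" using vw(1,4) by (simp add: adj_def)
  qed
  have cP: "card ?P > 0" using finP xy by (auto simp: card_gt_0_iff)
  let ?O = "{(v, w). v \<in> ?V \<and> w \<in> ?V \<and> ?c v = ?i \<and> ?c w = ?j \<and> ?F v w}"
  have O: "card ?O = card ?P * D ?i ?j" by (rule card_pairs_in_class[OF E])
  show "2 * D ?i ?j + (if ?i = ?j then 1 else 0) \<le> card ?Q"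
  proof (cases "?i = ?j")
    case False
    \<comment> \<open>Between different classes, unordered pairs correspond to the elements of the
      product.\<close>
    let ?h = "\<lambda>(v, w). {v, w}"
    have inj: "inj_on ?h (?P \<times> ?Q)"
      using False by (auto simp: inj_on_def doubleton_eq_iff)
    have "?h ` ?O = ?B \<inter> edges (flip G)"
      by (rule set_eqI, unfold memB) auto
    then have img: "?B \<inter> edges (flip G) = ?h ` ?O" by (rule sym)
    have "inj_on ?h ?O" by (rule inj_on_subset[OF inj]) blast
    then have 1: "card (?B \<inter> edges (flip G)) = card ?O" unfolding img by (rule card_image)
    have "v \<noteq> w" if "v \<in> ?P" "w \<in> ?Q" for v w using that False by auto
    then have B': "e \<in> ?B \<longleftrightarrow> (\<exists>v w. e = {v, w} \<and> v \<in> ?P \<and> w \<in> ?Q)" for e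
      unfolding pairs_between_def by blast
    have "?h ` (?P \<times> ?Q) = ?B" by (rule set_eqI, unfold B') auto
    then have 2: "card ?B = card ?P * card ?Q" using card_image[OF inj] by (simp add: card_cartesian_product)
    have "card ?P * (2 * D ?i ?j) \<le> card ?P * card ?Q" using B2 1 2 O by simp
    then show ?thesis using cP False by simp
  next
    case True
    \<comment> \<open>Inside one class each unordered pair arises from two ordered ones, and a
      vertex has one partner fewer than the class has members.\<close>
    have "card {(v, w). v \<in> ?P \<and> w \<in> ?P \<and> v \<noteq> w} = 2 * card {{v, w} | v w. v \<in> ?P \<and> w \<in> ?P \<and> v \<noteq> w}"
      by (rule card_ordered_pairs[OF fin]) auto
    moreover have "{{v, w} | v w. v \<in> ?P \<and> w \<in> ?P \<and> v \<noteq> w} = ?B"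
      unfolding True[symmetric] pairs_between_def by blast
    moreover have "{(v, w). v \<in> ?P \<and> w \<in> ?P \<and> v \<noteq> w} = (SIGMA v:?P. ?P - {v})" by auto
    moreover have "card (SIGMA v:?P. ?P - {v}) = (\<Sum>v\<in>?P. card (?P - {v}))"
      using finP by (intro card_SigmaI) auto
    moreover have "(\<Sum>v\<in>?P. card (?P - {v})) = (\<Sum>v\<in>?P. card ?P - 1)"
      using finP by (intro sum.cong) auto
    ultimately have 2: "2 * card ?B = card ?P * (card ?P - 1)" by simp
    let ?R = "\<lambda>v w. v \<in> ?V \<and> w \<in> ?V \<and> ?c v = ?i \<and> ?c w = ?j \<and> ?F v w"
    have "card ?O = 2 * card {{v, w} | v w. ?R v w}"
      by (rule card_ordered_pairs[OF fin]) (use True irr equitableD(2)[OF E] in auto)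
    moreover have "{{v, w} | v w. ?R v w} = ?B \<inter> edges (flip G)"
      by (rule set_eqI, unfold memB) auto
    ultimately have 1: "card ?O = 2 * card (?B \<inter> edges (flip G))" by simp
    have "card ?P * (2 * D ?i ?j) \<le> card ?P * (card ?P - 1)" using B2 1 2 O by linarith
    then have "2 * D ?i ?j \<le> card ?P - 1" using cP by simp
    then have "2 * D ?i ?j + 1 \<le> card ?P" using cP by linarith
    then show ?thesis using True by simp
  qed
qed

text \<open>The end of the logical part: from here on types are mere colours, and only the degrees
  of the flip matter.\<close>

lemma identified_iff_rigid_flip:
  assumes G: "simple_graph G"
  obtains D where "equitable (verts G) (C2_type G) D (adj (flip G))" "minority (verts G) (C2_type G) D"
    "identified_by_C 2 G \<longleftrightarrow> rigid (verts G) (C2_type G) D"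
proof -
  let ?V = "verts G" and ?c = "C2_type G"
  \<comment> \<open>Degrees are read off a representative; by \<open>C2_type_degree\<close> every
    vertex of the type gives the same numbers.\<close>
  define D where "D i j = card {y \<in> ?V. ?c y = j \<and> adj G (SOME x. x \<in> ?V \<and> ?c x = i) y}" for i j
  have eG: "equitable ?V ?c D (adj G)"
  proof (rule equitable_adj[OF G])
    fix x j assume x: "x \<in> ?V"
    let ?x = "SOME z. z \<in> ?V \<and> ?c z = ?c x"
    have "?x \<in> ?V \<and> ?c ?x = ?c x" by (rule someI[of _ x]) (use x in simp)
    then show "card {y \<in> ?V. ?c y = j \<and> adj G x y} = D (?c x) j"
      unfolding D_def using C2_type_degree[OF G x, of ?x j] by simp
  qed
  have "identified_by_C 2 G \<longleftrightarrow> rigid ?V ?c D"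
  proof
    assume "identified_by_C 2 G"
    then show "rigid ?V ?c D" by (intro rigidI_base[where ?E0.0 = "adj G"] identified_imp_iso[OF G _ eG])
  qed (rule rigid_imp_identified[OF G _ eG])
  also have "\<dots> \<longleftrightarrow> rigid ?V ?c (flip_deg ?V ?c (majority G) D)"
    by (rule rigid_flip[OF eG majority_commute, symmetric])
  finally have "identified_by_C 2 G \<longleftrightarrow> \<dots>" .
  moreover have "equitable ?V ?c (flip_deg ?V ?c (majority G) D) (adj (flip G))"
    unfolding adj_flip[OF G] by (rule equitable_flip[OF eG majority_commute])
  ultimately show ?thesis using that flip_minority[OF G] by blast
qed

subsection \<open>Leaf classes\<close>

definition part :: "'a set \<Rightarrow> ('a \<Rightarrow> 'c) \<Rightarrow> 'c set \<Rightarrow> 'a set" where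
  "part V c J = {v \<in> V. c v \<in> J}"

definition leaf_class :: "('c \<Rightarrow> 'c \<Rightarrow> nat) \<Rightarrow> 'c set \<Rightarrow> 'c \<Rightarrow> bool" where
  "leaf_class D J i \<longleftrightarrow> i \<in> J \<and> (\<exists>k\<in>J. k \<noteq> i \<and> D i k = 1 \<and> (\<forall>j\<in>J. j \<noteq> k \<longrightarrow> D i j = 0))"

inductive reach :: "('c \<Rightarrow> 'c \<Rightarrow> nat) \<Rightarrow> 'c set \<Rightarrow> 'c set \<Rightarrow> bool" for D J0 where
  start: "reach D J0 J0"
| step: "reach D J0 J \<Longrightarrow> leaf_class D J i \<Longrightarrow> reach D J0 (J - {i})"

definition reduced :: "'a set \<Rightarrow> ('a \<Rightarrow> 'c) \<Rightarrow> ('c \<Rightarrow> 'c \<Rightarrow> nat) \<Rightarrow> 'c set \<Rightarrow> bool" where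
  "reduced V c D J \<longleftrightarrow> (\<forall>i\<in>J. (\<forall>j\<in>J. j \<noteq> i \<longrightarrow> D i j = 0) \<and>
    (D i i = 0 \<or> D i i = 1 \<or> D i i = 2 \<and> card {v \<in> V. c v = i} = 5))"

lemma reach_subset: "reach D J0 J \<Longrightarrow> J \<subseteq> J0"
  by (induction rule: reach.induct) auto

text \<open>Induction against the order of deletion: deleted classes are put back until
  \<open>J0\<close> is reached.\<close>

lemma reach_up:
  assumes "reach D J0 J" "P J"
    and "\<And>J i. reach D J0 J \<Longrightarrow> leaf_class D J i \<Longrightarrow> P (J - {i}) \<Longrightarrow> P J"
  shows "P J0"
  using assms(1,2) by (induction rule: reach.induct) (use assms(3) in blast)+

lemma reach_terminal:
  assumes "finite J0"
  shows "\<exists>J. reach D J0 J \<and> (\<nexists>i. leaf_class D J i)"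
proof -
  have "reach D J0 J \<Longrightarrow> ?thesis" for J
  proof (induction "card J" arbitrary: J rule: less_induct)
    case less
    show ?case
    proof (cases "\<exists>i. leaf_class D J i")
      case True
      then obtain i where i: "leaf_class D J i" by blast
      have "finite J" using reach_subset[OF less.prems] assms finite_subset by blast
      moreover have "i \<in> J" using i by (simp add: leaf_class_def)
      ultimately have "card (J - {i}) < card J" by (rule card_Diff1_less)
      then show ?thesis using less.hyps reach.step[OF less.prems i] by blast
    qed (use less.prems in blast)
  qed
  then show ?thesis using reach.start by blast
qed

lemma degree_0:
  assumes E: "equitable V c D E" and "x \<in> V" "D (c x) (c y) = 0"
  shows "\<not> E x y"
proof
  assume xy: "E x y"
  have "card {z \<in> V. c z = c y \<and> E x z} = 0" using equitableD(6)[OF E assms(2)] assms(3) by simp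
  then have "{z \<in> V. c z = c y \<and> E x z} = {}" using equitableD(1)[OF E] by simp
  then show False using xy equitableD(5)[OF E] by blast
qed

lemma degree_1:
  assumes E: "equitable V c D E" and "x \<in> V" "D (c x) j = 1"
  shows "\<exists>!y. y \<in> V \<and> c y = j \<and> E x y"
proof -
  have "card {z \<in> V. c z = j \<and> E x z} = 1" using equitableD(6)[OF E assms(2)] assms(3) by simp
  then obtain y where y: "{z \<in> V. c z = j \<and> E x z} = {y}" by (rule card_1_singletonE)
  show ?thesis by (rule ex1I[of _ y]) (use y in blast)+
qed

lemma degree_pos:
  assumes E: "equitable V c D E" and "x \<in> V" "D (c x) j > 0"
  shows "\<exists>y\<in>V. c y = j \<and> E x y"
proof -
  have "card {z \<in> V. c z = j \<and> E x z} \<noteq> 0" using equitableD(6)[OF E assms(2)] assms(3) by simp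
  then have "{z \<in> V. c z = j \<and> E x z} \<noteq> {}" by (metis card.empty)
  then show ?thesis by blast
qed

lemma edge_degree_pos:
  assumes E: "equitable V c D E" and "E x y"
  shows "D (c x) (c y) > 0"
  using degree_0[OF E, of x y] equitableD(4)[OF E assms(2)] assms(2) by blast

lemma leaf_nbr:
  assumes E: "equitable V c D E" and leaf: "leaf_class D J i" and l: "l \<in> V" "c l = i"
  shows "\<exists>!a. a \<in> part V c (J - {i}) \<and> E l a" "l' \<in> V \<Longrightarrow> c l' = i \<Longrightarrow> \<not> E l l'"
proof -
  obtain k where k: "k \<in> J" "k \<noteq> i" "D i k = 1" "\<And>j. j \<in> J \<Longrightarrow> j \<noteq> k \<Longrightarrow> D i j = 0" and i: "i \<in> J"
    using leaf unfolding leaf_class_def by blast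
  obtain y where y: "y \<in> V" "c y = k" "E l y" "\<And>z. z \<in> V \<Longrightarrow> c z = k \<Longrightarrow> E l z \<Longrightarrow> z = y"
    using degree_1[OF E l(1), of k] k(3) l(2) by blast
  show "\<exists>!a. a \<in> part V c (J - {i}) \<and> E l a"
  proof (rule ex1I[of _ y])
    show "y \<in> part V c (J - {i}) \<and> E l y" using y(1-3) k(1,2) by (simp add: part_def)
    fix a assume a: "a \<in> part V c (J - {i}) \<and> E l a"
    then have "a \<in> V" "c a \<in> J" "E l a" by (simp_all add: part_def)
    moreover from this have "D i (c a) > 0" using edge_degree_pos[OF E, of l a] l(2) by simp
    then have "c a = k" using k(4)[OF \<open>c a \<in> J\<close>] by (metis less_irrefl)
    ultimately show "a = y" using y(4) by blast
  qed
  show "\<not> E l l'" if "l' \<in> V" "c l' = i"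
    using degree_0[OF E l(1), of l'] k(4)[OF i k(2)[symmetric]] that l(2) by simp
qed

section \<open>Extending isomorphisms over leaves\<close>

text \<open>The leaves at \<open>a\<close> are sent to the equally many leaves at
  \<open>g a\<close>. Two vertex types are allowed because the bouquet of a tree lives on a product
  type.\<close>

lemma extend_leaves:
  fixes E :: "'a \<Rightarrow> 'a \<Rightarrow> bool" and E' :: "'b \<Rightarrow> 'b \<Rightarrow> bool"
  assumes fin: "finite L" "finite M" and g: "bij_betw g A B" and disj: "A \<inter> L = {}" "B \<inter> M = {}"
    and iso: "\<And>x y. x \<in> A \<Longrightarrow> y \<in> A \<Longrightarrow> E x y \<longleftrightarrow> E' (g x) (g y)"
    and sym: "\<And>x y. E x y \<Longrightarrow> E y x" "\<And>x y. E' x y \<Longrightarrow> E' y x"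
    and L: "\<And>l. l \<in> L \<Longrightarrow> \<exists>!a. a \<in> A \<and> E l a" "\<And>l l'. l \<in> L \<Longrightarrow> l' \<in> L \<Longrightarrow> \<not> E l l'"
    and M: "\<And>m. m \<in> M \<Longrightarrow> \<exists>!b. b \<in> B \<and> E' m b" "\<And>m m'. m \<in> M \<Longrightarrow> m' \<in> M \<Longrightarrow> \<not> E' m m'"
    and card: "\<And>a. a \<in> A \<Longrightarrow> card {l \<in> L. E a l} = card {m \<in> M. E' (g a) m}"
  shows "\<exists>g'. bij_betw g' (A \<union> L) (B \<union> M) \<and> (\<forall>a\<in>A. g' a = g a) \<and> (\<forall>l\<in>L. g' l \<in> M) \<and>
    (\<forall>x\<in>A \<union> L. \<forall>y\<in>A \<union> L. E x y \<longleftrightarrow> E' (g' x) (g' y))"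
proof -
  define p where "p l = (THE a. a \<in> A \<and> E l a)" for l
  define q where "q m = (THE b. b \<in> B \<and> E' m b)" for m
  have p: "p l \<in> A" "E l (p l)" if "l \<in> L" for l
    using theI'[OF L(1)[OF that]] unfolding p_def by blast+
  have pu: "a = p l" if "l \<in> L" "a \<in> A" "E l a" for l a using L(1)[OF that(1)] p[OF that(1)] that by blast
  have q: "q m \<in> B" "E' m (q m)" if "m \<in> M" for m
    using theI'[OF M(1)[OF that]] unfolding q_def by blast+
  have qu: "b = q m" if "m \<in> M" "b \<in> B" "E' m b" for m b using M(1)[OF that(1)] q[OF that(1)] that by blast
  have gB: "g a \<in> B" if "a \<in> A" for a using bij_betw_apply[OF g that] .
  \<comment> \<open>A leaf may go to any leaf whose neighbour is the image of its own, so the fibres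
    of \<open>q\<close> are matched with those of \<open>g \<circ> p\<close>.\<close>
  have "\<exists>h. bij_betw h L M \<and> (\<forall>l\<in>L. q (h l) = g (p l))"
  proof (rule fiber_bij[OF fin])
    fix b
    show "card {l \<in> L. g (p l) = b} = card {m \<in> M. q m = b}"
    proof (cases "b \<in> B")
      case True
      then obtain a where a: "a \<in> A" "b = g a" using g unfolding bij_betw_def by blast
      have inj: "g (p l) = g a \<longleftrightarrow> p l = a" if "l \<in> L" for l
        using g p(1)[OF that] a(1) unfolding bij_betw_def by (auto dest: inj_onD)
      have "p l = a \<longleftrightarrow> E a l" if "l \<in> L" for l
        using p(2)[OF that] pu[OF that a(1)] sym(1) by blast
      then have "{l \<in> L. g (p l) = b} = {l \<in> L. E a l}" using inj unfolding a(2) by blast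
      moreover have "q m = g a \<longleftrightarrow> E' (g a) m" if "m \<in> M" for m
        using q(2)[OF that] qu[OF that gB[OF a(1)]] sym(2) by metis
      then have "{m \<in> M. q m = b} = {m \<in> M. E' (g a) m}" unfolding a(2) by blast
      ultimately show ?thesis using card[OF a(1)] by simp
    next
      case False
      then have "{l \<in> L. g (p l) = b} = {}" "{m \<in> M. q m = b} = {}" using p q gB by blast+
      then show ?thesis by (simp only: card.empty)
    qed
  qed
  then obtain h where h: "bij_betw h L M" and hq: "\<And>l. l \<in> L \<Longrightarrow> q (h l) = g (p l)" by blast
  have hM: "h l \<in> M" if "l \<in> L" for l using bij_betw_apply[OF h that] .
  define g' where "g' x = (if x \<in> A then g x else h x)" for x
  have gA: "g' a = g a" if "a \<in> A" for a using that by (simp add: g'_def)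
  have gL: "g' l = h l" if "l \<in> L" for l using that disj by (auto simp: g'_def)
  have "bij_betw g' A B" using g gA by (simp cong: bij_betw_cong)
  moreover have "bij_betw g' L M" using h gL by (simp cong: bij_betw_cong)
  ultimately have bij: "bij_betw g' (A \<union> L) (B \<union> M)" using disj by (intro bij_betw_combine) auto
  have AL: "E l a \<longleftrightarrow> E' (g' l) (g' a)" if "l \<in> L" "a \<in> A" for l a
  proof -
    have "E l a \<longleftrightarrow> a = p l" using p pu that by blast
    also have "\<dots> \<longleftrightarrow> g a = g (p l)" using g p(1)[OF that(1)] that(2) unfolding bij_betw_def
      by (auto dest: inj_onD)
    also have "\<dots> \<longleftrightarrow> E' (h l) (g a)"
      using q(2)[OF hM[OF that(1)]] qu[OF hM[OF that(1)] gB[OF that(2)]] hq[OF that(1)] by metis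
    finally show ?thesis using gA gL that by simp
  qed
  have "E x y \<longleftrightarrow> E' (g' x) (g' y)" if xy: "x \<in> A \<union> L" "y \<in> A \<union> L" for x y
  proof (cases "x \<in> A")
    case True
    show ?thesis
    proof (cases "y \<in> A")
      case True
      with \<open>x \<in> A\<close> show ?thesis using iso gA by simp
    next
      case False
      then have "y \<in> L" using xy by blast
      then show ?thesis using AL[of y x] True sym by blast
    qed
  next
    case False
    then have x: "x \<in> L" using xy by blast
    show ?thesis
    proof (cases "y \<in> A")
      case True
      with x show ?thesis using AL by blast
    next
      case False
      then have "y \<in> L" using xy by blast
      then show ?thesis using x L(2) M(2) hM gL by simp
    qed
  qed
  with bij gA gL hM show ?thesis by (intro exI[of _ g']) simp
qed

text \<open>Leaf counts agree because they are degrees and \<open>g\<close> preserves colours.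
  \<open>A\<close> and \<open>B\<close> may be proper parts of the remaining vertices: rigidity
  takes all of them, the comparison of two bouquets only those inside a block.\<close>

lemma extend_color_class:
  assumes E: "equitable V c D E" "equitable V c D E'" and leaf: "leaf_class D J i"
    and AB: "A \<subseteq> part V c (J - {i})" "B \<subseteq> part V c (J - {i})"
    and g: "bij_betw g A B" "\<And>x. x \<in> A \<Longrightarrow> c (g x) = c x"
    and iso: "\<And>x y. x \<in> A \<Longrightarrow> y \<in> A \<Longrightarrow> E x y \<longleftrightarrow> E' (g x) (g y)"
    and L_def: "L = {l \<in> V. c l = i \<and> (\<exists>a\<in>A. E l a)}"
    and M_def: "M = {m \<in> V. c m = i \<and> (\<exists>b\<in>B. E' m b)}"
  shows "\<exists>g'. bij_betw g' (A \<union> L) (B \<union> M) \<and> (\<forall>x\<in>A. g' x = g x) \<and> (\<forall>x\<in>A \<union> L. c (g' x) = c x) \<and>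
    (\<forall>x\<in>A \<union> L. \<forall>y\<in>A \<union> L. E x y \<longleftrightarrow> E' (g' x) (g' y))"
proof -
  have fin: "finite V" using equitableD(1)[OF E(1)] .
  have gB: "g a \<in> B" if "a \<in> A" for a using bij_betw_apply[OF g(1) that] .
  have "\<exists>g'. bij_betw g' (A \<union> L) (B \<union> M) \<and> (\<forall>a\<in>A. g' a = g a) \<and> (\<forall>l\<in>L. g' l \<in> M) \<and>
    (\<forall>x\<in>A \<union> L. \<forall>y\<in>A \<union> L. E x y \<longleftrightarrow> E' (g' x) (g' y))"
  proof (rule extend_leaves)
    show "finite L" "finite M" using fin by (simp_all add: L_def M_def)
    show "A \<inter> L = {}" "B \<inter> M = {}" using AB by (auto simp: L_def M_def part_def)
    show "E y x" if "E x y" for x y using equitableD(2)[OF E(1) that] .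
    show "E' y x" if "E' x y" for x y using equitableD(2)[OF E(2) that] .
    show "\<exists>!a. a \<in> A \<and> E l a" if "l \<in> L" for l
      using leaf_nbr(1)[OF E(1) leaf, of l] that AB(1) unfolding L_def by blast
    show "\<exists>!b. b \<in> B \<and> E' m b" if "m \<in> M" for m
      using leaf_nbr(1)[OF E(2) leaf, of m] that AB(2) unfolding M_def by blast
    show "\<not> E l l'" if "l \<in> L" "l' \<in> L" for l l'
      using leaf_nbr(2)[OF E(1) leaf] that unfolding L_def by blast
    show "\<not> E' l l'" if "l \<in> M" "l' \<in> M" for l l'
      using leaf_nbr(2)[OF E(2) leaf] that unfolding M_def by blast
    fix a assume a: "a \<in> A"
    have "{l \<in> L. E a l} = {y \<in> V. c y = i \<and> E a y}"
      using a equitableD(2)[OF E(1)] unfolding L_def by blast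
    moreover have "{m \<in> M. E' (g a) m} = {y \<in> V. c y = i \<and> E' (g a) y}"
      using gB[OF a] equitableD(2)[OF E(2)] unfolding M_def by blast
    moreover have "a \<in> V" "g a \<in> V" using a gB[OF a] AB by (auto simp: part_def)
    ultimately show "card {l \<in> L. E a l} = card {m \<in> M. E' (g a) m}"
      using equitableD(6)[OF E(1), of a i] equitableD(6)[OF E(2), of "g a" i] g(2)[OF a] by simp
  qed (use g iso in auto)
  then obtain g' where g': "bij_betw g' (A \<union> L) (B \<union> M)" "\<forall>a\<in>A. g' a = g a" "\<forall>l\<in>L. g' l \<in> M"
    "\<forall>x\<in>A \<union> L. \<forall>y\<in>A \<union> L. E x y \<longleftrightarrow> E' (g' x) (g' y)" by blast
  moreover have "c (g' x) = c x" if "x \<in> A \<union> L" for x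
    using that g'(2,3) g(2) by (auto simp: L_def M_def)
  ultimately show ?thesis by blast
qed

subsection \<open>Regular graphs of degree one and of degree two on five vertices\<close>

text \<open>Induction removing one matched pair on each side. The removed pairs differ, hence two
  sets \<open>V\<close> and \<open>W\<close>.\<close>

lemma matching_iso:
  assumes "finite V" "card V = card W" "\<And>x y. R x y \<Longrightarrow> R y x" "\<And>x. \<not> R x x" "\<And>x y. S x y \<Longrightarrow> S y x" "\<And>x. \<not> S x x"
    and "\<forall>x\<in>V. \<exists>!y. y \<in> V \<and> R x y" "\<forall>x\<in>W. \<exists>!y. y \<in> W \<and> S x y" "finite W"
  shows "\<exists>g. bij_betw g V W \<and> (\<forall>x\<in>V. \<forall>y\<in>V. R x y \<longleftrightarrow> S (g x) (g y))"
  using assms(1,2,7,8,9)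
proof (induction "card V" arbitrary: V W rule: less_induct)
  case less
  show ?case
  proof (cases "V = {}")
    case True
    then have "W = {}" using less.prems by simp
    with True show ?thesis by (auto simp: bij_betw_def)
  next
    case False
    then have "W \<noteq> {}" using less.prems by auto
    with False obtain x x' where x: "x \<in> V" "x' \<in> W" by blast
    obtain y where y: "y \<in> V" "R x y" "\<And>z. z \<in> V \<Longrightarrow> R x z \<Longrightarrow> z = y" using less.prems(3) x by blast
    obtain y' where y': "y' \<in> W" "S x' y'" "\<And>z. z \<in> W \<Longrightarrow> S x' z \<Longrightarrow> z = y'" using less.prems(4) x by blast
    have ne: "x \<noteq> y" "x' \<noteq> y'" using y y' assms(4,6) by blast+
    have yu: "z = x" if "z \<in> V" "R y z" for z using less.prems(3) y(1) x(1) assms(3)[OF y(2)] that by blast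
    have yu': "z = x'" if "z \<in> W" "S y' z" for z using less.prems(4) y'(1) x(2) assms(5)[OF y'(2)] that by blast
    let ?V = "V - {x, y}" and ?W = "W - {x', y'}"
    have c: "card ?V = card V - 2" "card ?W = card W - 2"
      using ne x y(1) y'(1) less.prems by (simp_all add: card_Diff_subset)
    have "\<exists>g. bij_betw g ?V ?W \<and> (\<forall>x\<in>?V. \<forall>y\<in>?V. R x y \<longleftrightarrow> S (g x) (g y))"
    proof (rule less.hyps)
      show "card ?V < card V" using x(1) less.prems(1) by (intro psubset_card_mono) auto
      show "card ?V = card ?W" using c less.prems(2) by simp
      show "\<forall>a\<in>?V. \<exists>!b. b \<in> ?V \<and> R a b"
      proof
        fix a assume a: "a \<in> ?V"
        then obtain b where b: "b \<in> V" "R a b" "\<And>z. z \<in> V \<Longrightarrow> R a z \<Longrightarrow> z = b" using less.prems(3) by blast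
        have "b \<noteq> x" "b \<noteq> y" using a b(2) assms(3) y(3) yu by blast+
        then show "\<exists>!b. b \<in> ?V \<and> R a b" using b by blast
      qed
      show "\<forall>a\<in>?W. \<exists>!b. b \<in> ?W \<and> S a b"
      proof
        fix a assume a: "a \<in> ?W"
        then obtain b where b: "b \<in> W" "S a b" "\<And>z. z \<in> W \<Longrightarrow> S a z \<Longrightarrow> z = b" using less.prems(4) by blast
        have "b \<noteq> x'" "b \<noteq> y'" using a b(2) assms(5) y'(3) yu' by blast+
        then show "\<exists>!b. b \<in> ?W \<and> S a b" using b by blast
      qed
    qed (use less.prems in auto)
    then obtain g where g: "bij_betw g ?V ?W" "\<And>a b. a \<in> ?V \<Longrightarrow> b \<in> ?V \<Longrightarrow> R a b \<longleftrightarrow> S (g a) (g b)" by blast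
    define h where "h = g(x := x', y := y')"
    have hx: "h x = x'" "h y = y'" using ne by (simp_all add: h_def)
    have hg: "h a = g a" if "a \<in> ?V" for a using that by (simp add: h_def)
    have "bij_betw h ?V ?W \<longleftrightarrow> bij_betw g ?V ?W" by (rule bij_betw_cong) (rule hg)
    with g(1) have "bij_betw h ?V ?W" by blast
    moreover have "bij_betw h {x, y} {x', y'}" using ne hx by (auto simp: bij_betw_def)
    ultimately have "bij_betw h (?V \<union> {x, y}) (?W \<union> {x', y'})" by (intro bij_betw_combine) auto
    moreover have "?V \<union> {x, y} = V" "?W \<union> {x', y'} = W" using x y(1) y'(1) by auto
    ultimately have bij: "bij_betw h V W" by simp
    have gW: "g a \<in> ?W" if "a \<in> ?V" for a using bij_betw_apply[OF g(1) that] .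
    have mixed: "\<not> R a b \<and> \<not> R b a \<and> \<not> S (h a) (h b) \<and> \<not> S (h b) (h a)" if "a \<in> ?V" "b \<in> {x, y}" for a b
    proof -
      have "\<not> R b a" using that y(3) yu by auto
      moreover have "h b \<in> {x', y'}" "h a \<in> ?W" using that hx hg gW by auto
      then have "\<not> S (h b) (h a)" using y'(3) yu' by auto
      ultimately show ?thesis using assms(3,5) by blast
    qed
    have "R a b \<longleftrightarrow> S (h a) (h b)" if ab: "a \<in> V" "b \<in> V" for a b
    proof (cases "a \<in> ?V")
      case True
      then show ?thesis using ab hg g(2) mixed by (cases "b \<in> ?V") auto
    next
      case False
      then have a: "a \<in> {x, y}" using ab by blast
      show ?thesis
      proof (cases "b \<in> ?V")
        case True
        then show ?thesis using mixed a by blast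
      next
        case False
        then have "b \<in> {x, y}" using ab by blast
        then show ?thesis using a hx y(2) y'(2) assms(3-6) by auto
      qed
    qed
    with bij show ?thesis by blast
  qed
qed

text \<open>With a vertex \<open>v\<close>, its neighbours \<open>a\<close>, \<open>b\<close> and
  the others \<open>p\<close>, \<open>q\<close>, the degrees leave one possibility up to exchanging
  \<open>p\<close> and \<open>q\<close>: were \<open>a\<close> and \<open>b\<close> adjacent,
  \<open>p\<close> could have no neighbour but \<open>q\<close>.\<close>

lemma c5_enum:
  assumes V: "card V = 5" and sym: "\<And>x y. R x y \<Longrightarrow> R y x" and irr: "\<And>x. \<not> R x x"
    and deg: "\<And>x. x \<in> V \<Longrightarrow> card {y \<in> V. R x y} = 2"
  shows "\<exists>z. bij_betw z {..<5::nat} V \<and>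
    (\<forall>m<5. \<forall>n<5. R (z m) (z n) \<longleftrightarrow> n = (m + 1) mod 5 \<or> m = (n + 1) mod 5)"
proof -
  have fin: "finite V" using V by (simp add: card_ge_0_finite)
  obtain v where v: "v \<in> V" using V by (metis card.empty equals0I zero_neq_numeral)
  obtain a b where ab: "{y \<in> V. R v y} = {a, b}" "a \<noteq> b" using deg[OF v] by (auto simp: card_2_iff)
  have abV: "a \<in> V" "b \<in> V" "R v a" "R v b" using ab by blast+
  have ne: "v \<noteq> a" "v \<noteq> b" using abV irr by blast+
  have "card (V - {v, a, b}) = 2" using V v abV ne ab(2) fin by (simp add: card_Diff_subset)
  then obtain p q where pq: "V - {v, a, b} = {p, q}" "p \<noteq> q" by (auto simp: card_2_iff)
  then have Vs: "V = {v, a, b, p, q}" using v abV by blast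
  have d: "distinct [v, a, b, p, q]" using ne ab(2) pq by auto
  have sum: "(if R x v then 1 else 0) + (if R x a then 1 else 0) + (if R x b then 1 else 0)
      + (if R x p then 1 else 0) + (if R x q then 1 else 0) = (2::nat)" if "x \<in> V" for x
  proof -
    have "card {y \<in> V. R x y} = (\<Sum>y\<in>V. if R x y then 1 else 0)"
      using fin by (simp add: sum.If_cases Int_def)
    then show ?thesis using deg[OF that] d unfolding Vs by (simp add: add.assoc)
  qed
  have vs: "\<not> R v p" "\<not> R v q" using ab pq by blast+
  have s: "R x y \<longleftrightarrow> R y x" for x y using sym by blast
  have pqV: "p \<in> V" "q \<in> V" using pq by blast+
  note rw = abV(3,4) vs irr s[of a v] s[of b v] s[of p v] s[of q v]
      s[of b a] s[of p a] s[of p b] s[of q a] s[of q b] s[of q p]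
  have sums: "(if R a b then 1 else 0) + (if R a p then 1 else 0) + (if R a q then 1 else 0) = (1::nat)"
    "(if R a b then 1 else 0) + (if R b p then 1 else 0) + (if R b q then 1 else 0) = (1::nat)"
    "(if R a p then 1 else 0) + (if R b p then 1 else 0) + (if R p q then 1 else 0) = (2::nat)"
    "(if R a q then 1 else 0) + (if R b q then 1 else 0) + (if R p q then 1 else 0) = (2::nat)"
    using sum[OF abV(1)] sum[OF abV(2)] sum[OF pqV(1)] sum[OF pqV(2)] by (simp_all add: rw)
  have eqs: "R a b = False \<and> R p q = True \<and> (R a p \<and> R b q \<and> \<not> R a q \<and> \<not> R b p \<or> R a q \<and> R b p \<and> \<not> R a p \<and> \<not> R b q)"
    using sums by (cases "R a b"; cases "R a p"; cases "R a q"; cases "R b p"; cases "R b q"; cases "R p q") simp_all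
  \<comment> \<open>Stated for arbitrary names, so that the two cases, which differ by exchanging
    \<open>p\<close> and \<open>q\<close>, share it.\<close>
  have main: "\<exists>z. bij_betw z {..<5::nat} V \<and>
    (\<forall>m<5. \<forall>n<5. R (z m) (z n) \<longleftrightarrow> n = (m + 1) mod 5 \<or> m = (n + 1) mod 5)"
    if p': "V = {v, a, b, p', q'}" "distinct [v, a, b, p', q']" "\<not> R v p'" "\<not> R v q'"
      "\<not> R a b" "R p' q'" "R a p'" "R b q'" "\<not> R a q'" "\<not> R b p'" for p' q'
  proof -
    let ?l = "[v, a, p', q', b]"
    have "bij_betw (\<lambda>m. ?l ! m) {..<5} V"
      by (rule bij_betw_nth) (use p'(1,2) in \<open>auto simp: numeral_eq_Suc\<close>)
    moreover have "R (?l ! m) (?l ! n) \<longleftrightarrow> n = (m + 1) mod 5 \<or> m = (n + 1) mod 5"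
      if "m < 5" "n < 5" for m n
    proof -
      have "m = 0 \<or> m = 1 \<or> m = 2 \<or> m = 3 \<or> m = 4" "n = 0 \<or> n = 1 \<or> n = 2 \<or> n = 3 \<or> n = 4"
        using that by linarith+
      then show ?thesis
        by (elim disjE) (simp_all add: p'(3-) abV(3,4) irr s[of a v] s[of b v] s[of p' v] s[of q' v]
          s[of b a] s[of p' a] s[of p' b] s[of q' a] s[of q' b] s[of q' p'])
    qed
    ultimately show ?thesis by blast
  qed
  from eqs show ?thesis
  proof (elim conjE disjE)
    assume "R a p" "R b q" "\<not> R a q" "\<not> R b p" "R a b = False" "R p q = True"
    then show ?thesis using main[of p q] Vs d vs by simp
  next
    assume "R a q" "R b p" "\<not> R a p" "\<not> R b q" "R a b = False" "R p q = True"
    moreover from this have "R q p" by (simp add: s[of q p])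
    moreover have "V = {v, a, b, q, p}" using Vs by blast
    moreover have "distinct [v, a, b, q, p]" using d by auto
    ultimately show ?thesis using main[of q p] vs by blast
  qed
qed

lemma c5_iso:
  assumes "card V = 5" "\<And>x y. R x y \<Longrightarrow> R y x" "\<And>x. \<not> R x x" "\<And>x y. S x y \<Longrightarrow> S y x" "\<And>x. \<not> S x x"
    and "\<And>x. x \<in> V \<Longrightarrow> card {y \<in> V. R x y} = 2" "\<And>x. x \<in> V \<Longrightarrow> card {y \<in> V. S x y} = 2"
  shows "\<exists>g. bij_betw g V V \<and> (\<forall>x\<in>V. \<forall>y\<in>V. R x y \<longleftrightarrow> S (g x) (g y))"
proof -
  obtain z where z: "bij_betw z {..<5::nat} V"
    "\<And>m n. m < 5 \<Longrightarrow> n < 5 \<Longrightarrow> R (z m) (z n) \<longleftrightarrow> n = (m + 1) mod 5 \<or> m = (n + 1) mod 5"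
    using c5_enum[OF assms(1,2,3,6)] by blast
  obtain w where w: "bij_betw w {..<5::nat} V"
    "\<And>m n. m < 5 \<Longrightarrow> n < 5 \<Longrightarrow> S (w m) (w n) \<longleftrightarrow> n = (m + 1) mod 5 \<or> m = (n + 1) mod 5"
    using c5_enum[OF assms(1,4,5,7)] by blast
  let ?z = "the_inv_into {..<5} z"
  have zi: "bij_betw ?z V {..<5}" by (rule bij_betw_the_inv_into[OF z(1)])
  have zz: "?z x < 5" "z (?z x) = x" if "x \<in> V" for x
    using bij_betw_apply[OF zi that] f_the_inv_into_f_bij_betw[OF z(1) that] by auto
  have "R x y \<longleftrightarrow> S ((w \<circ> ?z) x) ((w \<circ> ?z) y)" if "x \<in> V" "y \<in> V" for x y
    using z(2)[OF zz(1)[OF that(1)] zz(1)[OF that(2)]] w(2)[OF zz(1)[OF that(1)] zz(1)[OF that(2)]]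
      zz(2) that by simp
  moreover have "bij_betw (w \<circ> ?z) V V" using zi w(1) by (rule bij_betw_trans)
  ultimately show ?thesis by blast
qed

text \<open>In the reduced part no edges run between classes, and each class admits only one graph
  of its degree up to isomorphism, so isomorphisms of single classes fit together. They extend as
  the leaf classes are put back.\<close>

lemma reduced_imp_rigid:
  assumes V: "finite V" and J: "reach D (c ` V) J" and red: "reduced V c D J"
  shows "rigid V c D"
  unfolding rigid_def
proof (intro allI impI)
  fix E E' assume E: "equitable V c D E" "equitable V c D E'"
  let ?P = "\<lambda>J. \<exists>g. bij_betw g (part V c J) (part V c J) \<and> (\<forall>x\<in>part V c J. c (g x) = c x) \<and>
      (\<forall>x\<in>part V c J. \<forall>y\<in>part V c J. E x y \<longleftrightarrow> E' (g x) (g y))"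
  have "?P (c ` V)"
  proof (rule reach_up[OF J, where P = ?P])
    let ?cl = "\<lambda>i. {v \<in> V. c v = i}"
    have "\<exists>g. bij_betw g (?cl i) (?cl i) \<and> (\<forall>x\<in>?cl i. \<forall>y\<in>?cl i. E x y \<longleftrightarrow> E' (g x) (g y))"
      if i: "i \<in> J" for i
    proof -
      have fin: "finite (?cl i)" using V by simp
      consider "D i i = 0" | "D i i = 1" | "D i i = 2" "card (?cl i) = 5"
        using bspec[OF red[unfolded reduced_def] i] by (elim conjE disjE)
      then show ?thesis
      proof cases
        case 1
        have "\<not> E x y \<and> \<not> E' x y" if "x \<in> ?cl i" "y \<in> ?cl i" for x y
          using that 1 degree_0[OF E(1), of x y] degree_0[OF E(2), of x y] by auto
        then show ?thesis by (intro exI[of _ id]) auto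
      next
        case 2
        have "\<exists>!y. y \<in> ?cl i \<and> E x y" "\<exists>!y. y \<in> ?cl i \<and> E' x y" if "x \<in> ?cl i" for x
          using that 2 degree_1[OF E(1), of x i] degree_1[OF E(2), of x i] by auto
        then show ?thesis
          using equitableD(2,3)[OF E(1)] equitableD(2,3)[OF E(2)] fin by (intro matching_iso) auto
      next
        case 3
        have "{y \<in> ?cl i. E x y} = {y \<in> V. c y = i \<and> E x y}" "{y \<in> ?cl i. E' x y} = {y \<in> V. c y = i \<and> E' x y}"
          for x by auto
        then have "card {y \<in> ?cl i. E x y} = 2" "card {y \<in> ?cl i. E' x y} = 2" if "x \<in> ?cl i" for x
          using 3 that equitableD(6)[OF E(1), of x i] equitableD(6)[OF E(2), of x i] by simp_all
        then show ?thesis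
          using equitableD(2,3)[OF E(1)] equitableD(2,3)[OF E(2)] 3 by (intro c5_iso) blast+
      qed
    qed
    then have "\<forall>i\<in>J. \<exists>g. bij_betw g (?cl i) (?cl i) \<and> (\<forall>x\<in>?cl i. \<forall>y\<in>?cl i. E x y \<longleftrightarrow> E' (g x) (g y))"
      by blast
    from bchoice[OF this] obtain g where g: "\<And>i. i \<in> J \<Longrightarrow> bij_betw (g i) (?cl i) (?cl i)"
      "\<And>i x y. i \<in> J \<Longrightarrow> x \<in> ?cl i \<Longrightarrow> y \<in> ?cl i \<Longrightarrow> E x y \<longleftrightarrow> E' (g i x) (g i y)" by blast
    define h where "h x = g (c x) x" for x
    have gc: "g (c x) x \<in> V \<and> c (g (c x) x) = c x" if "x \<in> part V c J" for x
      using bij_betw_apply[OF g(1), of "c x" x] that by (auto simp: part_def)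
    have "inj_on h (part V c J)"
    proof (rule inj_onI)
      fix x y assume xy: "x \<in> part V c J" "y \<in> part V c J" "h x = h y"
      then have cxy: "c x = c y" using gc unfolding h_def by metis
      moreover have "inj_on (g (c x)) (?cl (c x))" using g(1) xy(1) by (auto simp: part_def bij_betw_def)
      ultimately show "x = y" using xy unfolding h_def by (auto simp: part_def dest: inj_onD)
    qed
    moreover have "h ` part V c J \<subseteq> part V c J" using gc unfolding h_def part_def by auto
    moreover have "finite (part V c J)" using V by (simp add: part_def)
    ultimately have "bij_betw h (part V c J) (part V c J)"
      by (simp add: bij_betw_def endo_inj_surj)
    moreover have "E x y \<longleftrightarrow> E' (h x) (h y)" if xy: "x \<in> part V c J" "y \<in> part V c J" for x y
    proof (cases "c x = c y")
      case True
      then show ?thesis using g(2)[of "c x" x y] xy by (simp add: h_def part_def)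
    next
      case False
      have "D (c x) (c y) = 0" using red xy False by (auto simp: reduced_def part_def)
      then show ?thesis
        using degree_0[OF E(1), of x y] degree_0[OF E(2), of "h x" "h y"] xy gc
        by (simp add: h_def part_def)
    qed
    ultimately show "?P J" using gc unfolding h_def by blast
  next
    fix J i assume leaf: "leaf_class D J i" and IH: "?P (J - {i})"
    from IH obtain g where g: "bij_betw g (part V c (J - {i})) (part V c (J - {i}))"
      "\<And>x. x \<in> part V c (J - {i}) \<Longrightarrow> c (g x) = c x"
      "\<And>x y. x \<in> part V c (J - {i}) \<Longrightarrow> y \<in> part V c (J - {i}) \<Longrightarrow> E x y \<longleftrightarrow> E' (g x) (g y)" by blast
    have i: "i \<in> J" using leaf by (simp add: leaf_class_def)
    have "part V c (J - {i}) \<union> {l \<in> V. c l = i \<and> (\<exists>a\<in>part V c (J - {i}). F l a)} = part V c J"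
      if "equitable V c D F" for F
      using leaf_nbr(1)[OF that leaf] i unfolding part_def by blast
    note un = this[OF E(1)] this[OF E(2)]
    from extend_color_class[OF E leaf subset_refl subset_refl g refl refl] show "?P J"
      unfolding un by blast
  qed
  moreover have "part V c (c ` V) = V" by (auto simp: part_def)
  ultimately show "\<exists>g. bij_betw g V V \<and> (\<forall>x\<in>V. c (g x) = c x) \<and> (\<forall>x\<in>V. \<forall>y\<in>V. E x y \<longleftrightarrow> E' (g x) (g y))"
    by simp
qed

section \<open>Exchanging the edges between chosen classes\<close>

text \<open>Degrees are prescribed for each pair of colours separately, so edges between selected
  classes can be exchanged without regard to the others. Every second realization is obtained this
  way.\<close>

lemma equitable_patch:
  assumes E: "equitable V c D E" and t: "\<And>i j. t i j \<Longrightarrow> t j i"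
    and R: "\<And>x y. R x y \<Longrightarrow> R y x \<and> x \<noteq> y \<and> x \<in> V \<and> y \<in> V"
    and deg: "\<And>x j. x \<in> V \<Longrightarrow> t (c x) j \<Longrightarrow> card {y \<in> V. c y = j \<and> R x y} = D (c x) j"
  shows "equitable V c D (\<lambda>x y. if t (c x) (c y) then R x y else E x y)"
  unfolding equitable_def
proof (intro conjI allI impI ballI)
  show "finite V" using equitableD(1)[OF E] .
  fix x y assume "if t (c x) (c y) then R x y else E x y"
  then show "if t (c y) (c x) then R y x else E y x" "x \<noteq> y" "x \<in> V" "y \<in> V"
    using t[of "c x" "c y"] t[of "c y" "c x"] R[of x y] equitableD(2,4,5)[OF E, of x y] equitableD(3)[OF E, of x]
    by (auto split: if_splits)
next
  fix x j assume x: "x \<in> V"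
  have "{y \<in> V. c y = j \<and> (if t (c x) (c y) then R x y else E x y)} =
      (if t (c x) j then {y \<in> V. c y = j \<and> R x y} else {y \<in> V. c y = j \<and> E x y})"
    by auto
  then show "card {y \<in> V. c y = j \<and> (if t (c x) (c y) then R x y else E x y)} = D (c x) j"
    using deg[OF x] equitableD(6)[OF E x] by simp
qed

definition reg :: "'a set \<Rightarrow> nat \<Rightarrow> ('a \<Rightarrow> 'a \<Rightarrow> bool) \<Rightarrow> bool" where
  "reg N k R \<longleftrightarrow> (\<forall>x y. R x y \<longrightarrow> R y x \<and> x \<noteq> y \<and> x \<in> N \<and> y \<in> N) \<and> (\<forall>x\<in>N. card {y. R x y} = k)"

lemma regD:
  assumes "reg N k R"
  shows "R x y \<Longrightarrow> R y x" "\<not> R x x" "R x y \<Longrightarrow> x \<in> N" "R x y \<Longrightarrow> y \<in> N" "x \<in> N \<Longrightarrow> card {y. R x y} = k"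
  using assms unfolding reg_def by blast+

lemma rigid_reg_iso:
  assumes E: "equitable V c D E" and rig: "rigid V c D"
    and R: "reg {v \<in> V. c v = i} (D i i) R" and S: "reg {v \<in> V. c v = i} (D i i) S"
  shows "\<exists>g. bij_betw g {v \<in> V. c v = i} {v \<in> V. c v = i} \<and>
    (\<forall>x\<in>{v \<in> V. c v = i}. \<forall>y\<in>{v \<in> V. c v = i}. R x y \<longleftrightarrow> S (g x) (g y))"
proof -
  let ?t = "\<lambda>a b. a = i \<and> b = i"
  let ?p = "\<lambda>R x y. if ?t (c x) (c y) then R x y else E x y"
  have p: "equitable V c D (?p R)" if R: "reg {v \<in> V. c v = i} (D i i) R" for R
  proof (rule equitable_patch[OF E])
    show "R y x \<and> x \<noteq> y \<and> x \<in> V \<and> y \<in> V" if "R x y" for x y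
      using regD(1-4)[OF R] that by blast
    fix x j assume x: "x \<in> V" "c x = i \<and> j = i"
    have "{y \<in> V. c y = j \<and> R x y} = {y. R x y}" using regD(4)[OF R] x by blast
    then show "card {y \<in> V. c y = j \<and> R x y} = D (c x) j" using regD(5)[OF R, of x] x by simp
  qed auto
  obtain g where g: "bij_betw g V V" "\<forall>x\<in>V. c (g x) = c x" "\<forall>x\<in>V. \<forall>y\<in>V. ?p R x y \<longleftrightarrow> ?p S (g x) (g y)"
    using rig p[OF R] p[OF S] unfolding rigid_def by blast
  let ?N = "{v \<in> V. c v = i}"
  have "g ` ?N \<subseteq> ?N" using g(2) bij_betw_apply[OF g(1)] by auto
  moreover have inj: "inj_on g ?N" using g(1) by (auto simp: bij_betw_def intro: inj_on_subset)
  ultimately have "bij_betw g ?N ?N" using equitableD(1)[OF E] by (simp add: bij_betw_def endo_inj_surj)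
  moreover have "R x y \<longleftrightarrow> S (g x) (g y)" if "x \<in> ?N" "y \<in> ?N" for x y
    using bspec[OF bspec[OF g(3)], of x y] g(2) that by simp
  ultimately show ?thesis by blast
qed

text \<open>The bipartite counterpart. \<open>R\<close> and \<open>S\<close> are read from class
  \<open>i\<close> to class \<open>j\<close> only and are symmetrized by \<open>?s\<close>.\<close>

lemma rigid_bipartite_iso:
  assumes E: "equitable V c D E" and rig: "rigid V c D" and ij: "i \<noteq> j"
    and R: "\<And>x. x \<in> V \<Longrightarrow> c x = i \<Longrightarrow> card {y \<in> V. c y = j \<and> R x y} = D i j"
      "\<And>y. y \<in> V \<Longrightarrow> c y = j \<Longrightarrow> card {x \<in> V. c x = i \<and> R x y} = D j i"
    and S: "\<And>x. x \<in> V \<Longrightarrow> c x = i \<Longrightarrow> card {y \<in> V. c y = j \<and> S x y} = D i j"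
      "\<And>y. y \<in> V \<Longrightarrow> c y = j \<Longrightarrow> card {x \<in> V. c x = i \<and> S x y} = D j i"
  shows "\<exists>g. bij_betw g V V \<and> (\<forall>x\<in>V. c (g x) = c x) \<and>
    (\<forall>x\<in>V. \<forall>y\<in>V. c x = i \<longrightarrow> c y = j \<longrightarrow> (R x y \<longleftrightarrow> S (g x) (g y)))"
proof -
  let ?t = "\<lambda>a b. a = i \<and> b = j \<or> a = j \<and> b = i"
  let ?s = "\<lambda>R x y. x \<in> V \<and> y \<in> V \<and> (c x = i \<and> c y = j \<and> R x y \<or> c x = j \<and> c y = i \<and> R y x)"
  let ?p = "\<lambda>R x y. if ?t (c x) (c y) then ?s R x y else E x y"
  have p: "equitable V c D (?p R)" if
    R: "\<And>x. x \<in> V \<Longrightarrow> c x = i \<Longrightarrow> card {y \<in> V. c y = j \<and> R x y} = D i j"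
      "\<And>y. y \<in> V \<Longrightarrow> c y = j \<Longrightarrow> card {x \<in> V. c x = i \<and> R x y} = D j i" for R
  proof (rule equitable_patch[OF E])
    fix x k assume x: "x \<in> V" "?t (c x) k"
    show "card {y \<in> V. c y = k \<and> ?s R x y} = D (c x) k"
    proof (cases "c x = i")
      case True
      then have "{y \<in> V. c y = k \<and> ?s R x y} = {y \<in> V. c y = j \<and> R x y}" using x ij by auto
      then show ?thesis using R(1) x True ij by simp
    next
      case False
      then have "{y \<in> V. c y = k \<and> ?s R x y} = {y \<in> V. c y = i \<and> R y x}" using x ij by auto
      then show ?thesis using R(2) x False ij by simp
    qed
  qed (use ij in auto)
  obtain g where g: "bij_betw g V V" "\<forall>x\<in>V. c (g x) = c x" "\<forall>x\<in>V. \<forall>y\<in>V. ?p R x y \<longleftrightarrow> ?p S (g x) (g y)"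
    using rig p[OF R] p[OF S] unfolding rigid_def by blast
  have "R x y \<longleftrightarrow> S (g x) (g y)" if "x \<in> V" "y \<in> V" "c x = i" "c y = j" for x y
    using bspec[OF bspec[OF g(3)], of x y] g(2) bij_betw_apply[OF g(1)] that ij by simp
  with g(1,2) show ?thesis by blast
qed

subsection \<open>Non-isomorphic regular graphs\<close>

text \<open>The difference \<open>y - x\<close> modulo \<open>n\<close>: steps forward from
  \<open>x\<close> to \<open>y\<close> on a cycle of length \<open>n\<close>.\<close>

definition cdist :: "nat \<Rightarrow> nat \<Rightarrow> nat \<Rightarrow> nat" where
  "cdist n x y = (if x \<le> y then y - x else y + n - x)"

text \<open>Connection set of a circulant graph: up to \<open>k div 2\<close> steps in either
  direction and, for odd \<open>k\<close>, the opposite vertex.\<close>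

definition circ_set :: "nat \<Rightarrow> nat \<Rightarrow> nat set" where
  "circ_set n k = {s. 1 \<le> s \<and> s < n \<and> (s \<le> k div 2 \<or> n - k div 2 \<le> s \<or> odd k \<and> 2 * s = n)}"

definition circ :: "nat \<Rightarrow> nat \<Rightarrow> nat \<Rightarrow> nat \<Rightarrow> bool" where
  "circ n k x y \<longleftrightarrow> x < n \<and> y < n \<and> cdist n x y \<in> circ_set n k"

text \<open>\<open>k < n\<close> keeps the two intervals disjoint and, for odd \<open>k\<close>, the
  opposite vertex outside both.\<close>

lemma card_circ_set:
  assumes "k < n" "odd k \<Longrightarrow> even n"
  shows "card (circ_set n k) = k"
proof -
  let ?h = "k div 2"
  have h: "?h < n - ?h" using assms(1) by linarith
  have fin: "finite {1..?h}" "finite {n - ?h..<n}" by simp_all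
  have c: "card ({1..?h} \<union> {n - ?h..<n}) = 2 * ?h"
    using h by (subst card_Un_disjoint) auto
  show ?thesis
  proof (cases "odd k")
    case False
    then have "circ_set n k = {1..?h} \<union> {n - ?h..<n}"
      using h assms(1) unfolding circ_set_def by auto
    then show ?thesis using c False by simp
  next
    case True
    then obtain m where m: "n = 2 * m" using assms(2) by blast
    have kh: "k = 2 * ?h + 1" using True by simp
    have mm: "?h < m" "m < n - ?h" "1 \<le> m" "m < n" using m kh assms(1) by linarith+
    have "circ_set n k = insert m ({1..?h} \<union> {n - ?h..<n})"
      using h m mm True unfolding circ_set_def by auto
    moreover have "m \<notin> {1..?h} \<union> {n - ?h..<n}" using mm by auto
    ultimately show ?thesis using c kh by simp
  qed
qed

lemma circ_reg:
  assumes "k < n" "odd k \<Longrightarrow> even n"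
  shows "reg {..<n} k (circ n k)"
  unfolding reg_def
proof (intro conjI allI impI ballI)
  fix x y assume xy: "circ n k x y"
  then show "x \<in> {..<n}" "y \<in> {..<n}" by (simp_all add: circ_def)
  show ne: "x \<noteq> y" using xy by (auto simp: circ_def cdist_def circ_set_def)
  have "cdist n y x = n - cdist n x y" using xy ne by (auto simp: circ_def cdist_def)
  moreover have "n - s \<in> circ_set n k" if "s \<in> circ_set n k" for s
    using that assms(1) unfolding circ_set_def by auto
  ultimately show "circ n k y x" using xy by (simp add: circ_def)
next
  fix x assume x: "x \<in> {..<n}"
  have "bij_betw (cdist n x) {y. circ n k x y} (circ_set n k)"
    by (rule bij_betw_byWitness[where f' = "\<lambda>s. if x + s < n then x + s else x + s - n"])
      (use x in \<open>auto simp: circ_def cdist_def circ_set_def\<close>)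
  then show "card {y. circ n k x y} = k" using card_circ_set[OF assms] bij_betw_same_card by fastforce
qed

text \<open>An invariant under isomorphism that separates the first pair of regular graphs.\<close>

definition clique_nbhd :: "'a set \<Rightarrow> ('a \<Rightarrow> 'a \<Rightarrow> bool) \<Rightarrow> 'a \<Rightarrow> bool" where
  "clique_nbhd N R x \<longleftrightarrow> (\<forall>y\<in>N. \<forall>z\<in>N. R x y \<longrightarrow> R x z \<longrightarrow> y \<noteq> z \<longrightarrow> R y z)"

text \<open>The outermost neighbours of \<open>x\<close> on its two sides are
  \<open>2 * (k div 2)\<close> steps apart, and \<open>n\<close> is too large for them to be
  adjacent the other way around or as opposite vertices.\<close>

lemma circ_no_clique_nbhd:
  assumes "2 \<le> k" "2 * k + 1 \<le> n" "x < n"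
  shows "\<not> clique_nbhd {..<n} (circ n k) x"
proof -
  let ?h = "k div 2"
  define y where "y = (if x + ?h < n then x + ?h else x + ?h - n)"
  define z where "z = (if ?h \<le> x then x - ?h else x + n - ?h)"
  have h: "1 \<le> ?h" "4 * ?h < n" "2 * ?h \<le> k" using assms by linarith+
  have yz: "y < n" "z < n" using h assms(3) unfolding y_def z_def by auto
  have d: "cdist n x y = ?h" "cdist n x z = n - ?h" "cdist n z y = 2 * ?h"
    using h assms(3) unfolding y_def z_def cdist_def by auto
  have "circ n k x y" "circ n k x z" using d h yz assms(3) by (auto simp: circ_def circ_set_def)
  moreover have "\<not> circ n k z y" using d(3) h unfolding circ_def circ_set_def by auto
  moreover have "z \<noteq> y" using d(3) h by (auto simp: cdist_def split: if_splits)
  ultimately show ?thesis using yz unfolding clique_nbhd_def by blast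
qed

text \<open>A complete component beside a circulant graph; the latter has enough vertices if
  \<open>2 * k + 2 \<le> n\<close>.\<close>

definition clique_plus :: "nat \<Rightarrow> nat \<Rightarrow> nat \<Rightarrow> nat \<Rightarrow> bool" where
  "clique_plus n k x y \<longleftrightarrow> x < k + 1 \<and> y < k + 1 \<and> x \<noteq> y \<or>
    k + 1 \<le> x \<and> k + 1 \<le> y \<and> circ (n - (k + 1)) k (x - (k + 1)) (y - (k + 1))"

lemma clique_plus_reg:
  assumes "2 * k + 2 \<le> n" "odd k \<Longrightarrow> even n"
  shows "reg {..<n} k (clique_plus n k)"
proof -
  let ?m = "n - (k + 1)"
  have C: "reg {..<?m} k (circ ?m k)" by (rule circ_reg) (use assms in auto)
  show ?thesis
    unfolding reg_def
  proof (intro conjI allI impI ballI)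
    fix x y assume xy: "clique_plus n k x y"
    show "clique_plus n k y x" using xy regD(1)[OF C] unfolding clique_plus_def by blast
    show "x \<noteq> y" using xy regD(2)[OF C] unfolding clique_plus_def by blast
    show "x \<in> {..<n}" "y \<in> {..<n}"
      using xy assms(1) unfolding clique_plus_def circ_def by auto
  next
    fix x assume x: "x \<in> {..<n}"
    show "card {y. clique_plus n k x y} = k"
    proof (cases "x < k + 1")
      case True
      then have "{y. clique_plus n k x y} = {..<k + 1} - {x}" unfolding clique_plus_def by auto
      then show ?thesis using True by simp
    next
      case False
      then have "{y. clique_plus n k x y} = (\<lambda>y. y + (k + 1)) ` {y. circ ?m k (x - (k + 1)) y}"
        unfolding clique_plus_def by (auto simp: image_iff intro!: exI[of _ "_ - Suc k"])
      then have "card {y. clique_plus n k x y} = card {y. circ ?m k (x - (k + 1)) y}"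
        by (simp add: card_image inj_on_def)
      also have "\<dots> = k" by (rule regD(5)[OF C]) (use x False in auto)
      finally show ?thesis .
    qed
  qed
qed

text \<open>A complete bipartite graph with sides \<open>{..<2h}\<close> and \<open>{2h..<4h}\<close> minus a matching with \<open>h\<close> edges, whose
  \<open>2h\<close> endpoints are joined to the additional vertex \<open>4h\<close>.\<close>

definition bip_plus :: "nat \<Rightarrow> nat \<Rightarrow> nat \<Rightarrow> bool" where
  "bip_plus h x y \<longleftrightarrow> x < 2 * h \<and> 2 * h \<le> y \<and> y < 4 * h \<and> \<not> (y = x + 2 * h \<and> x < h) \<or>
    y = 4 * h \<and> (x < h \<or> 2 * h \<le> x \<and> x < 3 * h)"

definition bip_graph :: "nat \<Rightarrow> nat \<Rightarrow> nat \<Rightarrow> bool" where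
  "bip_graph h x y \<longleftrightarrow> bip_plus h x y \<or> bip_plus h y x"

lemma bip_graph_reg: "reg {..<4 * h + 1} (2 * h) (bip_graph h)"
  unfolding reg_def
proof (intro conjI allI impI ballI)
  fix x y assume "bip_graph h x y"
  then show "bip_graph h y x" "x \<noteq> y" "x \<in> {..<4 * h + 1}" "y \<in> {..<4 * h + 1}"
    unfolding bip_graph_def bip_plus_def by auto
next
  fix x assume "x \<in> {..<4 * h + 1}"
  \<comment> \<open>The first halves of the two sides are the ends of the deleted matching, and the
    additional vertex is joined to exactly these.\<close>
  then consider "x < h" | "h \<le> x" "x < 2 * h" | "2 * h \<le> x" "x < 3 * h" | "3 * h \<le> x" "x < 4 * h" | "x = 4 * h"
    by (metis One_nat_def Suc_eq_plus1 leI lessThan_iff less_antisym)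
  then show "card {y. bip_graph h x y} = 2 * h"
  proof cases
    case 1
    then have "{y. bip_graph h x y} = insert (4 * h) ({2 * h..<4 * h} - {x + 2 * h})"
      unfolding bip_graph_def bip_plus_def by auto
    then show ?thesis using 1 by simp
  next
    case 2
    then have "{y. bip_graph h x y} = {2 * h..<4 * h}" unfolding bip_graph_def bip_plus_def by auto
    then show ?thesis by simp
  next
    case 3
    then have "{y. bip_graph h x y} = insert (4 * h) ({..<2 * h} - {x - 2 * h})"
      unfolding bip_graph_def bip_plus_def by auto
    then show ?thesis using 3 by simp
  next
    case 4
    then have "{y. bip_graph h x y} = {..<2 * h}" unfolding bip_graph_def bip_plus_def by auto
    then show ?thesis by simp
  next
    case 5
    then have "{y. bip_graph h x y} = {..<h} \<union> {2 * h..<3 * h}" unfolding bip_graph_def bip_plus_def by auto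
    moreover have "card \<dots> = 2 * h" by (subst card_Un_disjoint) auto
    ultimately show ?thesis by simp
  qed
qed

lemma reg_complement:
  assumes "reg N k R" "finite N"
  shows "reg N (card N - 1 - k) (\<lambda>x y. x \<in> N \<and> y \<in> N \<and> x \<noteq> y \<and> \<not> R x y)"
  unfolding reg_def
proof (intro conjI allI impI ballI)
  fix x assume x: "x \<in> N"
  have "{y. x \<in> N \<and> y \<in> N \<and> x \<noteq> y \<and> \<not> R x y} = N - {x} - {y. R x y}" using x by auto
  moreover have sub: "{y. R x y} \<subseteq> N - {x}" using regD(2,4)[OF assms(1)] by auto
  moreover have "finite {y. R x y}" by (rule finite_subset[OF sub]) (use assms(2) in simp)
  ultimately show "card {y. x \<in> N \<and> y \<in> N \<and> x \<noteq> y \<and> \<not> R x y} = card N - 1 - k"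
    using regD(5)[OF assms(1) x] assms(2) x by (simp add: card_Diff_subset)
qed (use regD(1)[OF assms(1)] in blast)+

text \<open>For \<open>n \<ge> 2 * k + 2\<close> a complete component can be split off. For
  \<open>n = 2 * k + 1\<close> only \<open>k\<close> vertices would remain beside it; but then
  \<open>k\<close> is even, complementation keeps the degree, and an almost bipartite graph can be
  compared with its complement.\<close>

lemma two_regular_graphs_nat:
  assumes "2 \<le> k" "2 * k + 1 \<le> n" "even (n * k)" "\<not> (k = 2 \<and> n = 5)"
  shows "\<exists>R S. reg {..<n} k R \<and> reg {..<n} k S \<and>
    \<not> (\<exists>g. bij_betw g {..<n} {..<n} \<and> (\<forall>x\<in>{..<n}. \<forall>y\<in>{..<n}. R x y \<longleftrightarrow> S (g x) (g y)))"
proof (cases "n = 2 * k + 1")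
  case False
  then have n: "2 * k + 2 \<le> n" using assms(2) by simp
  have par: "odd k \<Longrightarrow> even n" using assms(3) by auto
  have R: "reg {..<n} k (clique_plus n k)" by (rule clique_plus_reg[OF n par])
  have S: "reg {..<n} k (circ n k)" by (rule circ_reg) (use n par in auto)
  have "\<not> (\<exists>g. bij_betw g {..<n} {..<n} \<and> (\<forall>x\<in>{..<n}. \<forall>y\<in>{..<n}. clique_plus n k x y \<longleftrightarrow> circ n k (g x) (g y)))"
  proof
    assume "\<exists>g. bij_betw g {..<n} {..<n} \<and> (\<forall>x\<in>{..<n}. \<forall>y\<in>{..<n}. clique_plus n k x y \<longleftrightarrow> circ n k (g x) (g y))"
    then obtain g where g: "bij_betw g {..<n} {..<n}"
      "\<And>x y. x \<in> {..<n} \<Longrightarrow> y \<in> {..<n} \<Longrightarrow> clique_plus n k x y \<longleftrightarrow> circ n k (g x) (g y)" by blast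
    have 0: "0 \<in> {..<n}" using n by simp
    have "clique_nbhd {..<n} (clique_plus n k) 0" unfolding clique_nbhd_def clique_plus_def by auto
    then have "clique_nbhd {..<n} (circ n k) (g 0)"
      unfolding clique_nbhd_def
    proof (intro ballI impI)
      assume *: "\<forall>y\<in>{..<n}. \<forall>z\<in>{..<n}. clique_plus n k 0 y \<longrightarrow> clique_plus n k 0 z \<longrightarrow> y \<noteq> z \<longrightarrow> clique_plus n k y z"
      fix y z assume yz: "y \<in> {..<n}" "z \<in> {..<n}" "circ n k (g 0) y" "circ n k (g 0) z" "y \<noteq> z"
      obtain y' z' where "y' \<in> {..<n}" "z' \<in> {..<n}" "y = g y'" "z = g z'"
        using yz(1,2) g(1) unfolding bij_betw_def by blast
      then show "circ n k y z" using * yz(3-5) g(2) 0 by blast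
    qed
    moreover have "g 0 < n" using bij_betw_apply[OF g(1) 0] by simp
    ultimately show False using circ_no_clique_nbhd[of k n "g 0"] assms by blast
  qed
  with R S show ?thesis by blast
next
  case True
  then have "even k" using assms(3) by auto
  then obtain h where h: "k = 2 * h" by blast
  \<comment> \<open>Excluding \<open>k = 2\<close>, \<open>n = 5\<close> gives each side at least
    four vertices.\<close>
  have h2: "2 \<le> h" using assms(1,4) True h by auto
  have n: "n = 4 * h + 1" using True h by simp
  let ?B = "bip_graph h" let ?N = "{..<n}"
  let ?C = "\<lambda>x y. x \<in> ?N \<and> y \<in> ?N \<and> x \<noteq> y \<and> \<not> ?B x y"
  have B: "reg ?N k ?B" using bip_graph_reg[of h] n h by simp
  have C: "reg ?N k ?C" using reg_complement[OF B] True by simp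
  \<comment> \<open>The vertices 0, 1, 2, 3 form a clique in the complement, whereas the graph
    itself has its vertices in three independent sets.\<close>
  have "\<not> (\<exists>g. bij_betw g ?N ?N \<and> (\<forall>x\<in>?N. \<forall>y\<in>?N. ?C x y \<longleftrightarrow> ?B (g x) (g y)))"
  proof
    assume "\<exists>g. bij_betw g ?N ?N \<and> (\<forall>x\<in>?N. \<forall>y\<in>?N. ?C x y \<longleftrightarrow> ?B (g x) (g y))"
    then obtain g where g: "\<And>x y. x \<in> ?N \<Longrightarrow> y \<in> ?N \<Longrightarrow> ?C x y \<longleftrightarrow> ?B (g x) (g y)" by blast
    have ind: "\<not> ?B x y" if "x < 4" "y < 4" for x y
      using that h2 unfolding bip_graph_def bip_plus_def by auto
    have gB: "?B (g x) (g y)" if "x < 4" "y < 4" "x \<noteq> y" for x y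
    proof -
      have "x \<in> ?N" "y \<in> ?N" using that n h2 by auto
      then show ?thesis using g ind that by blast
    qed
    define side where "side x = (if x < 2 * h then 0 else if x < 4 * h then 1 else 2 :: nat)" for x
    have "side a \<noteq> side b" if "?B a b" for a b
      using that unfolding bip_graph_def bip_plus_def side_def by auto
    then have ne: "side (g x) \<noteq> side (g y)" if "x < 4" "y < 4" "x \<noteq> y" for x y
      using gB that by blast
    have "inj_on (side \<circ> g) {..<4}" unfolding inj_on_def using ne by force
    moreover have "(side \<circ> g) ` {..<4} \<subseteq> {..<3}" by (auto simp: side_def)
    ultimately have "card {..<4::nat} \<le> card {..<3::nat}" by (rule card_inj_on_le) simp
    then show False by simp
  qed
  with B C show ?thesis by blast
qed

lemma reg_transfer:
  assumes "reg A k R" "bij_betw f B A"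
  shows "reg B k (\<lambda>x y. x \<in> B \<and> y \<in> B \<and> R (f x) (f y))"
  unfolding reg_def
proof (intro conjI allI impI ballI)
  fix x assume x: "x \<in> B"
  have "bij_betw f {y. x \<in> B \<and> y \<in> B \<and> R (f x) (f y)} {z. R (f x) z}"
    using assms(2) x regD(4)[OF assms(1), of "f x"] unfolding bij_betw_def inj_on_def by auto
  then show "card {y. x \<in> B \<and> y \<in> B \<and> R (f x) (f y)} = k"
    using regD(5)[OF assms(1) bij_betw_apply[OF assms(2) x]] bij_betw_same_card by fastforce
qed (use regD(1,2)[OF assms(1)] in metis)+

lemma two_regular_graphs:
  assumes N: "finite N" and k: "2 \<le> k" "2 * k + 1 \<le> card N" "even (card N * k)" "\<not> (k = 2 \<and> card N = 5)"
  shows "\<exists>R S. reg N k R \<and> reg N k S \<and>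
    \<not> (\<exists>g. bij_betw g N N \<and> (\<forall>x\<in>N. \<forall>y\<in>N. R x y \<longleftrightarrow> S (g x) (g y)))"
proof -
  let ?n = "card N"
  obtain R S where RS: "reg {..<?n} k R" "reg {..<?n} k S"
    and no: "\<not> (\<exists>g. bij_betw g {..<?n} {..<?n} \<and> (\<forall>x\<in>{..<?n}. \<forall>y\<in>{..<?n}. R x y \<longleftrightarrow> S (g x) (g y)))"
    using two_regular_graphs_nat[OF k] by blast
  obtain f where f: "bij_betw f N {..<?n}" using ex_bij_betw_finite_nat[OF N] by (auto simp: atLeast0LessThan)
  let ?f = "the_inv_into N f"
  have fi: "bij_betw ?f {..<?n} N" by (rule bij_betw_the_inv_into[OF f])
  have ff: "?f x \<in> N" "f (?f x) = x" if "x \<in> {..<?n}" for x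
    using bij_betw_apply[OF fi that] f_the_inv_into_f_bij_betw[OF f that] by blast+
  let ?p = "\<lambda>R x y. x \<in> N \<and> y \<in> N \<and> R (f x) (f y)"
  have "\<not> (\<exists>g. bij_betw g N N \<and> (\<forall>x\<in>N. \<forall>y\<in>N. ?p R x y \<longleftrightarrow> ?p S (g x) (g y)))"
  proof
    assume "\<exists>g. bij_betw g N N \<and> (\<forall>x\<in>N. \<forall>y\<in>N. ?p R x y \<longleftrightarrow> ?p S (g x) (g y))"
    then obtain g where g: "bij_betw g N N" "\<And>x y. x \<in> N \<Longrightarrow> y \<in> N \<Longrightarrow> ?p R x y \<longleftrightarrow> ?p S (g x) (g y)" by blast
    have "bij_betw (f \<circ> (g \<circ> ?f)) {..<?n} {..<?n}"
      by (rule bij_betw_trans[OF bij_betw_trans[OF fi g(1)] f])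
    moreover have "R x y \<longleftrightarrow> S ((f \<circ> (g \<circ> ?f)) x) ((f \<circ> (g \<circ> ?f)) y)"
      if "x \<in> {..<?n}" "y \<in> {..<?n}" for x y
      using g(2)[OF ff(1)[OF that(1)] ff(1)[OF that(2)]] ff(2)[OF that(1)] ff(2)[OF that(2)]
        ff(1)[OF that(1)] ff(1)[OF that(2)] bij_betw_apply[OF g(1)] by simp
    ultimately show False using no by blast
  qed
  with reg_transfer[OF RS(1) f] reg_transfer[OF RS(2) f] show ?thesis by blast
qed

text \<open>These are the cases left over by \<open>two_regular_graphs\<close>: the flip supplies
  its size bound and the handshake lemma its parity.\<close>

lemma rigid_inner_degree:
  assumes E: "equitable V c D E" and rig: "rigid V c D" and mino: "minority V c D" and x: "x \<in> V" "c x = i"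
  shows "D i i \<le> 1 \<or> D i i = 2 \<and> card {v \<in> V. c v = i} = 5"
proof (rule ccontr)
  assume *: "\<not> ?thesis"
  let ?N = "{v \<in> V. c v = i}"
  have fin: "finite V" using equitableD(1)[OF E] .
  have 1: "2 * D i i + 1 \<le> card ?N" using mino x unfolding minority_def by force
  let ?R = "\<lambda>x y. x \<in> V \<and> y \<in> V \<and> c x = i \<and> c y = i \<and> E x y"
  have "card ?N * D i i = card {(x, y). ?R x y}" by (rule card_pairs_in_class[OF E, symmetric])
  also have "\<dots> = 2 * card {{x, y} | x y. ?R x y}"
    by (rule card_ordered_pairs[OF fin]) (use equitableD(2,3)[OF E] in auto)
  finally have 2: "even (card ?N * D i i)" by simp
  obtain R S where "reg ?N (D i i) R" "reg ?N (D i i) S"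
    "\<not> (\<exists>g. bij_betw g ?N ?N \<and> (\<forall>x\<in>?N. \<forall>y\<in>?N. R x y \<longleftrightarrow> S (g x) (g y)))"
    using two_regular_graphs[of ?N "D i i"] fin 1 2 * by auto
  then show False using rigid_reg_iso[OF E rig] by blast
qed

subsection \<open>Non-isomorphic biregular graphs\<close>

definition bireg :: "nat \<Rightarrow> nat \<Rightarrow> nat \<Rightarrow> nat \<Rightarrow> (nat \<Rightarrow> nat \<Rightarrow> bool) \<Rightarrow> bool" where
  "bireg a b k l T \<longleftrightarrow> (\<forall>m n. T m n \<longrightarrow> m < a \<and> n < b) \<and> (\<forall>m<a. card {n. T m n} = k) \<and> (\<forall>n<b. card {m. T m n} = l)"

text \<open>Number the edges by \<open>e < a * k\<close> and let \<open>e\<close> join row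
  \<open>e div k\<close> to column \<open>e mod b\<close>. Since \<open>k \<le> b\<close>, the
  \<open>k\<close> consecutive edges of a row hit different columns, and the edges of a column,
  being \<open>b\<close> apart, lie in different rows.\<close>

lemma bireg_exists:
  assumes "a * k = b * l" "k \<le> b" "0 < k"
  shows "\<exists>T. bireg a b k l T"
proof -
  let ?T = "\<lambda>m n. n < b \<and> (\<exists>e < a * k. e div k = m \<and> e mod b = n)"
  have "bireg a b k l ?T"
    unfolding bireg_def
  proof (intro conjI allI impI)
    fix m n assume *: "?T m n"
    then show "n < b" by blast
    show "m < a" using * assms(3) by (auto simp: less_mult_imp_div_less)
  next
    fix m assume m: "m < a"
    have b: "0 < b" using assms by simp
    have "{n. ?T m n} = (\<lambda>r. (m * k + r) mod b) ` {..<k}"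
    proof (intro set_eqI iffI)
      fix n assume "n \<in> {n. ?T m n}"
      then obtain e where e: "e < a * k" "e div k = m" "e mod b = n" by blast
      have "e = m * k + e mod k" using e(2) by (metis div_mult_mod_eq)
      then have "n = (m * k + e mod k) mod b" using e(3) by metis
      moreover have "e mod k < k" using assms(3) by simp
      ultimately show "n \<in> (\<lambda>r. (m * k + r) mod b) ` {..<k}" by blast
    next
      fix n assume "n \<in> (\<lambda>r. (m * k + r) mod b) ` {..<k}"
      then obtain r where r: "r < k" "n = (m * k + r) mod b" by blast
      have "(m + 1) * k \<le> a * k" using m by (intro mult_le_mono1) simp
      then have "m * k + r < a * k" using r(1) by simp
      moreover have "(m * k + r) div k = m" using r(1) by simp
      ultimately have "\<exists>e < a * k. e div k = m \<and> e mod b = n" using r(2) by blast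
      then show "n \<in> {n. ?T m n}" using r(2) b by simp
    qed
    moreover have "inj_on (\<lambda>r. (m * k + r) mod b) {..<k}"
    proof (rule linorder_inj_onI')
      fix r s assume rs: "r \<in> {..<k}" "s \<in> {..<k}" "r < s"
      show "(m * k + r) mod b \<noteq> (m * k + s) mod b"
      proof
        assume "(m * k + r) mod b = (m * k + s) mod b"
        then have "b dvd (m * k + s) - (m * k + r)" using rs(3) by (intro mod_eq_dvd_iff_nat[THEN iffD1]) auto
        then have "b dvd s - r" by simp
        then have "b \<le> s - r" using rs(3) by (intro dvd_imp_le) auto
        then show False using rs assms(2) by auto
      qed
    qed
    ultimately show "card {n. ?T m n} = k" by (simp add: card_image)
  next
    fix n assume n: "n < b"
    have "{m. ?T m n} = (\<lambda>t. (n + b * t) div k) ` {..<l}"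
    proof (intro set_eqI iffI)
      fix m assume "m \<in> {m. ?T m n}"
      then obtain e where e: "e < a * k" "e div k = m" "e mod b = n" by blast
      have ee: "e = n + b * (e div b)" using e(3) mod_mult_div_eq[of e b] by simp
      have "e div b < l" using e(1) assms(1) by (simp add: less_mult_imp_div_less mult.commute)
      moreover have "m = (n + b * (e div b)) div k" using e(2) ee by simp
      ultimately show "m \<in> (\<lambda>t. (n + b * t) div k) ` {..<l}" by blast
    next
      fix m assume "m \<in> (\<lambda>t. (n + b * t) div k) ` {..<l}"
      then obtain t where t: "t < l" "m = (n + b * t) div k" by blast
      have "b * (t + 1) \<le> b * l" using t(1) by (intro mult_le_mono2) simp
      then have "n + b * t < a * k" using n assms(1) by simp
      then show "m \<in> {m. ?T m n}" using t(2) n by auto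
    qed
    moreover have "inj_on (\<lambda>t. (n + b * t) div k) {..<l}"
    proof (rule linorder_inj_onI')
      fix t u :: nat assume tu: "t < u"
      have "b * (t + 1) \<le> b * u" using tu by (intro mult_le_mono2) simp
      then have "n + b * t + k \<le> n + b * u" using assms(2) by simp
      then have "(n + b * t + k) div k \<le> (n + b * u) div k" by (rule div_le_mono)
      moreover have "(n + b * t + k) div k = (n + b * t) div k + 1"
        using assms(3) div_add_self2[of k "n + b * t"] by linarith
      ultimately show "(n + b * t) div k \<noteq> (n + b * u) div k" by linarith
    qed
    ultimately show "card {m. ?T m n} = l" by (simp add: card_image)
  qed
  then show ?thesis by blast
qed

text \<open>In a biregular graph this means that the component of \<open>m\<close> is complete
  bipartite: a row sharing one neighbour with \<open>m\<close> shares them all and, having the same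
  degree, has no others.\<close>

definition closed_vertex :: "nat \<Rightarrow> (nat \<Rightarrow> nat \<Rightarrow> bool) \<Rightarrow> nat \<Rightarrow> bool" where
  "closed_vertex a T m \<longleftrightarrow> (\<forall>n n'. T m n \<longrightarrow> T m n' \<longrightarrow> (\<forall>m'<a. T m' n \<longleftrightarrow> T m' n'))"

lemma card_swap:
  assumes "finite A" "x \<in> A" "y \<notin> A"
  shows "card (insert y (A - {x})) = card A"
proof -
  have "card A > 0" using assms by (auto simp: card_gt_0_iff)
  then show ?thesis using assms by simp
qed

text \<open>The complete bipartite component of the first graph is destroyed by exchanging one of its
  edges with an edge outside of it.\<close>

lemma two_biregular_graphs:
  assumes "a * k = b * l" "2 \<le> k" "2 \<le> l" "2 * k \<le> b" "2 * l \<le> a"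
  shows "\<exists>T T'. bireg a b k l T \<and> bireg a b k l T' \<and>
    card {m. m < a \<and> closed_vertex a T' m} < card {m. m < a \<and> closed_vertex a T m}"
proof -
  \<comment> \<open>Removing a complete block of \<open>l\<close> rows and \<open>k\<close> columns
    keeps the edge count balanced and leaves at least \<open>k\<close> columns.\<close>
  have "(a - l) * k = (b - k) * l" using assms(1) by (simp add: diff_mult_distrib mult.commute[of l k])
  moreover have "k \<le> b - k" "0 < k" using assms(2,4) by linarith+
  ultimately obtain U where U: "bireg (a - l) (b - k) k l U"
    using bireg_exists by blast
  have Ulim: "\<And>m n. U m n \<Longrightarrow> m < a - l \<and> n < b - k"
    and Uk: "\<And>m. m < a - l \<Longrightarrow> card {n. U m n} = k" and Ul: "\<And>n. n < b - k \<Longrightarrow> card {m. U m n} = l"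
    using U unfolding bireg_def by blast+
  define T where "T m n \<longleftrightarrow> m < l \<and> n < k \<or> l \<le> m \<and> k \<le> n \<and> U (m - l) (n - k)" for m n
  have Tlow: "T m n \<longleftrightarrow> n < k" if "m < l" for m n using that by (auto simp: T_def)
  have Thigh: "k \<le> n" if "T m n" "l \<le> m" for m n using that by (auto simp: T_def)
  have Tcol: "T m n \<longleftrightarrow> m < l" if "n < k" for m n using that by (auto simp: T_def)
  have Tlim: "m < a \<and> n < b" if "T m n" for m n
    using that Ulim[of "m - l" "n - k"] assms unfolding T_def by linarith
  have Trow: "card {n. T m n} = k" if m: "m < a" for m
  proof (cases "m < l")
    case True
    then have "{n. T m n} = {..<k}" using Tlow by auto
    then show ?thesis by simp
  next
    case False
    then have "{n. T m n} = (\<lambda>n. n + k) ` {n. U (m - l) n}"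
      by (auto simp: T_def image_iff intro!: exI[of _ "_ - k"])
    then have "card {n. T m n} = card {n. U (m - l) n}" by (simp add: card_image)
    also have "\<dots> = k" using False m by (intro Uk) auto
    finally show ?thesis .
  qed
  have Tcl: "card {m. T m n} = l" if n: "n < b" for n
  proof (cases "n < k")
    case True
    then have "{m. T m n} = {..<l}" using Tcol by auto
    then show ?thesis by simp
  next
    case False
    then have "{m. T m n} = (\<lambda>m. m + l) ` {m. U m (n - k)}"
      by (auto simp: T_def image_iff intro!: exI[of _ "_ - l"])
    then have "card {m. T m n} = card {m. U m (n - k)}" by (simp add: card_image)
    also have "\<dots> = l" using False n by (intro Ul) auto
    finally show ?thesis .
  qed
  have T: "bireg a b k l T" unfolding bireg_def using Tlim Trow Tcl by blast
  have finr: "finite {n. T m n}" for m by (rule finite_subset[of _ "{..<b}"]) (use Tlim in auto)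
  have finc: "finite {m. T m n}" for n by (rule finite_subset[of _ "{..<a}"]) (use Tlim in auto)
  have la: "l < a" using assms by linarith
  have "{n. T l n} \<noteq> {}" using Trow[OF la] assms(2) by (metis card.empty not_numeral_le_zero)
  \<comment> \<open>Row \<open>l\<close> is the first one outside the block, so \<open>q\<close> is
    a column outside it.\<close>
  then obtain q where q: "T l q" by blast
  have qk: "k \<le> q" using Thigh[OF q] by simp
  \<comment> \<open>The edges (0, 0) and (l, q) give way to (0, q) and (l, 0), which changes no
    degree.\<close>
  define T' where "T' m n \<longleftrightarrow> T m n \<and> (m, n) \<noteq> (0, 0) \<and> (m, n) \<noteq> (l, q) \<or> (m, n) = (0, q) \<or> (m, n) = (l, 0)" for m n
  have l0: "0 < l" "0 < k" "q \<noteq> 0" using assms qk by auto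
  have T00: "T 0 0" "\<not> T 0 q" "\<not> T l 0" using l0 qk Tlow Tcol by auto
  have T': "bireg a b k l T'"
    unfolding bireg_def
  proof (intro conjI allI impI)
    fix m n assume "T' m n"
    then show "m < a" "n < b" using Tlim[of m n] Tlim[OF q] la unfolding T'_def by auto
  next
    fix m assume m: "m < a"
    have "{n. T' m n} = (if m = 0 then insert q ({n. T m n} - {0}) else
        if m = l then insert 0 ({n. T m n} - {q}) else {n. T m n})"
      using l0 T00 unfolding T'_def by auto
    then show "card {n. T' m n} = k"
      using Trow[OF m] card_swap[OF finr[of m], of 0 q] card_swap[OF finr[of m], of q 0] T00 q l0
      by (cases "m = 0"; cases "m = l") simp_all
  next
    fix n assume n: "n < b"
    have "{m. T' m n} = (if n = 0 then insert l ({m. T m n} - {0}) else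
        if n = q then insert 0 ({m. T m n} - {l}) else {m. T m n})"
      using l0 T00 unfolding T'_def by auto
    then show "card {m. T' m n} = l"
      using Tcl[OF n] card_swap[OF finc[of n], of 0 l] card_swap[OF finc[of n], of l 0] T00 q l0
      by (cases "n = 0"; cases "n = q") simp_all
  qed
  have other: "\<exists>n. T m n \<and> n \<noteq> n0" if "m < a" for m n0
  proof (rule ccontr)
    assume "\<not> ?thesis"
    then have "{n. T m n} \<subseteq> {n0}" by blast
    then have "card {n. T m n} \<le> 1" using card_mono[of "{n0}"] by simp
    then show False using Trow[OF that] assms(2) by simp
  qed
  \<comment> \<open>Neither a row of the block nor row \<open>l\<close> is closed in
    \<open>T'\<close>: rows 0 and 1 tell an exchanged column from an unaffected one. Any other
    closed row avoids column \<open>q\<close>, so its columns are unaffected and it was closed in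
    \<open>T\<close>.\<close>
  have key: "closed_vertex a T m \<and> l \<le> m" if m: "m < a" and cl: "closed_vertex a T' m" for m
  proof -
    have clD: "T' m' n \<longleftrightarrow> T' m' n'" if "T' m n" "T' m n'" "m' < a" for n n' m'
      using cl that unfolding closed_vertex_def by blast
    have a1: "0 < a" "1 < a" using assms by linarith+
    have 1: "m \<noteq> 0"
    proof
      assume [simp]: "m = 0"
      have "T' m 1" "T' m q" using assms(2,3) Tlow[of 0 1] l0 unfolding T'_def by auto
      then have "T' 1 1 \<longleftrightarrow> T' 1 q" using a1 by (intro clD)
      moreover have "T' 1 1" using assms(2,3) Tlow[of 1 1] unfolding T'_def by auto
      moreover have "\<not> T' 1 q" using assms(3) Tlow[of 1 q] qk unfolding T'_def by auto
      ultimately show False by blast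
    qed
    have 2: "\<not> m < l"
    proof
      assume ml: "m < l"
      have "T' m 0" "T' m 1" using assms(2) Tlow[OF ml] 1 ml l0 unfolding T'_def by auto
      then have "T' 0 0 \<longleftrightarrow> T' 0 1" using a1 by (intro clD)
      moreover have "T' 0 1" using assms(2) Tlow[of 0 1] l0 unfolding T'_def by auto
      moreover have "\<not> T' 0 0" using l0 unfolding T'_def by auto
      ultimately show False by blast
    qed
    have 3: "m \<noteq> l"
    proof
      assume [simp]: "m = l"
      obtain n1 where n1: "T l n1" "n1 \<noteq> q" using other[OF la] by blast
      have n1k: "k \<le> n1" using Thigh[OF n1(1)] by simp
      have "T' m 0" "T' m n1" using n1 l0 unfolding T'_def by auto
      then have "T' 1 0 \<longleftrightarrow> T' 1 n1" using a1 by (intro clD)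
      moreover have "T' 1 0" using assms(3) Tlow[of 1 0] l0 unfolding T'_def by auto
      moreover have "\<not> T' 1 n1" using assms(3) Tlow[of 1 n1] n1k unfolding T'_def by auto
      ultimately show False by blast
    qed
    have same: "T' m n \<longleftrightarrow> T m n" for n using 1 3 unfolding T'_def by auto
    have nq: "n \<noteq> q" if "T m n" for n
    proof
      assume [simp]: "n = q"
      obtain n1 where n1: "T m n1" "n1 \<noteq> q" using other[OF m] by blast
      have n1k: "k \<le> n1" using Thigh[OF n1(1)] 2 by simp
      have "T' 0 q \<longleftrightarrow> T' 0 n1" using a1 that n1 same by (intro clD) auto
      moreover have "T' 0 q" unfolding T'_def by auto
      moreover have "\<not> T' 0 n1" using Tlow[of 0 n1] n1 n1k l0 unfolding T'_def by auto
      ultimately show False by blast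
    qed
    have col: "T' m' n \<longleftrightarrow> T m' n" if "T m n" for m' n
      using nq[OF that] Thigh[OF that] 2 l0 unfolding T'_def by auto
    have "closed_vertex a T m"
      unfolding closed_vertex_def using clD same col by blast
    then show ?thesis using 2 by simp
  qed
  have "closed_vertex a T 0" unfolding closed_vertex_def using Tlow[of 0] Tcol l0 by auto
  then have "0 \<in> {m. m < a \<and> closed_vertex a T m}" using la by simp
  moreover have "0 \<notin> {m. m < a \<and> closed_vertex a T' m}" using key[of 0] l0 by auto
  ultimately have "{m. m < a \<and> closed_vertex a T' m} \<subset> {m. m < a \<and> closed_vertex a T m}"
    using key by blast
  then have "card {m. m < a \<and> closed_vertex a T' m} < card {m. m < a \<and> closed_vertex a T m}"
    by (intro psubset_card_mono) auto
  with T T' show ?thesis by blast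
qed

text \<open>An isomorphism of the two patched graphs, read in the numberings \<open>f\<close> and
  \<open>h\<close> of the classes, would preserve the number of closed rows.\<close>

lemma rigid_outer_degree:
  assumes E: "equitable V c D E" and rig: "rigid V c D" and mino: "minority V c D"
    and xy: "x \<in> V" "y \<in> V" "c x = i" "c y = j" "i \<noteq> j"
  shows "\<not> (2 \<le> D i j \<and> 2 \<le> D j i)"
proof
  assume *: "2 \<le> D i j \<and> 2 \<le> D j i"
  let ?A = "{v \<in> V. c v = i}" and ?B = "{v \<in> V. c v = j}"
  let ?a = "card ?A" and ?b = "card ?B"
  have fin: "finite ?A" "finite ?B" using equitableD(1)[OF E] by simp_all
  have m: "2 * D i j \<le> ?b" "2 * D j i \<le> ?a"
    using mino xy unfolding minority_def by force+
  obtain T T' where T: "bireg ?a ?b (D i j) (D j i) T" and T': "bireg ?a ?b (D i j) (D j i) T'"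
    and less: "card {m. m < ?a \<and> closed_vertex ?a T' m} < card {m. m < ?a \<and> closed_vertex ?a T m}"
    using two_biregular_graphs[OF degree_symmetry[OF E, of i j]] * m by blast
  obtain f where f: "bij_betw f ?A {..<?a}" using ex_bij_betw_finite_nat[OF fin(1)] by (auto simp: atLeast0LessThan)
  obtain h where h: "bij_betw h ?B {..<?b}" using ex_bij_betw_finite_nat[OF fin(2)] by (auto simp: atLeast0LessThan)
  have d1: "card {y \<in> V. c y = j \<and> T (f x) (h y)} = D i j" if "bireg ?a ?b (D i j) (D j i) T" "x \<in> V" "c x = i" for T x
  proof -
    have "f x < ?a" using bij_betw_apply[OF f, of x] that by simp
    moreover have "bij_betw h {y \<in> V. c y = j \<and> T (f x) (h y)} {n. T (f x) n}"
      using h that(1) unfolding bij_betw_def inj_on_def bireg_def by auto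
    ultimately show ?thesis using that(1) bij_betw_same_card unfolding bireg_def by fastforce
  qed
  have d2: "card {x \<in> V. c x = i \<and> T (f x) (h y)} = D j i" if "bireg ?a ?b (D i j) (D j i) T" "y \<in> V" "c y = j" for T y
  proof -
    have "h y < ?b" using bij_betw_apply[OF h, of y] that by simp
    moreover have "bij_betw f {x \<in> V. c x = i \<and> T (f x) (h y)} {m. T m (h y)}"
      using f that(1) unfolding bij_betw_def inj_on_def bireg_def by auto
    ultimately show ?thesis using that(1) bij_betw_same_card unfolding bireg_def by fastforce
  qed
  obtain g where g: "bij_betw g V V" "\<forall>x\<in>V. c (g x) = c x"
    "\<forall>x\<in>V. \<forall>y\<in>V. c x = i \<longrightarrow> c y = j \<longrightarrow> (T (f x) (h y) \<longleftrightarrow> T' (f (g x)) (h (g y)))"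
    using rigid_bipartite_iso[OF E rig xy(5) d1[OF T] d2[OF T] d1[OF T'] d2[OF T']] by blast
  have gcl: "bij_betw g {v \<in> V. c v = k} {v \<in> V. c v = k}" for k
  proof -
    have "g ` {v \<in> V. c v = k} \<subseteq> {v \<in> V. c v = k}" using g(2) bij_betw_apply[OF g(1)] by auto
    moreover have "inj_on g {v \<in> V. c v = k}" using g(1) by (auto simp: bij_betw_def intro: inj_on_subset)
    ultimately show ?thesis using equitableD(1)[OF E] by (simp add: bij_betw_def endo_inj_surj)
  qed
  define \<alpha> where "\<alpha> = f \<circ> g \<circ> the_inv_into ?A f"
  define \<beta> where "\<beta> = h \<circ> g \<circ> the_inv_into ?B h"
  have \<alpha>: "bij_betw \<alpha> {..<?a} {..<?a}" unfolding \<alpha>_def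
    using bij_betw_the_inv_into[OF f] gcl[of i] f by (auto intro!: bij_betw_trans)
  have \<beta>: "bij_betw \<beta> {..<?b} {..<?b}" unfolding \<beta>_def
    using bij_betw_the_inv_into[OF h] gcl[of j] h by (auto intro!: bij_betw_trans)
  have TT: "T m n \<longleftrightarrow> T' (\<alpha> m) (\<beta> n)" if mn: "m < ?a" "n < ?b" for m n
  proof -
    let ?x = "the_inv_into ?A f m" and ?y = "the_inv_into ?B h n"
    have "?x \<in> ?A" "f ?x = m" using bij_betw_apply[OF bij_betw_the_inv_into[OF f]] f_the_inv_into_f_bij_betw[OF f] mn by auto
    moreover have "?y \<in> ?B" "h ?y = n" using bij_betw_apply[OF bij_betw_the_inv_into[OF h]] f_the_inv_into_f_bij_betw[OF h] mn by auto
    ultimately show ?thesis using g(3)[rule_format, of ?x ?y] by (simp add: \<alpha>_def \<beta>_def)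
  qed
  have lim: "m < ?a \<and> n < ?b" if "T m n \<or> T' m n" for m n using T T' that unfolding bireg_def by blast
  have "closed_vertex ?a T m \<longleftrightarrow> closed_vertex ?a T' (\<alpha> m)" if m: "m < ?a" for m
  proof
    have \<alpha>m: "\<alpha> m < ?a" using bij_betw_apply[OF \<alpha>] m by simp
    assume cl: "closed_vertex ?a T m"
    show "closed_vertex ?a T' (\<alpha> m)"
      unfolding closed_vertex_def
    proof (intro allI impI)
      fix n n' m' assume *: "T' (\<alpha> m) n" "T' (\<alpha> m) n'" "m' < ?a"
      have "n \<in> {..<?b}" "n' \<in> {..<?b}" "m' \<in> {..<?a}" using lim * by blast+
      then have "n \<in> \<beta> ` {..<?b}" "n' \<in> \<beta> ` {..<?b}" "m' \<in> \<alpha> ` {..<?a}"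
        using \<alpha> \<beta> unfolding bij_betw_def by simp_all
      then obtain p p' r where p: "n = \<beta> p" "p < ?b" "n' = \<beta> p'" "p' < ?b" "m' = \<alpha> r" "r < ?a"
        by blast
      have "T m p" "T m p'" using * p TT m by simp_all
      then have "T r p \<longleftrightarrow> T r p'" using cl p(6) unfolding closed_vertex_def by blast
      then show "T' m' n \<longleftrightarrow> T' m' n'" using TT p by simp
    qed
  next
    assume cl: "closed_vertex ?a T' (\<alpha> m)"
    show "closed_vertex ?a T m"
      unfolding closed_vertex_def
    proof (intro allI impI)
      fix n n' m' assume *: "T m n" "T m n'" "m' < ?a"
      have n: "n < ?b" "n' < ?b" using lim * by blast+
      have "T' (\<alpha> m) (\<beta> n)" "T' (\<alpha> m) (\<beta> n')" using TT m n * by simp_all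
      moreover have "\<alpha> m' < ?a" using bij_betw_apply[OF \<alpha>] *(3) by simp
      ultimately have "T' (\<alpha> m') (\<beta> n) \<longleftrightarrow> T' (\<alpha> m') (\<beta> n')" using cl unfolding closed_vertex_def by blast
      then show "T m' n \<longleftrightarrow> T m' n'" using TT n *(3) by simp
    qed
  qed
  then have "card {m \<in> {..<?a}. closed_vertex ?a T m} = card {m \<in> {..<?a}. closed_vertex ?a T' m}"
    by (intro bij_betw_card_Collect[OF \<alpha>]) auto
  then show False using less by simp
qed

subsection \<open>Overlaps of two regular graphs\<close>

lemma extend_injection:
  assumes N: "finite N" and S: "S \<subseteq> N" "inj_on g S" "g ` S \<subseteq> N"
  shows "\<exists>\<sigma>. bij_betw \<sigma> N N \<and> (\<forall>x\<in>S. \<sigma> x = g x)"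
proof -
  have fS: "finite S" using N S(1) finite_subset by blast
  have "card (N - S) = card (N - g ` S)"
    using N S fS by (simp add: card_Diff_subset card_image)
  then obtain h where h: "bij_betw h (N - S) (N - g ` S)"
    using finite_same_card_bij[of "N - S" "N - g ` S"] N by blast
  let ?\<sigma> = "\<lambda>x. if x \<in> S then g x else h x"
  have "bij_betw ?\<sigma> S (g ` S) \<longleftrightarrow> bij_betw g S (g ` S)" by (rule bij_betw_cong) simp
  moreover have "bij_betw g S (g ` S)" using S(2) by (simp add: bij_betw_def)
  moreover have "bij_betw ?\<sigma> (N - S) (N - g ` S) \<longleftrightarrow> bij_betw h (N - S) (N - g ` S)" by (rule bij_betw_cong) simp
  ultimately have "bij_betw ?\<sigma> (S \<union> (N - S)) (g ` S \<union> (N - g ` S))"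
    using h by (intro bij_betw_combine) auto
  moreover have "S \<union> (N - S) = N" "g ` S \<union> (N - g ` S) = N" using S by auto
  ultimately have "bij_betw ?\<sigma> N N" by simp
  then show ?thesis by (intro exI[of _ ?\<sigma>]) simp
qed

text \<open>For adjacency matrices this counts the ordered pairs that are edges of \<open>a\<close>
  and are sent by \<open>\<sigma>\<close> to edges of \<open>b\<close>. Integers are used because
  differences of entries occur.\<close>

definition overlap :: "'a set \<Rightarrow> ('a \<Rightarrow> 'a \<Rightarrow> int) \<Rightarrow> ('a \<Rightarrow> 'a \<Rightarrow> int) \<Rightarrow> ('a \<Rightarrow> 'a) \<Rightarrow> int" where
  "overlap N a b \<sigma> = (\<Sum>u\<in>N. \<Sum>v\<in>N. a u v * b (\<sigma> u) (\<sigma> v))"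

text \<open>Isolates the terms with \<open>x\<close> or \<open>y\<close>: exchanging
  \<open>\<sigma> x\<close> and \<open>\<sigma> y\<close> affects only the middle sum.\<close>

lemma overlap_split:
  assumes W: "finite W" "x \<notin> W" "y \<notin> W" "x \<noteq> y" and N: "N = insert x (insert y W)"
    and sym: "\<And>u v. a u v = a v u" "\<And>u v. b u v = b v u" and diag: "\<And>u. a u u = 0"
  shows "overlap N a b \<sigma> = (\<Sum>u\<in>W. \<Sum>v\<in>W. a u v * b (\<sigma> u) (\<sigma> v))
    + 2 * (\<Sum>w\<in>W. a x w * b (\<sigma> x) (\<sigma> w) + a y w * b (\<sigma> y) (\<sigma> w)) + 2 * (a x y * b (\<sigma> x) (\<sigma> y))"
proof -
  have N_sum: "(\<Sum>v\<in>N. f v) = f x + (f y + (\<Sum>v\<in>W. f v))" for f :: "'a \<Rightarrow> int"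
    unfolding N using W by simp
  have "(\<Sum>w\<in>W. a w x * b (\<sigma> w) (\<sigma> x)) = (\<Sum>w\<in>W. a x w * b (\<sigma> x) (\<sigma> w))"
    "(\<Sum>w\<in>W. a w y * b (\<sigma> w) (\<sigma> y)) = (\<Sum>w\<in>W. a y w * b (\<sigma> y) (\<sigma> w))"
    by (simp_all only: sym(1)[of _ x] sym(1)[of _ y] sym(2)[of _ "\<sigma> x"] sym(2)[of _ "\<sigma> y"])
  moreover have "a y x * b (\<sigma> y) (\<sigma> x) = a x y * b (\<sigma> x) (\<sigma> y)" using sym by metis
  ultimately show ?thesis
    unfolding overlap_def N_sum by (simp add: sum.distrib diag algebra_simps)
qed

text \<open>If the overlap were constant, so would be its change under transposing \<open>x\<close> and \<open>y\<close>, which is bilinear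
  in the differences \<open>a x w - a y w\<close> and \<open>b p w - b q w\<close>. Exchanging the images of \<open>z\<close> and \<open>z'\<close>
  alters that bilinear expression by 4.\<close>

lemma overlap_not_constant:
  assumes N: "finite N"
    and sym: "\<And>u v. a u v = a v u" "\<And>u v. b u v = b v u" and diag: "\<And>u. a u u = 0"
    and xy: "x \<in> N" "y \<in> N" "z \<in> N" "z' \<in> N" "distinct [x, y, z, z']"
    and pq: "p \<in> N" "q \<in> N" "r \<in> N" "r' \<in> N" "distinct [p, q, r, r']"
    and a: "a x z - a y z = 1" "a x z' - a y z' = -1"
    and b: "b p r - b q r = 1" "b p r' - b q r' = -1"
    and const: "\<And>\<sigma>. bij_betw \<sigma> N N \<Longrightarrow> overlap N a b \<sigma> = K"
  shows False
proof -
  let ?W = "N - {x, y}"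
  let ?a = "\<lambda>w. a x w - a y w"
  let ?S = "\<lambda>\<sigma>. \<Sum>w\<in>?W. ?a w * (b (\<sigma> x) (\<sigma> w) - b (\<sigma> y) (\<sigma> w))"
  have ne: "x \<noteq> y" using xy(5) by simp
  have NW: "N = insert x (insert y ?W)" using xy by blast
  note split = overlap_split[of ?W x y N a b, OF _ _ _ ne NW sym diag]
  \<comment> \<open>Exchanging the images of \<open>x\<close> and \<open>y\<close> changes the
    overlap by twice \<open>?S \<sigma>\<close>, up to sign.\<close>
  have S0: "?S \<sigma> = 0" if \<sigma>: "bij_betw \<sigma> N N" for \<sigma>
  proof -
    let ?\<tau> = "\<sigma>(x := \<sigma> y, y := \<sigma> x)"
    have "?\<tau> = \<sigma> \<circ> (id(x := y, y := x))" using ne by (auto simp: fun_eq_iff)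
    moreover have "bij_betw (id(x := y, y := x)) N N"
      by (rule bij_betw_byWitness[where f' = "id(x := y, y := x)"]) (use xy ne in auto)
    ultimately have \<tau>: "bij_betw ?\<tau> N N" using \<sigma> bij_betw_trans by metis
    have t: "?\<tau> x = \<sigma> y" "?\<tau> y = \<sigma> x" using ne by simp_all
    have tw: "?\<tau> w = \<sigma> w" if "w \<in> ?W" for w using that by simp
    have 1: "(\<Sum>u\<in>?W. \<Sum>v\<in>?W. a u v * b (?\<tau> u) (?\<tau> v)) = (\<Sum>u\<in>?W. \<Sum>v\<in>?W. a u v * b (\<sigma> u) (\<sigma> v))"
      by (intro sum.cong refl) (simp add: tw)
    have 2: "(\<Sum>w\<in>?W. a x w * b (?\<tau> x) (?\<tau> w) + a y w * b (?\<tau> y) (?\<tau> w)) =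
        (\<Sum>w\<in>?W. a x w * b (\<sigma> y) (\<sigma> w) + a y w * b (\<sigma> x) (\<sigma> w))"
      unfolding t by (intro sum.cong refl) (simp add: tw)
    have "overlap N a b \<sigma> = overlap N a b ?\<tau>" using const[OF \<sigma>] const[OF \<tau>] by simp
    then have "(\<Sum>w\<in>?W. a x w * b (\<sigma> x) (\<sigma> w) + a y w * b (\<sigma> y) (\<sigma> w)) =
        (\<Sum>w\<in>?W. a x w * b (\<sigma> y) (\<sigma> w) + a y w * b (\<sigma> x) (\<sigma> w))"
      using split[of \<sigma>] split[of ?\<tau>] N unfolding 1 2 t by (simp add: sym(2)[of "\<sigma> y" "\<sigma> x"])
    then have "(\<Sum>w\<in>?W. (a x w * b (\<sigma> x) (\<sigma> w) + a y w * b (\<sigma> y) (\<sigma> w)) -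
        (a x w * b (\<sigma> y) (\<sigma> w) + a y w * b (\<sigma> x) (\<sigma> w))) = 0"
      unfolding sum_subtractf by simp
    then show ?thesis by (simp add: algebra_simps)
  qed
  \<comment> \<open>For this placement the terms of \<open>?S\<close> at \<open>z\<close> and
    \<open>z'\<close> are both 1. After exchanging \<open>r\<close> and \<open>r'\<close> both are
    -1 and all other terms are the same, so the two sums cannot both vanish.\<close>
  let ?g = "(\<lambda>_. p)(x := p, y := q, z := r, z' := r')"
  have "\<exists>\<sigma>. bij_betw \<sigma> N N \<and> (\<forall>u\<in>{x, y, z, z'}. \<sigma> u = ?g u)"
    by (rule extend_injection[OF N]) (use xy pq in auto)
  then obtain \<sigma> where \<sigma>: "bij_betw \<sigma> N N" and \<sigma>g: "\<And>u. u \<in> {x, y, z, z'} \<Longrightarrow> \<sigma> u = ?g u" by blast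
  have \<sigma>v: "\<sigma> x = p" "\<sigma> y = q" "\<sigma> z = r" "\<sigma> z' = r'" using \<sigma>g xy(5) by auto
  let ?\<rho> = "\<sigma>(z := r', z' := r)"
  have "?\<rho> = \<sigma> \<circ> (id(z := z', z' := z))" using \<sigma>v xy(5) by (auto simp: fun_eq_iff)
  moreover have "bij_betw (id(z := z', z' := z)) N N"
    by (rule bij_betw_byWitness[where f' = "id(z := z', z' := z)"]) (use xy in auto)
  ultimately have \<rho>: "bij_betw ?\<rho> N N" using \<sigma> bij_betw_trans by metis
  have \<rho>v: "?\<rho> x = p" "?\<rho> y = q" "?\<rho> z = r'" "?\<rho> z' = r" using \<sigma>v xy(5) by auto
  let ?U = "?W - {z, z'}"
  have WU: "?W = insert z (insert z' ?U)" using xy by auto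
  have W_sum: "(\<Sum>w\<in>?W. f w) = f z + (f z' + (\<Sum>w\<in>?U. f w))" for f :: "'a \<Rightarrow> int"
    using N xy(5) by (subst WU) simp
  let ?f = "\<lambda>\<sigma> w. ?a w * (b (\<sigma> x) (\<sigma> w) - b (\<sigma> y) (\<sigma> w))"
  have 1: "(\<Sum>w\<in>?U. ?f ?\<rho> w) = (\<Sum>w\<in>?U. ?f \<sigma> w)"
    by (intro sum.cong refl) (use \<sigma>v \<rho>v xy(5) in auto)
  have "?f \<sigma> z = 1" "?f \<sigma> z' = 1" using a b \<sigma>v by simp_all
  then have "1 + (1 + (\<Sum>w\<in>?U. ?f \<sigma> w)) = 0" using S0[OF \<sigma>] W_sum[of "?f \<sigma>"] by linarith
  moreover have "?f ?\<rho> z = -1" "?f ?\<rho> z' = -1" unfolding \<rho>v using a b by simp_all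
  then have "-1 + (-1 + (\<Sum>w\<in>?U. ?f ?\<rho> w)) = 0" using S0[OF \<rho>] W_sum[of "?f ?\<rho>"] by linarith
  ultimately show False using 1 by linarith
qed

text \<open>Some \<open>z\<close> has a neighbour \<open>x\<close> and a non-neighbour
  \<open>y\<close>. As \<open>x\<close> and \<open>y\<close> have equal degrees and \<open>z\<close>
  is private to \<open>x\<close>, some neighbour \<open>z'\<close> must be private to
  \<open>y\<close>.\<close>

lemma reg_witness:
  assumes N: "finite N" "reg N k R" "N \<noteq> {}" "1 \<le> k" "k + 2 \<le> card N"
  shows "\<exists>x y z z'. x \<in> N \<and> y \<in> N \<and> z \<in> N \<and> z' \<in> N \<and> distinct [x, y, z, z'] \<and>
    R x z \<and> \<not> R y z \<and> R y z' \<and> \<not> R x z'"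
proof -
  obtain z where z: "z \<in> N" using N(3) by blast
  have fin: "finite {y. R x y}" for x by (rule finite_subset[OF _ N(1)]) (use regD(4)[OF N(2)] in blast)
  have "{y. R z y} \<noteq> {}" using regD(5)[OF N(2) z] N(4) by (metis card.empty not_one_le_zero)
  then obtain x where x: "R z x" by blast
  have "card (insert z {y. R z y}) < card N"
    using regD(5)[OF N(2) z] N(5) fin card_insert_le_m1 by (simp add: card_insert_if)
  then have "\<not> N \<subseteq> insert z {y. R z y}" using card_mono[of "insert z {y. R z y}" N] fin by auto
  then obtain y where y: "y \<in> N" "y \<noteq> z" "\<not> R z y" by blast
  have xN: "x \<in> N" "R x z" using x regD(1,4)[OF N(2)] by blast+
  have yz: "\<not> R y z" using y(3) regD(1)[OF N(2)] by blast
  have xy: "x \<noteq> y" using x y(3) by blast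
  have xz: "x \<noteq> z" using x regD(2)[OF N(2)] by blast
  have "\<exists>z'. z' \<noteq> x \<and> R y z' \<and> \<not> R x z'"
  proof (rule ccontr)
    assume "\<not> ?thesis"
    \<comment> \<open>\<open>x\<close> and \<open>y\<close> are left out of each other's
      neighbourhoods, so the count works whether or not they are adjacent.\<close>
    then have sub: "{w. R y w} - {x} \<subseteq> {w. R x w} - {y, z}" using yz regD(2)[OF N(2), of y] by blast
    have "card ({w. R y w} - {x}) \<le> card ({w. R x w} - {y, z})" using sub fin by (intro card_mono) auto
    moreover have "R y x \<longleftrightarrow> R x y" using regD(1)[OF N(2)] by blast
    then have "card ({w. R y w} - {x}) = k - (if R x y then 1 else 0)"
      using regD(5)[OF N(2) y(1)] fin by (auto simp: card_Diff_singleton_if)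
    moreover have "card ({w. R x w} - {y, z}) = k - 1 - (if R x y then 1 else 0)"
    proof -
      have "{w. R x w} - {y, z} = {w. R x w} - {z} - {y}" by blast
      then show ?thesis
        using regD(5)[OF N(2) xN(1)] fin xN(2) y(2) by (auto simp: card_Diff_singleton_if)
    qed
    moreover have "R x y \<Longrightarrow> 2 \<le> k"
    proof -
      assume "R x y"
      then have "card {y, z} \<le> card {w. R x w}" using xN(2) fin by (intro card_mono) auto
      then show "2 \<le> k" using regD(5)[OF N(2) xN(1)] y(2) by simp
    qed
    ultimately show False using N(4) by (auto split: if_splits)
  qed
  then obtain z' where z': "z' \<noteq> x" "R y z'" "\<not> R x z'" by blast
  have "z' \<in> N" "z' \<noteq> y" "z' \<noteq> z" using z' regD(2,4)[OF N(2)] yz by blast+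
  then show ?thesis using xN z y yz xy xz z' by (intro exI[of _ x] exI[of _ y] exI[of _ z] exI[of _ z']) auto
qed

text \<open>The bounds on \<open>k\<close> and \<open>l\<close> make both graphs neither edgeless
  nor complete, which provides the four witnesses in each.\<close>

lemma reg_overlap:
  assumes N: "finite N" and R: "reg N k R" "1 \<le> k" "k + 2 \<le> card N"
    and S: "reg N l S" "1 \<le> l" "l + 2 \<le> card N"
  shows "\<exists>\<sigma>. bij_betw \<sigma> N N \<and>
    card {(x, y). x \<in> N \<and> y \<in> N \<and> R x y \<and> S (\<sigma> x) (\<sigma> y)} \<noteq> card {(x, y). x \<in> N \<and> y \<in> N \<and> R x y \<and> S x y}"
proof (rule ccontr)
  assume no: "\<not> ?thesis"
  let ?c = "\<lambda>\<sigma>. card {(x, y). x \<in> N \<and> y \<in> N \<and> R x y \<and> S (\<sigma> x) (\<sigma> y)}"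
  define a where "a x y = (if R x y then 1 else 0 :: int)" for x y
  define b where "b x y = (if S x y then 1 else 0 :: int)" for x y
  have ne: "N \<noteq> {}" using R(3) by auto
  obtain x y z z' where x: "x \<in> N" "y \<in> N" "z \<in> N" "z' \<in> N" "distinct [x, y, z, z']"
    "R x z" "\<not> R y z" "R y z'" "\<not> R x z'" using reg_witness[OF N R(1) ne R(2,3)] by blast
  obtain p q r r' where p: "p \<in> N" "q \<in> N" "r \<in> N" "r' \<in> N" "distinct [p, q, r, r']"
    "S p r" "\<not> S q r" "S q r'" "\<not> S p r'" using reg_witness[OF N S(1) ne S(2,3)] by blast
  have ov: "overlap N a b \<sigma> = int (?c \<sigma>)" for \<sigma>
  proof -
    have "overlap N a b \<sigma> = (\<Sum>(u, v)\<in>N \<times> N. if R u v \<and> S (\<sigma> u) (\<sigma> v) then 1 else 0)"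
      unfolding overlap_def sum.cartesian_product by (intro sum.cong) (auto simp: a_def b_def)
    also have "\<dots> = (\<Sum>w\<in>N \<times> N. if R (fst w) (snd w) \<and> S (\<sigma> (fst w)) (\<sigma> (snd w)) then 1 else 0)"
      by (intro sum.cong) auto
    also have "\<dots> = int (card {w \<in> N \<times> N. R (fst w) (snd w) \<and> S (\<sigma> (fst w)) (\<sigma> (snd w))})"
      using N by (simp add: sum.If_cases Int_def)
    also have "{w \<in> N \<times> N. R (fst w) (snd w) \<and> S (\<sigma> (fst w)) (\<sigma> (snd w))} =
        {(x, y). x \<in> N \<and> y \<in> N \<and> R x y \<and> S (\<sigma> x) (\<sigma> y)}" by auto
    finally show ?thesis .
  qed
  show False
  proof (rule overlap_not_constant[OF N, of a b x y z z' p q r r'])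
    show "a u v = a v u" for u v using regD(1)[OF R(1)] by (auto simp: a_def)
    show "b u v = b v u" for u v using regD(1)[OF S(1)] by (auto simp: b_def)
    show "a u u = 0" for u using regD(2)[OF R(1)] by (simp add: a_def)
    show "overlap N a b \<sigma> = int (card {(x, y). x \<in> N \<and> y \<in> N \<and> R x y \<and> S x y})" if "bij_betw \<sigma> N N" for \<sigma>
      unfolding ov using no that by auto
  qed (use x p in \<open>simp_all add: a_def b_def\<close>)
qed

subsection \<open>Rigid graphs reduce to isolated vertices, perfect matchings and 5-cycles\<close>

definition cls :: "'a set \<Rightarrow> ('a \<Rightarrow> 'c) \<Rightarrow> 'c \<Rightarrow> 'a set" where
  "cls V c i = {v \<in> V. c v = i}"

text \<open>The ends of a path of matched classes: at a turn \<open>i\<close>, the edges to the class \<open>j\<close> (possibly \<open>i\<close>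
  itself) induce a regular graph on the class \<open>i\<close>.\<close>

definition turn_rel :: "'a set \<Rightarrow> ('a \<Rightarrow> 'c) \<Rightarrow> ('a \<Rightarrow> 'a \<Rightarrow> bool) \<Rightarrow> 'c \<Rightarrow> 'c \<Rightarrow> 'a \<Rightarrow> 'a \<Rightarrow> bool" where
  "turn_rel V c F i j x x' \<longleftrightarrow> x \<in> cls V c i \<and> x' \<in> cls V c i \<and> x \<noteq> x' \<and>
    (if j = i then F x x' else \<exists>y\<in>cls V c j. F x y \<and> F x' y)"

text \<open>For \<open>j \<noteq> i\<close>, vertices of class \<open>i\<close> are related when
  they share their only neighbour in class \<open>j\<close>; this yields disjoint cliques of size
  \<open>D j i\<close>.\<close>

definition turn :: "('c \<Rightarrow> 'c \<Rightarrow> nat) \<Rightarrow> 'c \<Rightarrow> 'c \<Rightarrow> bool" where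
  "turn D i j \<longleftrightarrow> (if j = i then 1 \<le> D i i else D i j = 1 \<and> 2 \<le> D j i)"

definition matched :: "('c \<Rightarrow> 'c \<Rightarrow> nat) \<Rightarrow> 'c \<Rightarrow> 'c \<Rightarrow> bool" where
  "matched D i j \<longleftrightarrow> i \<noteq> j \<and> D i j = 1 \<and> D j i = 1"

text \<open>The composition of the edge relations between consecutive classes. Being a relation and
  not a function, it makes sense for every \<open>F\<close> and is carried along by
  isomorphisms.\<close>

fun path_rel :: "'a set \<Rightarrow> ('a \<Rightarrow> 'c) \<Rightarrow> ('a \<Rightarrow> 'a \<Rightarrow> bool) \<Rightarrow> 'c list \<Rightarrow> 'a \<Rightarrow> 'a \<Rightarrow> bool" where
  "path_rel V c F [] x y \<longleftrightarrow> False"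
| "path_rel V c F [i] x y \<longleftrightarrow> x \<in> cls V c i \<and> y = x"
| "path_rel V c F (i # j # p) x y \<longleftrightarrow> x \<in> cls V c i \<and> (\<exists>z\<in>cls V c j. F x z \<and> path_rel V c F (j # p) z y)"

text \<open>Edges between classes that are not consecutive on the path do not influence it.\<close>

lemma path_rel_cong:
  assumes "successively (\<lambda>a b. \<forall>x\<in>cls V c a. \<forall>y\<in>cls V c b. F x y \<longleftrightarrow> F' x y) p"
  shows "path_rel V c F p x y \<longleftrightarrow> path_rel V c F' p x y"
  using assms
proof (induction p arbitrary: x)
  case (Cons i p)
  show ?case
  proof (cases p)
    case (Cons j q)
    then show ?thesis using Cons.IH Cons.prems by auto
  qed simp
qed simp

lemma cls_bij:
  assumes V: "finite V" and g: "bij_betw g V V" "\<forall>x\<in>V. c (g x) = c x"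
  shows "bij_betw g (cls V c i) (cls V c i)"
proof -
  have "g ` cls V c i \<subseteq> cls V c i" using g(2) bij_betw_apply[OF g(1)] by (auto simp: cls_def)
  moreover have "inj_on g (cls V c i)" using g(1) by (auto simp: bij_betw_def cls_def intro: inj_on_subset)
  ultimately show ?thesis using V by (simp add: bij_betw_def endo_inj_surj cls_def)
qed

lemma path_rel_iso:
  assumes V: "finite V" and g: "bij_betw g V V" "\<forall>x\<in>V. c (g x) = c x"
    and iso: "\<forall>x\<in>V. \<forall>y\<in>V. F x y \<longleftrightarrow> F' (g x) (g y)" and xy: "x \<in> V" "path_rel V c F p x y"
  shows "path_rel V c F' p (g x) (g y)"
  using xy
proof (induction p arbitrary: x)
  case (Cons i p)
  have i: "g x \<in> cls V c i" if "x \<in> cls V c i" for x i using bij_betw_apply[OF cls_bij[of V g c, OF V g] that] .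
  show ?case
  proof (cases p)
    case Nil
    then show ?thesis using Cons.prems i by simp
  next
    case (Cons j q)
    then obtain z where z: "z \<in> cls V c j" "F x z" "path_rel V c F p z y" "x \<in> cls V c i"
      using Cons.prems(2) by auto
    have "z \<in> V" using z(1) by (simp add: cls_def)
    then have "path_rel V c F' p (g z) (g y)" "F' (g x) (g z)" using z Cons.IH iso Cons.prems(1) by blast+
    then show ?thesis using Cons i[OF z(4)] i[OF z(1)] by auto
  qed
qed simp

lemma turn_rel_iso:
  assumes V: "finite V" and g: "bij_betw g V V" "\<forall>x\<in>V. c (g x) = c x"
    and iso: "\<forall>x\<in>V. \<forall>y\<in>V. F x y \<longleftrightarrow> F' (g x) (g y)" and xy: "x \<in> cls V c i" "x' \<in> cls V c i"
  shows "turn_rel V c F i j x x' \<longleftrightarrow> turn_rel V c F' i j (g x) (g x')"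
proof -
  have xV: "x \<in> V" "x' \<in> V" using xy by (simp_all add: cls_def)
  have gx: "g x \<in> cls V c i" "g x' \<in> cls V c i" using bij_betw_apply[OF cls_bij[of V g c, OF V g]] xy by blast+
  have ne: "g x \<noteq> g x' \<longleftrightarrow> x \<noteq> x'" using g(1) xV by (auto simp: bij_betw_def dest: inj_onD)
  have gj: "g ` cls V c j = cls V c j" using cls_bij[of V g c, OF V g] by (simp add: bij_betw_def)
  have "(\<exists>y\<in>cls V c j. F' (g x) y \<and> F' (g x') y) \<longleftrightarrow> (\<exists>y\<in>g ` cls V c j. F' (g x) y \<and> F' (g x') y)"
    unfolding gj ..
  also have "\<dots> \<longleftrightarrow> (\<exists>y\<in>cls V c j. F x y \<and> F x' y)" using iso xV by (auto simp: cls_def)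
  finally show ?thesis unfolding turn_rel_def using xy gx ne bspec[OF bspec[OF iso xV(1)] xV(2)] by simp
qed

lemma successively_all:
  "(\<And>x y. x \<in> set xs \<Longrightarrow> y \<in> set xs \<Longrightarrow> P x y) \<Longrightarrow> successively P xs"
  by (induction P xs rule: successively.induct) auto

text \<open>Total degree at least two into \<open>J\<close>, expressed without a sum.\<close>

definition big :: "('c \<Rightarrow> 'c \<Rightarrow> nat) \<Rightarrow> 'c set \<Rightarrow> 'c \<Rightarrow> bool" where
  "big D J i \<longleftrightarrow> (\<exists>j\<in>J. 2 \<le> D i j \<or> (\<exists>j'\<in>J. j' \<noteq> j \<and> 1 \<le> D i j \<and> 1 \<le> D i j'))"

lemma not_big:
  assumes "\<not> big D J i" "k \<in> J" "D i k > 0"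
  shows "D i k = 1 \<and> (\<forall>j\<in>J. j \<noteq> k \<longrightarrow> D i j = 0)"
proof
  have "\<not> 2 \<le> D i k" using assms(1,2) unfolding big_def by blast
  then show "D i k = 1" using assms(3) by linarith
  show "\<forall>j\<in>J. j \<noteq> k \<longrightarrow> D i j = 0"
  proof (intro ballI impI)
    fix j assume j: "j \<in> J" "j \<noteq> k"
    have "1 \<le> D i k" using assms(3) by linarith
    then have "\<not> 1 \<le> D i j" using assms(1,2) j unfolding big_def by blast
    then show "D i j = 0" by linarith
  qed
qed

text \<open>With total degree one into \<open>J\<close>, class \<open>j\<close> would be a leaf
  class attached to \<open>i\<close>.\<close>

lemma leafless_big:
  assumes noleaf: "\<nexists>i. leaf_class D J i" and ij: "i \<in> J" "j \<in> J" "j \<noteq> i" "D j i > 0"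
  shows "big D J j"
proof (rule ccontr)
  assume "\<not> big D J j"
  then have "leaf_class D J j"
    unfolding leaf_class_def using not_big[of D J j i, OF _ ij(1,4)] ij(1-3) by (intro conjI bexI[of _ i]) auto
  then show False using noleaf by blast
qed

text \<open>Both directions of the theorem end here. A class that is not big has total degree at
  most one, and an edge to another class would make it a leaf class, so only big classes need
  attention.\<close>

lemma leafless_reducedI:
  assumes noleaf: "\<nexists>i. leaf_class D J i"
    and good: "\<And>i. i \<in> J \<Longrightarrow> big D J i \<Longrightarrow>
      D i i = 2 \<and> card {v \<in> V. c v = i} = 5 \<and> (\<forall>j\<in>J. j \<noteq> i \<longrightarrow> D i j = 0)"
  shows "reduced V c D J"
  unfolding reduced_def
proof
  fix i assume i: "i \<in> J"
  show "(\<forall>j\<in>J. j \<noteq> i \<longrightarrow> D i j = 0) \<and> (D i i = 0 \<or> D i i = 1 \<or> D i i = 2 \<and> card {v \<in> V. c v = i} = 5)"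
  proof (cases "big D J i")
    case True
    then show ?thesis using good[OF i] by blast
  next
    case False
    show ?thesis
    proof (cases "\<exists>k\<in>J. D i k > 0")
      case True
      then obtain k where k: "k \<in> J" "D i k > 0" by blast
      have "k = i"
      proof (rule ccontr)
        assume "k \<noteq> i"
        then show False using leafless_big[of D J k i, OF noleaf k(1) i _ k(2)] False by blast
      qed
      then show ?thesis using not_big[of D J i k, OF False k] by blast
    next
      case False
      then show ?thesis using i by auto
    qed
  qed
qed

section \<open>Twisting along paths of matched classes\<close>

locale rigid_graph =
  fixes V :: "'a set" and c :: "'a \<Rightarrow> 'c" and D E
  assumes eq: "equitable V c D E" and rig: "rigid V c D" and mino: "minority V c D"
begin

abbreviation "cl \<equiv> cls V c"

lemma fin: "finite V" "finite (cl i)"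
  using equitableD(1)[OF eq] by (simp_all add: cls_def)

lemma min_out: "cl i \<noteq> {} \<Longrightarrow> cl j \<noteq> {} \<Longrightarrow> 2 * D i j \<le> card (cl j)"
  using mino unfolding minority_def cls_def by (force split: if_splits)

lemma min_in: "cl i \<noteq> {} \<Longrightarrow> 2 * D i i + 1 \<le> card (cl i)"
  using mino unfolding minority_def cls_def by (force split: if_splits)

text \<open>\<open>E'\<close> arises from \<open>E\<close> by permuting class \<open>i\<close> for
  the edges to class \<open>j\<close> alone. Rigidity returns \<open>E'\<close> to \<open>E\<close>
  by some \<open>\<pi>\<close> of which only the preservation of colours is known.\<close>

lemma twist:
  assumes \<sigma>: "bij_betw \<sigma> (cl i) (cl i)"
  obtains E' \<pi> where
    "bij_betw \<pi> V V" "\<forall>x\<in>V. c (\<pi> x) = c x" "\<forall>x\<in>V. \<forall>y\<in>V. E' x y \<longleftrightarrow> E (\<pi> x) (\<pi> y)"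
    "\<forall>a b. \<not> (a = i \<and> b = j \<or> a = j \<and> b = i) \<longrightarrow> (\<forall>x\<in>cl a. \<forall>y\<in>cl b. E' x y \<longleftrightarrow> E x y)"
    "\<And>x y. x \<in> cl i \<Longrightarrow> y \<in> cl j \<Longrightarrow> E' x y \<longleftrightarrow> E (\<sigma> x) (if j = i then \<sigma> y else y)"
proof -
  define \<tau> where "\<tau> x = (if x \<in> cl i then \<sigma> x else x)" for x
  have \<sigma>i: "\<sigma> x \<in> cl i" if "x \<in> cl i" for x using bij_betw_apply[OF \<sigma> that] .
  have \<tau>c: "c (\<tau> x) = c x" if "x \<in> V" for x using \<sigma>i[of x] by (simp add: \<tau>_def cls_def)
  have "bij_betw \<tau> (cl i) (cl i) \<longleftrightarrow> bij_betw \<sigma> (cl i) (cl i)" by (rule bij_betw_cong) (simp add: \<tau>_def)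
  moreover have "bij_betw \<tau> (V - cl i) (V - cl i) \<longleftrightarrow> bij_betw id (V - cl i) (V - cl i)"
    by (rule bij_betw_cong) (simp add: \<tau>_def)
  ultimately have "bij_betw \<tau> (cl i \<union> (V - cl i)) (cl i \<union> (V - cl i))"
    using \<sigma> by (intro bij_betw_combine) auto
  moreover have "cl i \<union> (V - cl i) = V" by (auto simp: cls_def)
  ultimately have \<tau>: "bij_betw \<tau> V V" by simp
  let ?t = "\<lambda>a b. a = i \<and> b = j \<or> a = j \<and> b = i"
  let ?R = "\<lambda>x y. x \<in> V \<and> y \<in> V \<and> E (\<tau> x) (\<tau> y)"
  define E' where "E' x y \<longleftrightarrow> (if ?t (c x) (c y) then ?R x y else E x y)" for x y
  have "equitable V c D (\<lambda>x y. if ?t (c x) (c y) then ?R x y else E x y)"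
  proof (rule equitable_patch[OF eq])
    fix x k assume x: "x \<in> V"
    have "card {y \<in> V. c y = k \<and> ?R x y} = card {z \<in> V. c z = k \<and> E (\<tau> x) z}"
      by (rule bij_betw_card_Collect[OF \<tau>]) (use x \<tau>c in auto)
    also have "\<dots> = D (c x) k"
      using equitableD(6)[OF eq bij_betw_apply[OF \<tau> x]] \<tau>c[OF x] by simp
    finally show "card {y \<in> V. c y = k \<and> ?R x y} = D (c x) k" .
  qed (use equitableD(2,3)[OF eq] in auto)
  then have "equitable V c D E'" unfolding E'_def .
  with rig eq obtain \<pi> where \<pi>: "bij_betw \<pi> V V" "\<forall>x\<in>V. c (\<pi> x) = c x"
    "\<forall>x\<in>V. \<forall>y\<in>V. E' x y \<longleftrightarrow> E (\<pi> x) (\<pi> y)" unfolding rigid_def by blast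
  show ?thesis
  proof (rule that)
    show "bij_betw \<pi> V V" by (rule \<pi>(1))
    show "\<forall>x\<in>V. c (\<pi> x) = c x" by (rule \<pi>(2))
    show "\<forall>x\<in>V. \<forall>y\<in>V. E' x y \<longleftrightarrow> E (\<pi> x) (\<pi> y)" by (rule \<pi>(3))
    show "\<forall>a b. \<not> ?t a b \<longrightarrow> (\<forall>x\<in>cl a. \<forall>y\<in>cl b. E' x y \<longleftrightarrow> E x y)"
      by (auto simp: E'_def cls_def)
    show "E' x y \<longleftrightarrow> E (\<sigma> x) (if j = i then \<sigma> y else y)" if "x \<in> cl i" "y \<in> cl j" for x y
      using that by (auto simp: E'_def \<tau>_def cls_def)
  qed
qed

text \<open>The degree \<open>k\<close> is \<open>D i i\<close> or \<open>D j i - 1\<close>. The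
  bound \<open>k + 2\<close> comes from the flip, by which twice \<open>D i i\<close> or
  \<open>D j i\<close> fits into class \<open>i\<close>.\<close>

lemma turn_reg:
  assumes t: "turn D i j" and i: "cl i \<noteq> {}"
  shows "\<exists>k. reg (cl i) k (turn_rel V c E i j) \<and> 1 \<le> k \<and> k + 2 \<le> card (cl i)"
proof (cases "j = i")
  case True
  then have D: "1 \<le> D i i" using t by (simp add: turn_def)
  have "reg (cl i) (D i i) (turn_rel V c E i j)"
    unfolding reg_def
  proof (intro conjI allI impI ballI)
    fix x assume x: "x \<in> cl i"
    have "{y. turn_rel V c E i j x y} = {y \<in> V. c y = i \<and> E x y}"
      using x True equitableD(3)[OF eq] by (auto simp: turn_rel_def cls_def)
    then show "card {y. turn_rel V c E i j x y} = D i i"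
      using equitableD(6)[OF eq, of x i] x by (simp add: cls_def)
  qed (use True equitableD(2)[OF eq] in \<open>auto simp: turn_rel_def\<close>)
  then show ?thesis using D min_in[OF i] by (intro exI[of _ "D i i"]) auto
next
  case False
  then have D: "D i j = 1" "2 \<le> D j i" using t by (simp_all add: turn_def)
  have "reg (cl i) (D j i - 1) (turn_rel V c E i j)"
    unfolding reg_def
  proof (intro conjI allI impI ballI)
    fix x assume x: "x \<in> cl i"
    then have xV: "x \<in> V" "c x = i" by (simp_all add: cls_def)
    have "D (c x) j = 1" using D(1) xV(2) by simp
    then obtain y where y: "y \<in> V" "c y = j" "E x y" "\<And>z. z \<in> V \<Longrightarrow> c z = j \<Longrightarrow> E x z \<Longrightarrow> z = y"
      using degree_1[OF eq xV(1), of j] by blast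
    have "(\<exists>z\<in>cl j. E x z \<and> E w z) \<longleftrightarrow> E y w" for w
    proof
      assume "\<exists>z\<in>cl j. E x z \<and> E w z"
      then obtain z where "z \<in> V" "c z = j" "E x z" "E w z" by (auto simp: cls_def)
      then show "E y w" using y(4) equitableD(2)[OF eq] by blast
    next
      assume "E y w"
      then have "E w y" "y \<in> cl j" using y(1,2) equitableD(2)[OF eq] by (simp_all add: cls_def)
      then show "\<exists>z\<in>cl j. E x z \<and> E w z" using y(3) by blast
    qed
    then have "turn_rel V c E i j x w \<longleftrightarrow> w \<in> cl i \<and> w \<noteq> x \<and> E y w" for w
      using x False unfolding turn_rel_def by auto
    then have "{w. turn_rel V c E i j x w} = {w \<in> V. c w = i \<and> E y w} - {x}"
      unfolding cls_def by blast
    moreover have "x \<in> {w \<in> V. c w = i \<and> E y w}" using xV y(3) equitableD(2)[OF eq] by blast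
    ultimately show "card {w. turn_rel V c E i j x w} = D j i - 1"
      using equitableD(6)[OF eq y(1), of i] y(2) fin(1) by simp
  qed (use False in \<open>auto simp: turn_rel_def\<close>)
  moreover have "2 * D j i \<le> card (cl i)"
  proof -
    obtain x where x: "x \<in> cl i" using i by blast
    then have "\<exists>y\<in>V. c y = j \<and> E x y" using degree_pos[OF eq, of x j] D(1) by (auto simp: cls_def)
    then have "cl j \<noteq> {}" by (auto simp: cls_def)
    then show ?thesis by (rule min_out[OF _ i])
  qed
  ultimately show ?thesis using D(2) by (intro exI[of _ "D j i - 1"]) auto
qed

lemma match_bij:
  assumes "matched D i j"
  shows "\<exists>\<mu>. bij_betw \<mu> (cl i) (cl j) \<and> (\<forall>x\<in>cl i. \<forall>y\<in>cl j. E x y \<longleftrightarrow> y = \<mu> x)"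
proof -
  have "\<forall>x\<in>cl i. \<exists>y. y \<in> cl j \<and> E x y \<and> (\<forall>z\<in>cl j. E x z \<longrightarrow> z = y)"
    using degree_1[OF eq, of _ j] assms unfolding matched_def cls_def by fastforce
  from bchoice[OF this] obtain \<mu> where \<mu>: "\<And>x. x \<in> cl i \<Longrightarrow> \<mu> x \<in> cl j \<and> E x (\<mu> x) \<and> (\<forall>z\<in>cl j. E x z \<longrightarrow> z = \<mu> x)"
    by blast
  have "\<forall>x\<in>cl j. \<exists>y. y \<in> cl i \<and> E x y \<and> (\<forall>z\<in>cl i. E x z \<longrightarrow> z = y)"
    using degree_1[OF eq, of _ i] assms unfolding matched_def cls_def by fastforce
  from bchoice[OF this] obtain \<nu> where \<nu>: "\<And>x. x \<in> cl j \<Longrightarrow> \<nu> x \<in> cl i \<and> E x (\<nu> x) \<and> (\<forall>z\<in>cl i. E x z \<longrightarrow> z = \<nu> x)"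
    by blast
  have "\<nu> (\<mu> x) = x" if "x \<in> cl i" for x using \<mu>[OF that] \<nu>[of "\<mu> x"] equitableD(2)[OF eq] that by metis
  moreover have "\<mu> (\<nu> x) = x" if "x \<in> cl j" for x using \<nu>[OF that] \<mu>[of "\<nu> x"] equitableD(2)[OF eq] that by metis
  ultimately have "bij_betw \<mu> (cl i) (cl j)"
    using \<mu> \<nu> by (intro bij_betw_byWitness[where f' = \<nu>]) auto
  then show ?thesis using \<mu> by blast
qed

lemma path_bij:
  assumes "successively (matched D) p" "p \<noteq> []"
  shows "\<exists>\<beta>. bij_betw \<beta> (cl (hd p)) (cl (last p)) \<and> (\<forall>x\<in>cl (hd p). \<forall>y. path_rel V c E p x y \<longleftrightarrow> y = \<beta> x)"
  using assms
proof (induction p)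
  case (Cons i p)
  show ?case
  proof (cases p)
    case Nil
    then show ?thesis by (intro exI[of _ id]) (simp add: bij_betw_def)
  next
    case p: (Cons j q)
    obtain \<mu> where \<mu>: "bij_betw \<mu> (cl i) (cl j)" "\<forall>x\<in>cl i. \<forall>y\<in>cl j. E x y \<longleftrightarrow> y = \<mu> x"
      using match_bij[of i j] Cons.prems p by auto
    obtain \<beta> where \<beta>: "bij_betw \<beta> (cl (hd p)) (cl (last p))"
      "\<forall>x\<in>cl (hd p). \<forall>y. path_rel V c E p x y \<longleftrightarrow> y = \<beta> x"
      using Cons.IH Cons.prems p by auto
    have "bij_betw (\<beta> \<circ> \<mu>) (cl i) (cl (last p))" using \<mu>(1) \<beta>(1) p by (auto intro: bij_betw_trans)
    moreover have "path_rel V c E (i # p) x y \<longleftrightarrow> y = (\<beta> \<circ> \<mu>) x" if x: "x \<in> cl i" for x y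
    proof -
      have \<mu>x: "\<mu> x \<in> cl j" using bij_betw_apply[OF \<mu>(1) x] .
      have "path_rel V c E (i # p) x y \<longleftrightarrow> (\<exists>z\<in>cl j. E x z \<and> path_rel V c E p z y)" using p x by simp
      also have "\<dots> \<longleftrightarrow> path_rel V c E p (\<mu> x) y" using bspec[OF \<mu>(2) x] \<mu>x by auto
      also have "\<dots> \<longleftrightarrow> y = \<beta> (\<mu> x)" using \<beta>(2) \<mu>x p by simp
      finally show ?thesis by simp
    qed
    moreover have "hd (i # p) = i" "last (i # p) = last p" using p by simp_all
    ultimately show ?thesis by (intro exI[of _ "\<beta> \<circ> \<mu>"]) (simp only: simp_thms ball_simps, blast)
  qed
qed simp

text \<open>A path avoiding the twisted pair of classes uses the same edges in \<open>E'\<close> and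
  in \<open>E\<close>, so \<open>\<pi>\<close> maps it to a path of the same kind.\<close>

lemma path_commute:
  assumes p: "successively (matched D) p" "p \<noteq> []" and t: "successively (\<lambda>a b. \<not> t a b) p"
    and \<beta>: "\<forall>x\<in>cl (hd p). \<forall>y. path_rel V c E p x y \<longleftrightarrow> y = \<beta> x"
    and E': "\<forall>a b. \<not> t a b \<longrightarrow> (\<forall>x\<in>cl a. \<forall>y\<in>cl b. E' x y \<longleftrightarrow> E x y)"
    and \<pi>: "bij_betw \<pi> V V" "\<forall>x\<in>V. c (\<pi> x) = c x" "\<forall>x\<in>V. \<forall>y\<in>V. E' x y \<longleftrightarrow> E (\<pi> x) (\<pi> y)"
    and x: "x \<in> cl (hd p)"
  shows "\<beta> (\<pi> x) = \<pi> (\<beta> x)"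
proof -
  have xV: "x \<in> V" using x by (simp add: cls_def)
  have "path_rel V c E p x (\<beta> x)" using \<beta> x by blast
  moreover have "successively (\<lambda>a b. \<forall>x\<in>cl a. \<forall>y\<in>cl b. E' x y \<longleftrightarrow> E x y) p"
    using t by (rule successively_mono) (use E' in blast)
  ultimately have "path_rel V c E' p x (\<beta> x)" using path_rel_cong[of V c E' E p x "\<beta> x"] by blast
  then have "path_rel V c E p (\<pi> x) (\<pi> (\<beta> x))" by (rule path_rel_iso[where c = c and F = E' and F' = E and g = \<pi>, OF fin(1) \<pi> xV])
  moreover have "\<pi> x \<in> cl (hd p)" using bij_betw_apply[OF cls_bij[of V \<pi> c, OF fin(1) \<pi>(1,2)] x] .
  ultimately show ?thesis using \<beta> by simp
qed

text \<open>\<open>A\<close> is the regular graph at the far end brought back along the path,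
  \<open>B\<close> the one at the near end. A twist of the near end permutes \<open>B\<close> alone,
  yet rigidity would keep the number of pairs related in both. The hypothesis \<open>types\<close>
  guarantees that the far end does not use the twisted pair of classes.\<close>

lemma no_two_turns:
  assumes p: "successively (matched D) p" "p \<noteq> []" and ne: "cl (hd p) \<noteq> {}"
    and t: "turn D (hd p) j" "turn D (last p) j'"
    and types: "\<not> (last p = hd p \<and> j' = j \<or> last p = j \<and> j' = hd p)"
  shows False
proof -
  let ?i = "hd p" and ?l = "last p"
  let ?t = "\<lambda>a b. a = ?i \<and> b = j \<or> a = j \<and> b = ?i"
  let ?N = "cl ?i"
  \<comment> \<open>Matched classes are distinct with degree 1 both ways; a turn stays in its class
    or has a degree of at least 2. So the path avoids the twisted pair.\<close>
  have pt: "successively (\<lambda>a b. \<not> ?t a b) p"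
    using p(1) by (rule successively_mono) (use t(1) in \<open>auto simp: matched_def turn_def split: if_splits\<close>)
  obtain \<beta> where \<beta>: "bij_betw \<beta> ?N (cl ?l)" "\<forall>x\<in>?N. \<forall>y. path_rel V c E p x y \<longleftrightarrow> y = \<beta> x"
    using path_bij[OF p] by blast
  have ne': "cl ?l \<noteq> {}" using ne \<beta>(1) by (auto simp: bij_betw_def)
  define A where "A x x' \<longleftrightarrow> x \<in> ?N \<and> x' \<in> ?N \<and> turn_rel V c E ?l j' (\<beta> x) (\<beta> x')" for x x'
  define B where "B = turn_rel V c E ?i j"
  obtain k where k: "reg (cl ?l) k (turn_rel V c E ?l j')" "1 \<le> k" "k + 2 \<le> card (cl ?l)"
    using turn_reg[OF t(2) ne'] by blast
  have A: "reg ?N k A" unfolding A_def using reg_transfer[OF k(1) \<beta>(1)] by simp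
  have kN: "k + 2 \<le> card ?N" using k(3) bij_betw_same_card[OF \<beta>(1)] by simp
  obtain l where B: "reg ?N l B" "1 \<le> l" "l + 2 \<le> card ?N"
    using turn_reg[OF t(1) ne] unfolding B_def by blast
  obtain \<sigma> where \<sigma>: "bij_betw \<sigma> ?N ?N"
    "card {(x, y). x \<in> ?N \<and> y \<in> ?N \<and> A x y \<and> B (\<sigma> x) (\<sigma> y)} \<noteq> card {(x, y). x \<in> ?N \<and> y \<in> ?N \<and> A x y \<and> B x y}"
    using reg_overlap[OF fin(2) A k(2) kN B] by blast
  obtain E' \<pi> where \<pi>: "bij_betw \<pi> V V" "\<forall>x\<in>V. c (\<pi> x) = c x" "\<forall>x\<in>V. \<forall>y\<in>V. E' x y \<longleftrightarrow> E (\<pi> x) (\<pi> y)"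
    and E'1: "\<forall>a b. \<not> ?t a b \<longrightarrow> (\<forall>x\<in>cl a. \<forall>y\<in>cl b. E' x y \<longleftrightarrow> E x y)"
    and E'2: "\<And>x y. x \<in> ?N \<Longrightarrow> y \<in> cl j \<Longrightarrow> E' x y \<longleftrightarrow> E (\<sigma> x) (if j = ?i then \<sigma> y else y)"
    by (rule twist[OF \<sigma>(1), of j]) blast
  have \<pi>N: "bij_betw \<pi> ?N ?N" by (rule cls_bij[of V \<pi> c, OF fin(1) \<pi>(1,2)])
  have \<beta>\<pi>: "\<beta> (\<pi> x) = \<pi> (\<beta> x)" if "x \<in> ?N" for x
    by (rule path_commute[where t = ?t and E' = E' and \<pi> = \<pi> and \<beta> = \<beta>, OF p pt \<beta>(2) E'1 \<pi> that])
  \<comment> \<open>\<open>\<pi>\<close> carries the permuted \<open>B\<close> to \<open>B\<close>;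
    that it also preserves \<open>A\<close> is shown by \<open>AA\<close>.\<close>
  have BB: "B (\<sigma> x) (\<sigma> y) \<longleftrightarrow> B (\<pi> x) (\<pi> y)" if xy: "x \<in> ?N" "y \<in> ?N" for x y
  proof -
    have s: "\<sigma> x \<in> ?N" "\<sigma> y \<in> ?N" "\<sigma> x \<noteq> \<sigma> y \<longleftrightarrow> x \<noteq> y"
      using \<sigma>(1) xy by (auto simp: bij_betw_def dest: inj_onD)
    have "B (\<sigma> x) (\<sigma> y) \<longleftrightarrow> turn_rel V c E' ?i j x y"
      unfolding B_def turn_rel_def using s xy E'2 by (cases "j = ?i") simp_all
    also have "\<dots> \<longleftrightarrow> B (\<pi> x) (\<pi> y)" unfolding B_def by (rule turn_rel_iso[where c = c and F = E' and F' = E and g = \<pi>, OF fin(1) \<pi> xy])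
    finally show ?thesis .
  qed
  have AA: "A x y \<longleftrightarrow> A (\<pi> x) (\<pi> y)" if xy: "x \<in> ?N" "y \<in> ?N" for x y
  proof -
    have b: "\<beta> x \<in> cl ?l" "\<beta> y \<in> cl ?l" using bij_betw_apply[OF \<beta>(1)] xy by blast+
    have nt: "\<not> ?t ?l j'" using types by simp
    have "E' u v \<longleftrightarrow> E u v" if "u \<in> cl ?l" "v \<in> cl j'" for u v
      using bspec[OF bspec[OF E'1[THEN spec, THEN spec, THEN mp, OF nt] that(1)] that(2)] .
    then have "turn_rel V c E ?l j' (\<beta> x) (\<beta> y) \<longleftrightarrow> turn_rel V c E' ?l j' (\<beta> x) (\<beta> y)"
      unfolding turn_rel_def using b by (cases "j' = ?l") simp_all
    also have "\<dots> \<longleftrightarrow> turn_rel V c E ?l j' (\<pi> (\<beta> x)) (\<pi> (\<beta> y))" by (rule turn_rel_iso[where c = c and F = E' and F' = E and g = \<pi>, OF fin(1) \<pi> b])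
    finally show ?thesis
      unfolding A_def using xy \<beta>\<pi> bij_betw_apply[OF \<pi>N] by simp
  qed
  have "bij_betw (map_prod \<pi> \<pi>) (?N \<times> ?N) (?N \<times> ?N)"
    using \<pi>N unfolding bij_betw_def by (auto simp: map_prod_inj_on map_prod_surj_on)
  then have "card {w \<in> ?N \<times> ?N. A (fst w) (snd w) \<and> B (\<sigma> (fst w)) (\<sigma> (snd w))} =
      card {w \<in> ?N \<times> ?N. A (fst w) (snd w) \<and> B (fst w) (snd w)}"
    by (rule bij_betw_card_Collect) (use AA BB in auto)
  moreover have "{w \<in> ?N \<times> ?N. A (fst w) (snd w) \<and> B (\<sigma> (fst w)) (\<sigma> (snd w))} =
      {(x, y). x \<in> ?N \<and> y \<in> ?N \<and> A x y \<and> B (\<sigma> x) (\<sigma> y)}"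
    "{w \<in> ?N \<times> ?N. A (fst w) (snd w) \<and> B (fst w) (snd w)} = {(x, y). x \<in> ?N \<and> y \<in> ?N \<and> A x y \<and> B x y}"
    by auto
  ultimately show False using \<sigma>(2) by simp
qed

text \<open>The monodromy is \<open>\<beta>\<close> followed by the inverse of the closing matching
  \<open>\<mu>\<close>. Colour-preserving isomorphisms do not change its number of fixed
  points.\<close>

lemma no_matched_cycle:
  assumes p: "successively (matched D) p" "p \<noteq> []" and ne: "cl (hd p) \<noteq> {}"
    and m: "matched D (hd p) (last p)"
    and pt: "successively (\<lambda>a b. \<not> (a = hd p \<and> b = last p \<or> a = last p \<and> b = hd p)) p"
  shows False
proof -
  let ?i = "hd p" and ?l = "last p"
  let ?t = "\<lambda>a b. a = ?i \<and> b = ?l \<or> a = ?l \<and> b = ?i"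
  let ?N = "cl ?i"
  have il: "?l \<noteq> ?i" using m by (auto simp: matched_def)
  obtain \<beta> where \<beta>: "bij_betw \<beta> ?N (cl ?l)" "\<forall>x\<in>?N. \<forall>y. path_rel V c E p x y \<longleftrightarrow> y = \<beta> x"
    using path_bij[OF p] by blast
  obtain \<mu> where \<mu>: "bij_betw \<mu> ?N (cl ?l)" "\<forall>x\<in>?N. \<forall>y\<in>cl ?l. E x y \<longleftrightarrow> y = \<mu> x"
    using match_bij[OF m] by blast
  have \<beta>N: "\<beta> x \<in> cl ?l" if "x \<in> ?N" for x using bij_betw_apply[OF \<beta>(1) that] .
  \<comment> \<open>A twist by \<open>\<sigma>\<close> replaces \<open>\<mu>\<close> by
    \<open>\<mu> \<circ> \<sigma>\<close>, so rigidity forces the same number of fixed points for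
    every \<open>\<sigma>\<close>.\<close>
  have inv: "card {x \<in> ?N. \<beta> x = \<mu> (\<sigma> x)} = card {x \<in> ?N. \<beta> x = \<mu> x}" if \<sigma>: "bij_betw \<sigma> ?N ?N" for \<sigma>
  proof -
    obtain E' \<pi> where \<pi>: "bij_betw \<pi> V V" "\<forall>x\<in>V. c (\<pi> x) = c x" "\<forall>x\<in>V. \<forall>y\<in>V. E' x y \<longleftrightarrow> E (\<pi> x) (\<pi> y)"
      and E'1: "\<forall>a b. \<not> ?t a b \<longrightarrow> (\<forall>x\<in>cl a. \<forall>y\<in>cl b. E' x y \<longleftrightarrow> E x y)"
      and E'2: "\<And>x y. x \<in> ?N \<Longrightarrow> y \<in> cl ?l \<Longrightarrow> E' x y \<longleftrightarrow> E (\<sigma> x) (if ?l = ?i then \<sigma> y else y)"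
      by (rule twist[OF \<sigma>, of ?l]) blast
    have \<pi>N: "bij_betw \<pi> ?N ?N" by (rule cls_bij[of V \<pi> c, OF fin(1) \<pi>(1,2)])
    show ?thesis
    proof (rule bij_betw_card_Collect[OF \<pi>N])
      fix x assume x: "x \<in> ?N"
      have \<sigma>x: "\<sigma> x \<in> ?N" and \<pi>x: "\<pi> x \<in> ?N" using bij_betw_apply[OF \<sigma> x] bij_betw_apply[OF \<pi>N x] by blast+
      have xV: "x \<in> V" "\<beta> x \<in> V" using x \<beta>N[OF x] by (simp_all add: cls_def)
      have "\<beta> x = \<mu> (\<sigma> x) \<longleftrightarrow> E (\<sigma> x) (\<beta> x)" using \<mu>(2) \<sigma>x \<beta>N[OF x] by blast
      also have "\<dots> \<longleftrightarrow> E' x (\<beta> x)" using E'2[OF x \<beta>N[OF x]] il by simp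
      also have "\<dots> \<longleftrightarrow> E (\<pi> x) (\<beta> (\<pi> x))"
        using bspec[OF bspec[OF \<pi>(3) xV(1)] xV(2)] path_commute[where t = ?t and E' = E' and \<pi> = \<pi> and \<beta> = \<beta>, OF p pt \<beta>(2) E'1 \<pi> x] by simp
      also have "\<dots> \<longleftrightarrow> \<beta> (\<pi> x) = \<mu> (\<pi> x)" using \<mu>(2) \<pi>x \<beta>N[OF \<pi>x] by blast
      finally show "\<beta> x = \<mu> (\<sigma> x) \<longleftrightarrow> \<beta> (\<pi> x) = \<mu> (\<pi> x)" .
    qed
  qed
  have all: "\<beta> x = \<mu> (\<sigma> x)" if "card {x \<in> ?N. \<beta> x = \<mu> (\<sigma> x)} = card ?N" "x \<in> ?N" for \<sigma> x
  proof -
    have "{x \<in> ?N. \<beta> x = \<mu> (\<sigma> x)} = ?N" using that(1) fin(2) by (intro card_subset_eq) auto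
    then show ?thesis using that(2) by blast
  qed
  let ?\<mu> = "the_inv_into ?N \<mu>"
  \<comment> \<open>For this permutation in the role of \<open>\<sigma>\<close> every point is
    fixed, hence so it is for all others.\<close>
  have m\<beta>: "bij_betw (?\<mu> \<circ> \<beta>) ?N ?N" by (rule bij_betw_trans[OF \<beta>(1) bij_betw_the_inv_into[OF \<mu>(1)]])
  have "{x \<in> ?N. \<beta> x = \<mu> ((?\<mu> \<circ> \<beta>) x)} = ?N"
    using f_the_inv_into_f_bij_betw[OF \<mu>(1)] \<beta>N by auto
  then have full: "card {x \<in> ?N. \<beta> x = \<mu> x} = card ?N" using inv[OF m\<beta>] by (simp only:)
  have ne': "cl ?l \<noteq> {}" using ne \<beta>(1) by (auto simp: bij_betw_def)
  \<comment> \<open>The flip bound applied to degree 1 gives a second vertex, hence a transposition,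
    for which not all points can be fixed.\<close>
  have "2 \<le> card ?N"
    using min_out[OF ne ne'] m bij_betw_same_card[OF \<mu>(1)] by (simp add: matched_def)
  then have "\<not> card ?N \<le> Suc 0" by simp
  then obtain u v where uv: "u \<in> ?N" "v \<in> ?N" "u \<noteq> v"
    unfolding card_le_Suc0_iff_eq[OF fin(2)] by blast
  let ?s = "id(u := v, v := u)"
  have s: "bij_betw ?s ?N ?N"
    by (rule bij_betw_byWitness[where f' = ?s]) (use uv in auto)
  have "card {x \<in> ?N. \<beta> x = \<mu> (?s x)} = card ?N" using inv[OF s] full by simp
  then have "\<beta> u = \<mu> (?s u)" by (rule all) (use uv in simp)
  moreover have "\<beta> v = \<mu> (id v)" by (rule all) (use uv full in simp_all)
  moreover have "?s u = v" using uv by simp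
  ultimately have "\<beta> u = \<beta> v" by simp
  then show False using \<beta>(1) uv by (auto simp: bij_betw_def dest: inj_onD)
qed

lemma terminal_reduced:
  assumes J: "J \<subseteq> c ` V" and noleaf: "\<nexists>i. leaf_class D J i"
  shows "reduced V c D J"
proof -
  have cl: "cl i \<noteq> {}" if "i \<in> J" for i using J that by (auto simp: cls_def)
  have sym: "card (cl i) * D i j = card (cl j) * D j i" for i j
    using degree_symmetry[OF eq] by (simp add: cls_def)
  have pos: "card (cl i) > 0" if "i \<in> J" for i using cl[OF that] fin(2) by (simp add: card_gt_0_iff)
  have Dsym: "D j i > 0" if "i \<in> J" "j \<in> J" "D i j > 0" for i j
  proof -
    have "card (cl j) * D j i > 0" unfolding sym[of i j, symmetric] using pos[OF that(1)] that(3) by simp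
    then show ?thesis by simp
  qed
  have inner: "D i i \<le> 1 \<or> D i i = 2 \<and> card (cl i) = 5" if i: "i \<in> J" for i
  proof -
    obtain x where "x \<in> V" "c x = i" using cl[OF i] by (auto simp: cls_def)
    then show ?thesis using rigid_inner_degree[OF eq rig mino, of x i] by (simp add: cls_def)
  qed
  have outer: "\<not> (2 \<le> D i j \<and> 2 \<le> D j i)" if ij: "i \<in> J" "j \<in> J" "i \<noteq> j" for i j
  proof -
    obtain x where x: "x \<in> V" "c x = i" using cl[OF ij(1)] by (auto simp: cls_def)
    obtain y where y: "y \<in> V" "c y = j" using cl[OF ij(2)] by (auto simp: cls_def)
    show ?thesis by (rule rigid_outer_degree[OF eq rig mino x(1) y(1) x(2) y(2) ij(3)])
  qed
  \<comment> \<open>The 5-cycles permitted by \<open>reduced\<close>; \<open>Bd\<close> collects the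
    offending classes.\<close>
  define good where "good i \<longleftrightarrow> D i i = 2 \<and> card (cl i) = 5 \<and> (\<forall>j\<in>J. j \<noteq> i \<longrightarrow> D i j = 0)" for i
  define Bd where "Bd = {i \<in> J. big D J i \<and> \<not> good i}"
  \<comment> \<open>In a leafless graph a class with an edge to another class is big, and it is not
    good, so the neighbour classes of offending classes offend as well.\<close>
  have nbr: "j \<in> Bd" if "i \<in> Bd" "j \<in> J" "j \<noteq> i" "D i j > 0" for i j
  proof -
    have i: "i \<in> J" using that(1) by (simp add: Bd_def)
    have ji: "D j i > 0" by (rule Dsym[OF i that(2,4)])
    have "big D J j" by (rule leafless_big[of D J i j, OF noleaf i that(2,3) ji])
    moreover have "\<not> good j" using ji i that(3) unfolding good_def by auto
    ultimately show ?thesis using that(2) by (simp add: Bd_def)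
  qed
  have "Bd = {}"
  proof (rule ccontr)
    assume "Bd \<noteq> {}"
    have "finite J" using J fin(1) finite_subset by blast
    then have finB: "finite Bd" by (simp add: Bd_def)
    define n where "n = Max ((\<lambda>i. card (cl i)) ` Bd)"
    define M where "M = {i \<in> Bd. card (cl i) = n}"
    have n: "card (cl i) \<le> n" if "i \<in> Bd" for i using that finB unfolding n_def by simp
    have "n \<in> (\<lambda>i. card (cl i)) ` Bd" unfolding n_def using finB \<open>Bd \<noteq> {}\<close> by (intro Max_in) auto
    then obtain i0 where i0: "i0 \<in> M" by (auto simp: M_def)
    have finM: "finite M" using finB by (simp add: M_def)
    have MJ: "i \<in> J" "big D J i" "\<not> good i" if "i \<in> M" for i using that by (simp_all add: M_def Bd_def)
    \<comment> \<open>As \<open>n\<close> is the largest size, double counting gives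
      \<open>D i j \<le> D j i\<close>, and \<open>outer\<close> then leaves only
      \<open>D i j = 1\<close>. If \<open>D j i = 1\<close> too, the sizes agree and
      \<open>j\<close> lies in \<open>M\<close> again.\<close>
    have out: "D i j = 1 \<and> (2 \<le> D j i \<or> D j i = 1 \<and> j \<in> M)" if i: "i \<in> M" and j: "j \<in> J" "j \<noteq> i" "D i j > 0" for i j
    proof -
      have jB: "j \<in> Bd" using nbr i j unfolding M_def by blast
      have ni: "card (cl i) = n" "card (cl j) \<le> n" using i n[OF jB] by (simp_all add: M_def)
      have npos: "n > 0" using pos[OF MJ(1)[OF i]] ni by simp
      have s: "n * D i j = card (cl j) * D j i" using sym[of i j] ni(1) by simp
      have "n * D i j \<le> n * D j i" unfolding s using ni(2) by simp
      then have le: "D i j \<le> D j i" using npos by simp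
      have 1: "D i j = 1" using outer[OF MJ(1)[OF i] j(1) j(2)[symmetric]] j(3) le by linarith
      have "j \<in> M" if "D j i = 1"
        using s that 1 jB ni(1) by (simp add: M_def)
      then show ?thesis using 1 le by linarith
    qed
    have turnI: "turn D i j \<or> matched D i j \<and> j \<in> M" if "i \<in> M" "j \<in> J" "D i j > 0" for i j
    proof (cases "j = i")
      case True
      then show ?thesis using that(3) by (simp add: turn_def)
    next
      case False
      then show ?thesis using out[OF that(1,2) False that(3)] by (auto simp: turn_def matched_def)
    qed
    \<comment> \<open>Paths of matchings through the largest offending classes, of which a longest
      one is taken.\<close>
    define P where "P p \<longleftrightarrow> p \<noteq> [] \<and> distinct p \<and> set p \<subseteq> M \<and> successively (matched D) p" for p
    have "P [i0]" using i0 by (simp add: P_def)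
    moreover have "length p < Suc (card M)" if "P p" for p
      using that finM card_mono[of M "set p"] by (simp add: P_def distinct_card)
    ultimately obtain p where p: "P p" and pmax: "\<And>q. P q \<Longrightarrow> length q \<le> length p"
      using ex_has_greatest_nat[of P "[i0]" length "Suc (card M)"] by blast
    have closed: "k \<in> set q" if "P q" "length q = length p" "matched D (last q) k" "k \<in> M" for q k
    proof (rule ccontr)
      assume "k \<notin> set q"
      then have "P (q @ [k])" using that unfolding P_def by (simp add: successively_append_iff)
      then show False using pmax that(2) by fastforce
    qed
    \<comment> \<open>Being big, the last class \<open>l\<close> has an edge to a class other than
      its predecessor \<open>a\<close>. If that is no turn, it is a matching to a class which by
      maximality is on the path already, and a cycle closes.\<close>
    have long: "\<exists>j. turn D (last q) j" if q: "P q" "length q = length p" "2 \<le> length q" for q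
    proof (rule ccontr)
      assume no: "\<not> ?thesis"
      define l where "l = last q"
      have "butlast q \<noteq> []" using q(3) by (cases q rule: rev_cases) auto
      then obtain r a where "butlast q = r @ [a]" by (metis append_butlast_last_id)
      then have qq: "q = r @ [a, l]" using append_butlast_last_id[of q] q(1) by (simp add: P_def l_def)
      have "successively (matched D) (r @ [a, l])" using q(1) qq by (simp add: P_def)
      then have al: "matched D a l" by (auto simp: successively_append_iff)
      have lM: "l \<in> M" using q(1) last_in_set[of q] unfolding P_def l_def by blast
      have "\<exists>j\<in>J. j \<noteq> a \<and> 1 \<le> D l j"
      proof -
        have la: "D l a = 1" using al by (simp add: matched_def)
        obtain k where k: "k \<in> J" "2 \<le> D l k \<or> (\<exists>j'\<in>J. j' \<noteq> k \<and> 1 \<le> D l k \<and> 1 \<le> D l j')"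
          using MJ(2)[OF lM] unfolding big_def by blast
        show ?thesis
        proof (cases "k = a")
          case True
          then show ?thesis using k(2) la by auto
        next
          case False
          moreover have "1 \<le> D l k" using k(2) by auto
          ultimately show ?thesis using k(1) by blast
        qed
      qed
      then obtain j where j: "j \<in> J" "j \<noteq> a" "D l j > 0" by auto
      then have jm: "matched D l j" "j \<in> M" using turnI[OF lM j(1,3)] no unfolding l_def by blast+
      then have "j \<in> set q" using closed[OF q(1,2)] unfolding l_def by blast
      moreover have "j \<noteq> l" using jm(1) by (auto simp: matched_def)
      ultimately have "j \<in> set r" using j(2) by (simp add: qq)
      then obtain r1 r2 where r: "r = r1 @ j # r2" by (auto dest: split_list)
      let ?p = "j # r2 @ [a, l]"
      have q': "q = r1 @ ?p" using qq r by simp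
      have d: "distinct ?p" "successively (matched D) ?p"
        using q(1) unfolding P_def q' by (simp_all add: successively_append_iff)
      show False
      proof (rule no_matched_cycle[of ?p])
        show "successively (matched D) ?p" by (rule d(2))
        show "cl (hd ?p) \<noteq> {}" using cl[OF j(1)] by simp
        show "matched D (hd ?p) (last ?p)" using jm(1) by (auto simp: matched_def)
        let ?Q = "\<lambda>x y. \<not> (x = j \<and> y = l \<or> x = l \<and> y = j)"
        \<comment> \<open>The closing pair is not consecutive on the list, since \<open>a\<close>
          stands between \<open>j\<close> and \<open>l\<close>.\<close>
        have "successively ?Q (j # r2 @ [a])" by (rule successively_all) (use d(1) in auto)
        then have "successively ?Q ((j # r2 @ [a]) @ [l])"
          using d(1) j(2) by (subst successively_append_iff) auto
        then show "successively (\<lambda>x y. \<not> (x = hd ?p \<and> y = last ?p \<or> x = last ?p \<and> y = hd ?p)) ?p" by simp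
      qed simp
    qed
    show False
    proof (cases "2 \<le> length p")
      case True
      \<comment> \<open>The reversed path is as long, which gives a turn at the first class
        too.\<close>
      have rev: "P (rev p)"
        using p unfolding P_def by (simp add: successively_rev) (auto elim!: successively_mono simp: matched_def)
      obtain j' where j': "turn D (last p) j'" using long[OF p refl True] by blast
      obtain j where j: "turn D (hd p) j"
        using long[OF rev] True p by (auto simp: P_def last_rev)
      have ne: "hd p \<noteq> last p"
        using p True unfolding P_def by (cases p) auto
      have hM: "hd p \<in> M" using p unfolding P_def by (meson hd_in_set subsetD)
      show False
      proof (rule no_two_turns[of p j j'])
        \<comment> \<open>If each end turned towards the other, the degree from
          \<open>last p\<close> to \<open>hd p\<close> would be both 1 and at least 2.\<close>
        show "\<not> (last p = hd p \<and> j' = j \<or> last p = j \<and> j' = hd p)"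
          using ne j j' by (auto simp: turn_def split: if_splits)
      qed (use p j j' cl[OF MJ(1)[OF hM]] in \<open>simp_all add: P_def\<close>)
    next
      case False
      then obtain l where l: "p = [l]" using p unfolding P_def by (cases p; cases "tl p") auto
      have lM: "l \<in> M" using p l by (simp add: P_def)
      have t: "turn D l j" if "j \<in> J" "D l j > 0" for j
      proof (rule ccontr)
        assume "\<not> turn D l j"
        then have "matched D l j" "j \<in> M" using turnI[OF lM that] by blast+
        then have "j \<in> set [l]" using closed[of p j] p l by simp
        then show False using \<open>matched D l j\<close> by (auto simp: matched_def)
      qed
      \<comment> \<open>A path of one class needs two different turns there. A degree of 2 or more
        can only be the inner one, which makes the class have five vertices; not being good, it has
        another neighbour class.\<close>
      have "\<exists>j\<in>J. \<exists>j'\<in>J. j \<noteq> j' \<and> D l j > 0 \<and> D l j' > 0"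
      proof (cases "\<exists>j\<in>J. 2 \<le> D l j")
        case True
        then obtain j where j: "j \<in> J" "2 \<le> D l j" by blast
        have jl: "j = l"
        proof (rule ccontr)
          assume "j \<noteq> l"
          then show False using out[OF lM j(1)] j(2) by simp
        qed
        then have "D l l = 2 \<and> card (cl l) = 5" using inner[OF j(1)] j(2) by auto
        then obtain j' where "j' \<in> J" "j' \<noteq> l" "D l j' > 0" using MJ(3)[OF lM] unfolding good_def by auto
        then show ?thesis using j jl by force
      next
        case False
        then obtain j j' where "j \<in> J" "j' \<in> J" "j' \<noteq> j" "1 \<le> D l j" "1 \<le> D l j'"
          using MJ(2)[OF lM] unfolding big_def by blast
        then show ?thesis by (intro bexI[of _ j] bexI[of _ j']) simp_all
      qed
      then obtain j j' where j: "j \<in> J" "j' \<in> J" "j \<noteq> j'" "D l j > 0" "D l j' > 0" by blast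
      show False
        by (rule no_two_turns[of "[l]" j j']) (use j t cl[OF MJ(1)[OF lM]] in auto)
    qed
  qed
  show ?thesis
  proof (rule leafless_reducedI[OF noleaf])
    fix i assume "i \<in> J" "big D J i"
    then have "good i" using \<open>Bd = {}\<close> unfolding Bd_def by blast
    then show "D i i = 2 \<and> card {v \<in> V. c v = i} = 5 \<and> (\<forall>j\<in>J. j \<noteq> i \<longrightarrow> D i j = 0)"
      unfolding good_def cls_def .
  qed
qed

end

subsection \<open>Trees and bouquets\<close>

lemma adj_induced: "adj (induced G S) x y \<longleftrightarrow> adj G x y \<and> x \<in> S \<and> y \<in> S"
  by (auto simp: adj_def induced_def)

lemma verts_induced [simp]: "verts (induced G S) = S" and color_induced [simp]: "color (induced G S) = color G"
  by (simp_all add: induced_def)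

lemma simple_graph_induced:
  assumes "simple_graph G" "S \<subseteq> verts G"
  shows "simple_graph (induced G S)"
  using assms finite_subset by (auto simp: simple_graph_def induced_def)

lemma connected_graph_adj:
  "connected_graph G \<longleftrightarrow> (\<forall>v\<in>verts G. \<forall>w\<in>verts G. (v, w) \<in> {(x, y). adj G x y}\<^sup>*)"
  by (simp add: connected_graph_def adj_def)

lemma cycle_in_adj:
  "cycle_in G vs \<longleftrightarrow> length vs \<ge> 3 \<and> distinct vs \<and> set vs \<subseteq> verts G \<and>
    (\<forall>i<length vs. adj G (vs ! i) (vs ! ((i + 1) mod length vs)))"
  by (simp add: cycle_in_def adj_def)

lemma cycle_nbrs:
  assumes vs: "cycle_in G vs" and x: "x \<in> set vs"
  shows "\<exists>y z. y \<noteq> z \<and> y \<in> set vs \<and> z \<in> set vs \<and> adj G x y \<and> adj G x z"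
proof -
  let ?n = "length vs"
  have n: "3 \<le> ?n" and d: "distinct vs" and a: "\<And>i. i < ?n \<Longrightarrow> adj G (vs ! i) (vs ! ((i + 1) mod ?n))"
    using vs by (simp_all add: cycle_in_adj)
  obtain i where i: "i < ?n" "x = vs ! i" using x by (auto simp: in_set_conv_nth)
  define j where "j = (if i + 1 = ?n then 0 else i + 1)"
  define k where "k = (if i = 0 then ?n - 1 else i - 1)"
  have jk: "j < ?n" "k < ?n" "j \<noteq> k" using n i by (auto simp: j_def k_def)
  have j: "(i + 1) mod ?n = j" using i(1) n by (auto simp: j_def)
  have k: "(k + 1) mod ?n = i" using i(1) n by (auto simp: k_def)
  have "adj G x (vs ! j)" using a[OF i(1)] i(2) j by simp
  moreover have "adj G x (vs ! k)" using a[OF jk(2)] i(2) k by (auto dest: adj_sym)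
  moreover have "vs ! j \<noteq> vs ! k" using d jk by (simp add: nth_eq_iff_index_eq)
  ultimately show ?thesis using jk by (metis nth_mem)
qed

text \<open>A vertex of \<open>L\<close> has only one neighbour in the enlarged graph and so lies on
  no cycle.\<close>

lemma tree_add_leaves:
  assumes G: "simple_graph G" and SL: "S \<union> L \<subseteq> verts G" and T: "tree (induced G S)"
    and L: "\<And>l. l \<in> L \<Longrightarrow> \<exists>!a. a \<in> S \<and> adj G l a" "\<And>l l'. l \<in> L \<Longrightarrow> l' \<in> L \<Longrightarrow> \<not> adj G l l'"
  shows "tree (induced G (S \<union> L))"
  unfolding tree_def
proof (intro conjI)
  let ?T = "induced G (S \<union> L)"
  show "simple_graph ?T" using simple_graph_induced[OF G SL] .
  show "verts ?T \<noteq> {}" using T by (simp add: tree_def)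
  let ?R = "{(x, y). adj ?T x y}\<^sup>*"
  have RS: "(x, y) \<in> ?R" if "x \<in> S" "y \<in> S" for x y
  proof -
    have "(x, y) \<in> {(x, y). adj (induced G S) x y}\<^sup>*" using T that by (simp add: tree_def connected_graph_adj)
    moreover have "{(x, y). adj (induced G S) x y} \<subseteq> {(x, y). adj ?T x y}" by (auto simp: adj_induced)
    ultimately show ?thesis using rtrancl_mono by blast
  qed
  have RL: "\<exists>a\<in>S. (x, a) \<in> ?R \<and> (a, x) \<in> ?R" if x: "x \<in> S \<union> L" for x
  proof (cases "x \<in> S")
    case False
    then obtain a where "a \<in> S" "adj G x a" using x L(1) by blast
    then have "adj ?T x a" "adj ?T a x" "a \<in> S" using x by (auto simp: adj_induced dest: adj_sym)
    then show ?thesis by blast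
  qed blast
  show "connected_graph ?T"
    unfolding connected_graph_adj
  proof (intro ballI)
    fix v w assume "v \<in> verts ?T" "w \<in> verts ?T"
    then obtain a b where "a \<in> S" "b \<in> S" "(v, a) \<in> ?R" "(b, w) \<in> ?R" using RL[of v] RL[of w] by auto
    then show "(v, w) \<in> ?R" using RS by (meson rtrancl_trans)
  qed
  show "\<nexists>vs. cycle_in ?T vs"
  proof
    assume "\<exists>vs. cycle_in ?T vs"
    then obtain vs where vs: "cycle_in ?T vs" by blast
    show False
    proof (cases "set vs \<subseteq> S")
      case True
      have "cycle_in (induced G S) vs"
        unfolding cycle_in_adj
      proof (intro conjI allI impI)
        fix i assume i: "i < length vs"
        then have "(i + 1) mod length vs < length vs" by (intro mod_less_divisor) auto
        then show "adj (induced G S) (vs ! i) (vs ! ((i + 1) mod length vs))"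
          using vs i True unfolding cycle_in_adj adj_induced by (meson nth_mem subsetD)
      qed (use vs True in \<open>auto simp: cycle_in_adj\<close>)
      then show False using T by (auto simp: tree_def)
    next
      case False
      then obtain l where l: "l \<in> set vs" "l \<notin> S" by blast
      then have lL: "l \<in> L" using vs by (auto simp: cycle_in_adj)
      obtain y z where yz: "y \<noteq> z" "adj ?T l y" "adj ?T l z" using cycle_nbrs[OF vs l(1)] by blast
      then have "y \<in> S" "z \<in> S" "adj G l y" "adj G l z" using L(2)[OF lL] by (auto simp: adj_induced)
      then show False using L(1)[OF lL] yz(1) by blast
    qed
  qed
qed

lemma tree_singleton:
  assumes "simple_graph G" "x \<in> verts G"
  shows "tree (induced G {x})"
proof -
  have "\<not> cycle_in (induced G {x}) vs" for vs
  proof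
    assume vs: "cycle_in (induced G {x}) vs"
    then have "length vs \<ge> 3" "card (set vs) = length vs" "set vs \<subseteq> {x}"
      by (auto simp: cycle_in_adj distinct_card)
    moreover from this have "card (set vs) \<le> 1" using card_mono[of "{x}" "set vs"] by simp
    ultimately show False by linarith
  qed
  then show ?thesis
    using simple_graph_induced[of G "{x}"] assms by (auto simp: tree_def connected_graph_adj)
qed

lemma verts_bouquet [simp]: "verts (bouquet_of T v) = verts T \<times> {..<5}"
  by (simp add: bouquet_of_def)

lemma adj_bouquet:
  "adj (bouquet_of T v) (x, m) (y, n) \<longleftrightarrow> m < 5 \<and> n < 5 \<and>
    (m = n \<and> adj T x y \<or> x = v \<and> y = v \<and> (n = (m + 1) mod 5 \<or> m = (n + 1) mod 5))"
proof
  assume "adj (bouquet_of T v) (x, m) (y, n)"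
  then consider (T) x' y' i where "{(x, m), (y, n)} = {(x', i), (y', i)}" "{x', y'} \<in> edges T" "i < 5"
    | (C) i where "{(x, m), (y, n)} = {(v, i), (v, (i + 1) mod 5)}" "i < 5"
    unfolding adj_def bouquet_of_def by auto
  then show "m < 5 \<and> n < 5 \<and>
    (m = n \<and> adj T x y \<or> x = v \<and> y = v \<and> (n = (m + 1) mod 5 \<or> m = (n + 1) mod 5))"
  proof cases
    case T
    then show ?thesis by (auto simp: doubleton_eq_iff adj_def insert_commute)
  next
    case C
    then show ?thesis by (auto simp: doubleton_eq_iff)
  qed
next
  assume *: "m < 5 \<and> n < 5 \<and>
    (m = n \<and> adj T x y \<or> x = v \<and> y = v \<and> (n = (m + 1) mod 5 \<or> m = (n + 1) mod 5))"
  then consider "m = n" "{x, y} \<in> edges T" | "x = v" "y = v" "n = (m + 1) mod 5" | "x = v" "y = v" "m = (n + 1) mod 5"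
    unfolding adj_def by blast
  then show "adj (bouquet_of T v) (x, m) (y, n)"
  proof cases
    case 1
    then show ?thesis using * unfolding adj_def bouquet_of_def by auto
  next
    case 2
    then have "{(x, m), (y, n)} = {(v, m), (v, (m + 1) mod 5)}" by simp
    then have "{(x, m), (y, n)} \<in> {{(v, i), (v, (i + 1) mod 5)} |i. i < 5}" using * by blast
    then show ?thesis unfolding adj_def bouquet_of_def graph.select_convs by (rule UnI2)
  next
    case 3
    then have "{(x, m), (y, n)} = {(v, n), (v, (n + 1) mod 5)}" by (simp add: insert_commute)
    then have "{(x, m), (y, n)} \<in> {{(v, i), (v, (i + 1) mod 5)} |i. i < 5}" using * by blast
    then show ?thesis unfolding adj_def bouquet_of_def graph.select_convs by (rule UnI2)
  qed
qed

text \<open>The roots of the five copies form a cycle.\<close>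

lemma tree_not_bouquet:
  fixes B :: "('a, 'm) graph_scheme"
  assumes "tree B" "bouquet B"
  shows False
proof -
  obtain T :: "'a graph" and v f where T: "v \<in> verts T" and f: "graph_iso f (bouquet_of T v) B"
    using assms(2) unfolding bouquet_def isomorphic_def by blast
  let ?vs = "map (\<lambda>m. f (v, m)) [0..<5]"
  have bij: "bij_betw f (verts T \<times> {..<5}) (verts B)" using f by (simp add: graph_iso_def)
  have inj: "inj_on (\<lambda>m. f (v, m)) {..<5}"
    using bij T by (auto simp: bij_betw_def inj_on_def)
  have "cycle_in B ?vs"
    unfolding cycle_in_adj
  proof (intro conjI allI impI)
    show "distinct ?vs" using inj by (simp add: distinct_map atLeast0LessThan)
    show "set ?vs \<subseteq> verts B" using bij_betw_apply[OF bij] T by auto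
    fix i assume i: "i < length ?vs"
    have "adj (bouquet_of T v) (v, i) (v, (i + 1) mod 5)" using i by (simp add: adj_bouquet)
    moreover have "(v, i) \<in> verts (bouquet_of T v)" "(v, (i + 1) mod 5) \<in> verts (bouquet_of T v)" using i T by auto
    ultimately have "adj B (f (v, i)) (f (v, (i + 1) mod 5))" using f unfolding graph_iso_adj by blast
    then show "adj B (?vs ! i) (?vs ! ((i + 1) mod length ?vs))" using i by simp
  qed simp
  then show False using assms(1) by (auto simp: tree_def)
qed

text \<open>In contrast to \<^const>\<open>bouquet\<close>, the isomorphism has to respect the colours.\<close>

definition colored_bouquet :: "('a, 'c) colored_graph \<Rightarrow> 'c set \<Rightarrow> 'a set \<Rightarrow> bool" where
  "colored_bouquet F J S \<longleftrightarrow> (\<exists>S0 v f. S0 \<subseteq> part (verts F) (color F) J \<and> tree (induced F S0) \<and> v \<in> S0 \<and>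
    graph_iso f (bouquet_of (induced F S0) v) (induced F S) \<and> (\<forall>x\<in>S0. \<forall>m<5. color F (f (x, m)) = color F x))"

lemma colored_bouquet_imp_bouquet:
  assumes F: "simple_graph F" and S: "S \<subseteq> verts F" and b: "colored_bouquet F J S"
  shows "bouquet (induced F S)"
proof -
  obtain S0 v f where f: "tree (induced F S0)" "v \<in> S0" "graph_iso f (bouquet_of (induced F S0) v) (induced F S)"
    using b unfolding colored_bouquet_def by blast
  let ?T = "\<lparr>verts = S0, edges = edges (induced F S0)\<rparr>"
  have "tree ?T" using f(1) unfolding tree_def simple_graph_def connected_graph_def cycle_in_def by simp
  moreover have "bouquet_of ?T v = bouquet_of (induced F S0) v" by (simp add: bouquet_of_def)
  ultimately show ?thesis
    unfolding bouquet_def isomorphic_def using f simple_graph_induced[OF F S] by (metis graph.select_convs(1))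
qed

text \<open>The leaves at \<open>S0\<close> are copied together with the tree. Since
  \<open>f\<close> preserves colours and the number of leaves at a vertex is a degree, the five
  copies account for all leaves at \<open>S\<close>.\<close>

lemma bouquet_add_leaves:
  fixes F :: "('a, 'c) colored_graph"
  assumes F: "simple_graph F" and E: "equitable (verts F) (color F) D (adj F)" and leaf: "leaf_class D J i"
    and S: "S \<subseteq> part (verts F) (color F) (J - {i})" and b: "colored_bouquet F (J - {i}) S"
  shows "colored_bouquet F J (S \<union> {l \<in> verts F. color F l = i \<and> (\<exists>a\<in>S. adj F l a)})"
proof -
  let ?V = "verts F" and ?c = "color F"
  have fin: "finite ?V" using F by (simp add: simple_graph_def)
  obtain S0 v f where S0: "S0 \<subseteq> part ?V ?c (J - {i})" "tree (induced F S0)" "v \<in> S0"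
    and f: "graph_iso f (bouquet_of (induced F S0) v) (induced F S)"
    and fc: "\<And>x m. x \<in> S0 \<Longrightarrow> m < 5 \<Longrightarrow> ?c (f (x, m)) = ?c x"
    using b unfolding colored_bouquet_def by blast
  define L0 where "L0 = {l \<in> ?V. ?c l = i \<and> (\<exists>a\<in>S0. adj F l a)}"
  define M where "M = {l \<in> ?V. ?c l = i \<and> (\<exists>a\<in>S. adj F l a)}"
  let ?T = "induced F (S0 \<union> L0)"
  let ?B = "adj (bouquet_of ?T v)"
  have iJ: "i \<in> J" using leaf by (simp add: leaf_class_def)
  have nb: "\<exists>!a. a \<in> part ?V ?c (J - {i}) \<and> adj F l a" if "l \<in> ?V" "?c l = i" for l
    using leaf_nbr(1)[OF E leaf that] .
  have nn: "\<not> adj F l l'" if "l \<in> ?V" "?c l = i" "l' \<in> ?V" "?c l' = i" for l l'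
    using leaf_nbr(2)[OF E leaf that] .
  have disj: "S0 \<inter> L0 = {}" "S \<inter> M = {}" using S0(1) S by (auto simp: L0_def M_def part_def)
  have L0u: "\<exists>!a. a \<in> S0 \<and> adj F l a" if "l \<in> L0" for l
    using nb[of l] that S0(1) unfolding L0_def by blast
  have L0n: "\<not> adj F l l'" if "l \<in> L0" "l' \<in> L0" for l l' using nn that unfolding L0_def by blast
  have SL: "S0 \<union> L0 \<subseteq> ?V" using S0(1) by (auto simp: L0_def part_def)
  have T: "tree ?T" by (rule tree_add_leaves[OF F SL S0(2) L0u L0n])
  have vL: "v \<notin> L0" using S0(3) disj by blast
  have fbij: "bij_betw f (S0 \<times> {..<5}) S" using f by (simp add: graph_iso_def)
  have Bsym: "?B q p" if "?B p q" for p q using that by (rule adj_sym)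
  have BL: "?B (l, m) (a, n) \<longleftrightarrow> m < 5 \<and> n = m \<and> adj F l a" if "l \<in> L0" "a \<in> S0" for l m a n
    using that vL by (auto simp: adj_bouquet adj_induced)
  have "\<exists>g'. bij_betw g' (S0 \<times> {..<5} \<union> L0 \<times> {..<5}) (S \<union> M) \<and> (\<forall>a\<in>S0 \<times> {..<5}. g' a = f a) \<and>
      (\<forall>l\<in>L0 \<times> {..<5}. g' l \<in> M) \<and>
      (\<forall>x\<in>S0 \<times> {..<5} \<union> L0 \<times> {..<5}. \<forall>y\<in>S0 \<times> {..<5} \<union> L0 \<times> {..<5}. ?B x y \<longleftrightarrow> adj F (g' x) (g' y))"
  proof (rule extend_leaves)
    show "finite (L0 \<times> {..<5::nat})" "finite M" using fin by (simp_all add: L0_def M_def)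
    show "bij_betw f (S0 \<times> {..<5}) S" by (rule fbij)
    show "(S0 \<times> {..<5}) \<inter> (L0 \<times> {..<5}) = {}" "S \<inter> M = {}" using disj by auto
    show "?B q p" if "?B p q" for p q using that by (rule adj_sym)
    show "adj F y x" if "adj F x y" for x y using that by (rule adj_sym)
    show "?B p q \<longleftrightarrow> adj F (f p) (f q)" if pq: "p \<in> S0 \<times> {..<5}" "q \<in> S0 \<times> {..<5}" for p q
    proof -
      obtain x m y n where xy: "p = (x, m)" "q = (y, n)" "x \<in> S0" "y \<in> S0" using pq by auto
      have "?B p q \<longleftrightarrow> adj (bouquet_of (induced F S0) v) p q"
        unfolding xy(1,2) adj_bouquet adj_induced using xy(3,4) by auto
      also have "\<dots> \<longleftrightarrow> adj (induced F S) (f p) (f q)" using f pq unfolding graph_iso_adj xy(1,2) by simp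
      also have "\<dots> \<longleftrightarrow> adj F (f p) (f q)" using bij_betw_apply[OF fbij] pq by (simp add: adj_induced)
      finally show ?thesis .
    qed
    show "\<exists>!a. a \<in> S0 \<times> {..<5} \<and> ?B l a" if l0: "l \<in> L0 \<times> {..<5}" for l
    proof -
      obtain x m where l: "l = (x, m)" "x \<in> L0" "m < 5" using l0 by auto
      obtain a where a: "a \<in> S0" "adj F x a" "\<And>b. b \<in> S0 \<Longrightarrow> adj F x b \<Longrightarrow> b = a" using L0u[OF l(2)] by blast
      show ?thesis
      proof (rule ex1I[of _ "(a, m)"])
        show "(a, m) \<in> S0 \<times> {..<5} \<and> ?B l (a, m)"
          using a(1,2) BL[OF l(2) a(1), of m m] l(1,3) by simp
        fix q assume q: "q \<in> S0 \<times> {..<5} \<and> ?B l q"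
        then obtain b n where "q = (b, n)" "b \<in> S0" by auto
        moreover from this have "n = m" "adj F x b" using q BL[OF l(2), of b m n] l(1) by simp_all
        ultimately show "q = (a, m)" using a(3) by blast
      qed
    qed
    show "\<not> ?B l l'" if "l \<in> L0 \<times> {..<5}" "l' \<in> L0 \<times> {..<5}" for l l'
      using that vL L0n by (auto simp: adj_bouquet adj_induced)
    show "\<exists>!b. b \<in> S \<and> adj F m b" if "m \<in> M" for m
      using nb[of m] that S unfolding M_def by blast
    show "\<not> adj F m m'" if "m \<in> M" "m' \<in> M" for m m' using nn that unfolding M_def by blast
    fix a :: "'a \<times> nat" assume "a \<in> S0 \<times> {..<5}"
    then obtain x m where a: "a = (x, m)" "x \<in> S0" "m < 5" by auto
    have xV: "x \<in> ?V" using a(2) S0(1) by (auto simp: part_def)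
    have fa: "f a \<in> S" using bij_betw_apply[OF fbij, of a] a by simp
    then have faV: "f a \<in> ?V" using S by (auto simp: part_def)
    have "?B a (l, n) \<longleftrightarrow> n = m \<and> adj F x l" if "l \<in> L0" for l n
    proof -
      have "?B a (l, n) \<longleftrightarrow> ?B (l, n) a" using Bsym by blast
      also have "\<dots> \<longleftrightarrow> n < 5 \<and> m = n \<and> adj F l x" unfolding a(1) by (rule BL[OF that a(2)])
      also have "\<dots> \<longleftrightarrow> n = m \<and> adj F x l" using a(3) adj_sym[of F x l] adj_sym[of F l x] by auto
      finally show ?thesis .
    qed
    then have "{l \<in> L0 \<times> {..<5}. ?B a l} = (\<lambda>l. (l, m)) ` {l \<in> L0. adj F x l}" using a(3) by auto
    then have "card {l \<in> L0 \<times> {..<5}. ?B a l} = card {l \<in> L0. adj F x l}"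
      by (simp add: card_image inj_on_def)
    also have "{l \<in> L0. adj F x l} = {y \<in> ?V. ?c y = i \<and> adj F x y}"
      using a(2) unfolding L0_def by (auto dest: adj_sym)
    also have "card \<dots> = D (?c x) i" by (rule equitableD(6)[OF E xV])
    also have "\<dots> = card {y \<in> ?V. ?c y = i \<and> adj F (f a) y}"
      using equitableD(6)[OF E faV, of i] fc[OF a(2,3)] a(1) by simp
    also have "{y \<in> ?V. ?c y = i \<and> adj F (f a) y} = {m \<in> M. adj F (f a) m}"
      using fa unfolding M_def by (auto dest: adj_sym)
    finally show "card {l \<in> L0 \<times> {..<5}. ?B a l} = card {m \<in> M. adj F (f a) m}" .
  qed
  then obtain g' where g': "bij_betw g' (S0 \<times> {..<5} \<union> L0 \<times> {..<5}) (S \<union> M)"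
    "\<And>a. a \<in> S0 \<times> {..<5} \<Longrightarrow> g' a = f a" "\<And>l. l \<in> L0 \<times> {..<5} \<Longrightarrow> g' l \<in> M"
    "\<And>x y. x \<in> S0 \<times> {..<5} \<union> L0 \<times> {..<5} \<Longrightarrow> y \<in> S0 \<times> {..<5} \<union> L0 \<times> {..<5} \<Longrightarrow> ?B x y \<longleftrightarrow> adj F (g' x) (g' y)"
    by blast
  have un: "S0 \<times> {..<5} \<union> L0 \<times> {..<5} = (S0 \<union> L0) \<times> {..<5::nat}" by blast
  have "graph_iso g' (bouquet_of ?T v) (induced F (S \<union> M))"
    unfolding graph_iso_adj
  proof (intro conjI ballI)
    show "bij_betw g' (verts (bouquet_of ?T v)) (verts (induced F (S \<union> M)))"
      using g'(1) unfolding un by simp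
    fix p q assume "p \<in> verts (bouquet_of ?T v)" "q \<in> verts (bouquet_of ?T v)"
    then have pq: "p \<in> S0 \<times> {..<5} \<union> L0 \<times> {..<5}" "q \<in> S0 \<times> {..<5} \<union> L0 \<times> {..<5}" unfolding un by simp_all
    show "?B p q \<longleftrightarrow> adj (induced F (S \<union> M)) (g' p) (g' q)"
      using g'(4)[OF pq] bij_betw_apply[OF g'(1) pq(1)] bij_betw_apply[OF g'(1) pq(2)] by (simp add: adj_induced)
  qed
  moreover have "?c (g' (x, m)) = ?c x" if "x \<in> S0 \<union> L0" "m < 5" for x m
  proof (cases "x \<in> S0")
    case True
    then show ?thesis using g'(2)[of "(x, m)"] fc that by simp
  next
    case False
    then have "x \<in> L0" using that by blast
    then show ?thesis using g'(3)[of "(x, m)"] that unfolding L0_def M_def by simp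
  qed
  moreover have "S0 \<union> L0 \<subseteq> part ?V ?c J" using S0(1) iJ by (auto simp: part_def L0_def)
  ultimately have "colored_bouquet F J (S \<union> M)"
    unfolding colored_bouquet_def using T S0(3) by blast
  then show ?thesis by (simp add: M_def)
qed

section \<open>Blocks of the bouquet forest\<close>

text \<open>The invariant while leaf classes are put back. That a bouquet contains an entire colour
  class is what finally excludes a second bouquet isomorphic to it.\<close>

definition forest_part :: "('a, 'c) colored_graph \<Rightarrow> 'c set \<Rightarrow> 'a set set \<Rightarrow> bool" where
  "forest_part F J \<S> \<longleftrightarrow> partition_on (part (verts F) (color F) J) \<S> \<and>
    (\<forall>x\<in>part (verts F) (color F) J. \<forall>y\<in>part (verts F) (color F) J. adj F x y \<longrightarrow> (\<exists>S\<in>\<S>. x \<in> S \<and> y \<in> S)) \<and>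
    (\<forall>S\<in>\<S>. tree (induced F S) \<or>
      colored_bouquet F J S \<and> (\<exists>i. {v \<in> verts F. color F v = i} \<noteq> {} \<and> {v \<in> verts F. color F v = i} \<subseteq> S))"

lemma forest_part_reduced:
  fixes F :: "('a, 'c) colored_graph"
  assumes F: "simple_graph F" and E: "equitable (verts F) (color F) D (adj F)"
    and red: "reduced (verts F) (color F) D J"
  shows "\<exists>\<S>. forest_part F J \<S>"
proof -
  let ?V = "verts F" and ?c = "color F"
  let ?P = "part ?V ?c J" and ?cl = "\<lambda>i. {v \<in> ?V. ?c v = i}"
  \<comment> \<open>Inner degree 0 gives single vertices, 1 gives matched pairs, 2 gives whole
    classes.\<close>
  define block where "block x = (if D (?c x) (?c x) = 2 then ?cl (?c x)
    else insert x {y \<in> ?V. ?c y = ?c x \<and> adj F x y})" for x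
  have cases: "D (?c x) (?c x) = 0 \<or> D (?c x) (?c x) = 1 \<or> D (?c x) (?c x) = 2 \<and> card (?cl (?c x)) = 5"
    if "x \<in> ?P" for x using red that unfolding reduced_def part_def by blast
  have sub: "block x \<subseteq> ?cl (?c x)" if "x \<in> ?P" for x using that by (auto simp: block_def part_def)
  have self: "x \<in> block x" if "x \<in> ?P" for x using that by (auto simp: block_def part_def)
  have block0: "block x = {x}" if "x \<in> ?P" "D (?c x) (?c x) = 0" for x
    using that degree_0[OF E, of x] by (auto simp: block_def part_def)
  have block1: "\<exists>y. block x = {x, y} \<and> adj F x y \<and> y \<in> ?V \<and> ?c y = ?c x \<and> block y = {y, x}"
    if x: "x \<in> ?P" "D (?c x) (?c x) = 1" for x
  proof -
    have xV: "x \<in> ?V" using x by (simp add: part_def)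
    obtain y where y: "y \<in> ?V" "?c y = ?c x" "adj F x y" "\<And>z. z \<in> ?V \<Longrightarrow> ?c z = ?c x \<Longrightarrow> adj F x z \<Longrightarrow> z = y"
      using degree_1[OF E xV x(2)] by blast
    have yx: "\<And>z. z \<in> ?V \<Longrightarrow> ?c z = ?c x \<Longrightarrow> adj F y z \<Longrightarrow> z = x"
      using degree_1[OF E y(1), of "?c x"] x(2) y(2) xV adj_sym[OF y(3)] by auto
    have "{z \<in> ?V. ?c z = ?c x \<and> adj F x z} = {y}" using y by blast
    then have "block x = {x, y}" using x(2) unfolding block_def by simp
    moreover have "{z \<in> ?V. ?c z = ?c x \<and> adj F y z} = {x}" using yx xV adj_sym[OF y(3)] by blast
    then have "block y = {y, x}" using x(2) unfolding block_def y(2) by simp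
    ultimately show ?thesis using y by blast
  qed
  have same: "block z = block x" if x: "x \<in> ?P" and z: "z \<in> block x" for x z
    using cases[OF x]
  proof (elim disjE)
    assume "D (?c x) (?c x) = 0"
    then show ?thesis using block0[OF x] z by simp
  next
    assume "D (?c x) (?c x) = 1"
    then show ?thesis using block1[OF x] z by auto
  next
    assume d: "D (?c x) (?c x) = 2 \<and> card (?cl (?c x)) = 5"
    then have "?c z = ?c x" using z by (simp add: block_def)
    then show ?thesis using d by (simp add: block_def)
  qed
  have "partition_on ?P (block ` ?P)"
  proof (rule partition_onI)
    show "\<Union> (block ` ?P) = ?P" using sub self by (fastforce simp: part_def)
    show "{} \<notin> block ` ?P" using self by blast
    show "disjnt p q" if pq: "p \<in> block ` ?P" "q \<in> block ` ?P" "p \<noteq> q" for p q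
    proof (rule ccontr)
      assume "\<not> disjnt p q"
      then obtain z where "z \<in> p" "z \<in> q" by (auto simp: disjnt_def)
      then have "p = block z" "q = block z" using pq(1,2) same by (metis imageE)+
      then show False using pq(3) by simp
    qed
  qed
  moreover have "\<exists>S\<in>block ` ?P. x \<in> S \<and> y \<in> S" if xy: "x \<in> ?P" "y \<in> ?P" "adj F x y" for x y
  proof -
    have "D (?c x) (?c y) > 0" by (rule edge_degree_pos[OF E xy(3)])
    then have "?c y = ?c x" using red xy unfolding reduced_def part_def by (metis (no_types, lifting) less_irrefl mem_Collect_eq)
    then have "y \<in> block x" using xy by (auto simp: block_def part_def)
    then show ?thesis using self xy(1) by blast
  qed
  moreover have "tree (induced F (block x)) \<or> colored_bouquet F J (block x) \<and>
      (\<exists>i. ?cl i \<noteq> {} \<and> ?cl i \<subseteq> block x)" if x: "x \<in> ?P" for x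
  proof -
    have xV: "x \<in> ?V" using x by (simp add: part_def)
    from cases[OF x] show ?thesis
    proof (elim disjE)
      assume "D (?c x) (?c x) = 0"
      then show ?thesis using block0[OF x] tree_singleton[OF F xV] by simp
    next
      assume "D (?c x) (?c x) = 1"
      then obtain y where y: "block x = {x, y}" "adj F x y" "y \<in> ?V" using block1[OF x] by blast
      have "tree (induced F ({x} \<union> {y}))"
        by (rule tree_add_leaves[OF F _ tree_singleton[OF F xV]])
          (use xV y adj_sym[OF y(2)] equitableD(3)[OF E] in auto)
      then show ?thesis using y(1) by (simp add: insert_commute)
    next
      assume d: "D (?c x) (?c x) = 2 \<and> card (?cl (?c x)) = 5"
      let ?C = "?cl (?c x)"
      have deg: "card {y \<in> ?C. adj F w y} = 2" if w: "w \<in> ?C" for w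
      proof -
        have "{y \<in> ?C. adj F w y} = {y \<in> ?V. ?c y = ?c x \<and> adj F w y}" by auto
        then show ?thesis using equitableD(6)[OF E, of w "?c x"] w d by simp
      qed
      obtain z where z: "bij_betw z {..<5::nat} ?C"
        "\<And>m n. m < 5 \<Longrightarrow> n < 5 \<Longrightarrow> adj F (z m) (z n) \<longleftrightarrow> n = (m + 1) mod 5 \<or> m = (n + 1) mod 5"
        using c5_enum[OF conjunct2[OF d] adj_sym equitableD(3)[OF E] deg] by blast
      have zC: "z m \<in> ?C" if "m < 5" for m using bij_betw_apply[OF z(1)] that by simp
      \<comment> \<open>A 5-cycle is the bouquet of a tree with one vertex; colours are respected
        because the cycle is a single class.\<close>
      let ?f = "\<lambda>p. z (snd p)"
      have "graph_iso ?f (bouquet_of (induced F {x}) x) (induced F ?C)"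
        unfolding graph_iso_adj
      proof (intro conjI ballI)
        have "bij_betw snd ({x} \<times> {..<5::nat}) {..<5}" by (auto simp: bij_betw_def inj_on_def)
        from bij_betw_trans[OF this z(1)]
        show "bij_betw ?f (verts (bouquet_of (induced F {x}) x)) (verts (induced F ?C))" by (simp add: comp_def)
        fix p q assume "p \<in> verts (bouquet_of (induced F {x}) x)" "q \<in> verts (bouquet_of (induced F {x}) x)"
        then obtain m n where pq: "p = (x, m)" "q = (x, n)" "m < 5" "n < 5" by auto
        show "adj (bouquet_of (induced F {x}) x) p q \<longleftrightarrow> adj (induced F ?C) (?f p) (?f q)"
          using pq z(2)[OF pq(3,4)] zC[OF pq(3)] zC[OF pq(4)] equitableD(3)[OF E, of x]
          by (simp add: adj_bouquet adj_induced)
      qed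
      moreover have "\<forall>y\<in>{x}. \<forall>m<5. ?c (?f (y, m)) = ?c y" using zC by auto
      moreover have "{x} \<subseteq> ?P" using x by simp
      ultimately have "colored_bouquet F J ?C"
        unfolding colored_bouquet_def using tree_singleton[OF F xV] by blast
      moreover have bC: "block x = ?C" using d by (simp add: block_def)
      moreover have "?C \<noteq> {}" using xV by blast
      ultimately show ?thesis unfolding bC by (intro disjI2 conjI exI[of _ "?c x"] subset_refl)
    qed
  qed
  ultimately have "forest_part F J (block ` ?P)" unfolding forest_part_def by blast
  then show ?thesis by blast
qed

text \<open>Each leaf joins the block of its unique neighbour.\<close>

lemma forest_part_step:
  fixes F :: "('a, 'c) colored_graph"
  assumes F: "simple_graph F" and E: "equitable (verts F) (color F) D (adj F)" and leaf: "leaf_class D J i"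
    and fp: "forest_part F (J - {i}) \<S>"
  shows "\<exists>\<S>'. forest_part F J \<S>'"
proof -
  let ?V = "verts F" and ?c = "color F"
  let ?P = "part ?V ?c J" and ?Q = "part ?V ?c (J - {i})"
  define ex where "ex S = S \<union> {l \<in> ?V. ?c l = i \<and> (\<exists>a\<in>S. adj F l a)}" for S
  have part: "partition_on ?Q \<S>"
    and edge: "\<And>x y. x \<in> ?Q \<Longrightarrow> y \<in> ?Q \<Longrightarrow> adj F x y \<Longrightarrow> \<exists>S\<in>\<S>. x \<in> S \<and> y \<in> S"
    and tb: "\<And>S. S \<in> \<S> \<Longrightarrow> tree (induced F S) \<or> colored_bouquet F (J - {i}) S \<and>
      (\<exists>i. {v \<in> ?V. ?c v = i} \<noteq> {} \<and> {v \<in> ?V. ?c v = i} \<subseteq> S)"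
    using fp unfolding forest_part_def by blast+
  have iJ: "i \<in> J" using leaf by (simp add: leaf_class_def)
  have SQ: "S \<subseteq> ?Q" if "S \<in> \<S>" for S using partition_onD1[OF part] that by blast
  have nb: "\<exists>!a. a \<in> ?Q \<and> adj F l a" if "l \<in> ?V" "?c l = i" for l using leaf_nbr(1)[OF E leaf that] .
  have nn: "\<not> adj F l l'" if "l \<in> ?V" "?c l = i" "l' \<in> ?V" "?c l' = i" for l l'
    using leaf_nbr(2)[OF E leaf that] .
  have PQ: "x \<in> ?Q \<or> x \<in> ?V \<and> ?c x = i" if "x \<in> ?P" for x using that by (auto simp: part_def)
  have inS: "\<exists>S\<in>\<S>. x \<in> S" if "x \<in> ?Q" for x using partition_onD1[OF part] that by blast
  have uniq: "S = S'" if "S \<in> \<S>" "S' \<in> \<S>" "x \<in> S" "x \<in> S'" for S S' x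
    using partition_onD2[OF part] that unfolding disjoint_def by blast
  have exQ: "x \<in> ?Q \<Longrightarrow> x \<in> ex S \<Longrightarrow> x \<in> S" for x S by (auto simp: ex_def part_def)
  have "partition_on ?P (ex ` \<S>)"
  proof (rule partition_onI)
    show "\<Union> (ex ` \<S>) = ?P"
    proof (intro equalityI subsetI)
      fix x assume "x \<in> \<Union> (ex ` \<S>)"
      then show "x \<in> ?P" using SQ iJ unfolding ex_def by (auto simp: part_def)
    next
      fix x assume x: "x \<in> ?P"
      show "x \<in> \<Union> (ex ` \<S>)"
      proof (cases "x \<in> ?Q")
        case True
        then show ?thesis using inS unfolding ex_def by blast
      next
        case False
        then have xi: "x \<in> ?V" "?c x = i" using PQ[OF x] by blast+
        then obtain a where "a \<in> ?Q" "adj F x a" using nb by blast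
        then obtain S where "S \<in> \<S>" "a \<in> S" using inS by blast
        then show ?thesis using xi \<open>adj F x a\<close> unfolding ex_def by blast
      qed
    qed
    show "{} \<notin> ex ` \<S>"
    proof
      assume "{} \<in> ex ` \<S>"
      then obtain S where "S \<in> \<S>" "ex S = {}" by force
      moreover from this have "S = {}" by (simp add: ex_def)
      ultimately show False using partition_onD3[OF part] by simp
    qed
    show "disjnt p q" if pq: "p \<in> ex ` \<S>" "q \<in> ex ` \<S>" "p \<noteq> q" for p q
    proof (rule ccontr)
      assume "\<not> disjnt p q"
      then obtain x where x: "x \<in> p" "x \<in> q" by (auto simp: disjnt_def)
      obtain S S' where S: "S \<in> \<S>" "S' \<in> \<S>" "p = ex S" "q = ex S'" using pq by blast
      have "S = S'"
      proof (cases "x \<in> ?Q")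
        case True
        then have "x \<in> S" "x \<in> S'" using exQ x S by blast+
        then show ?thesis using uniq S by blast
      next
        case False
        then have xi: "x \<in> ?V" "?c x = i" and "\<exists>a\<in>S. adj F x a" "\<exists>a\<in>S'. adj F x a"
          using x S SQ PQ unfolding ex_def by blast+
        then obtain a a' where a: "a \<in> S" "adj F x a" "a' \<in> S'" "adj F x a'" by blast
        then have "a = a'" using nb[OF xi] SQ S by blast
        then show ?thesis using uniq S a by blast
      qed
      then show False using S pq(3) by blast
    qed
  qed
  moreover have "\<exists>S\<in>ex ` \<S>. x \<in> S \<and> y \<in> S" if xy: "x \<in> ?P" "y \<in> ?P" "adj F x y" for x y
  proof -
    have leaf_case: "\<exists>S\<in>ex ` \<S>. l \<in> S \<and> a \<in> S" if la: "l \<in> ?V" "?c l = i" "a \<in> ?Q" "adj F l a" for l a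
    proof -
      obtain S where S: "S \<in> \<S>" "a \<in> S" using inS la(3) by blast
      then have "l \<in> ex S" "a \<in> ex S" using la by (auto simp: ex_def)
      then show ?thesis using S(1) by blast
    qed
    consider "x \<in> ?Q" "y \<in> ?Q" | "x \<in> ?V" "?c x = i" "y \<in> ?Q" | "x \<in> ?Q" "y \<in> ?V" "?c y = i"
      using PQ[OF xy(1)] PQ[OF xy(2)] nn xy(3) by blast
    then show ?thesis
    proof cases
      case 1
      then obtain S where S: "S \<in> \<S>" "x \<in> S" "y \<in> S" using edge[OF _ _ xy(3)] by blast
      then have "x \<in> ex S" "y \<in> ex S" by (simp_all add: ex_def)
      then show ?thesis using S(1) by blast
    next
      case 2
      then show ?thesis by (rule leaf_case[OF _ _ _ xy(3)])
    next
      case 3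
      then show ?thesis using leaf_case[OF 3(2,3,1) adj_sym[OF xy(3)]] by blast
    qed
  qed
  moreover have "tree (induced F (ex S)) \<or> colored_bouquet F J (ex S) \<and>
      (\<exists>i. {v \<in> ?V. ?c v = i} \<noteq> {} \<and> {v \<in> ?V. ?c v = i} \<subseteq> ex S)" if S: "S \<in> \<S>" for S
    using tb[OF S]
  proof
    assume T: "tree (induced F S)"
    have "tree (induced F (ex S))"
      unfolding ex_def
    proof (rule tree_add_leaves[OF F _ T])
      let ?L = "{l \<in> ?V. ?c l = i \<and> (\<exists>a\<in>S. adj F l a)}"
      show "S \<union> ?L \<subseteq> ?V" using SQ[OF S] by (auto simp: part_def)
      show "\<exists>!a. a \<in> S \<and> adj F l a" if "l \<in> ?L" for l using nb[of l] that SQ[OF S] by blast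
      show "\<not> adj F l l'" if "l \<in> ?L" "l' \<in> ?L" for l l' using nn that by blast
    qed
    then show ?thesis ..
  next
    assume b: "colored_bouquet F (J - {i}) S \<and> (\<exists>i. {v \<in> ?V. ?c v = i} \<noteq> {} \<and> {v \<in> ?V. ?c v = i} \<subseteq> S)"
    then have "colored_bouquet F J (ex S)"
      unfolding ex_def using bouquet_add_leaves[OF F E leaf SQ[OF S]] by blast
    moreover have "S \<subseteq> ex S" by (auto simp: ex_def)
    ultimately show ?thesis using b by (meson order_trans)
  qed
  ultimately have "forest_part F J (ex ` \<S>)" unfolding forest_part_def by blast
  then show ?thesis by blast
qed

lemma reduced_imp_bouquet_forest:
  fixes F :: "('a, 'c) colored_graph"
  assumes F: "simple_graph F" and E: "equitable (verts F) (color F) D (adj F)"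
    and J: "reach D (color F ` verts F) J" and red: "reduced (verts F) (color F) D J"
  shows "bouquet_forest F"
proof -
  let ?V = "verts F" and ?c = "color F"
  have "\<exists>\<S>. forest_part F (?c ` ?V) \<S>"
    by (rule reach_up[where P = "\<lambda>J. \<exists>\<S>. forest_part F J \<S>", OF J forest_part_reduced[OF F E red]])
      (use forest_part_step[OF F E] in blast)
  then obtain \<S> where fp: "forest_part F (?c ` ?V) \<S>" by blast
  have pV: "part ?V ?c (?c ` ?V) = ?V" by (auto simp: part_def)
  have part: "partition_on ?V \<S>"
    and edge: "\<And>x y. x \<in> ?V \<Longrightarrow> y \<in> ?V \<Longrightarrow> adj F x y \<Longrightarrow> \<exists>S\<in>\<S>. x \<in> S \<and> y \<in> S"
    and tb: "\<And>S. S \<in> \<S> \<Longrightarrow> tree (induced F S) \<or> colored_bouquet F (?c ` ?V) S \<and>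
      (\<exists>i. {v \<in> ?V. ?c v = i} \<noteq> {} \<and> {v \<in> ?V. ?c v = i} \<subseteq> S)"
    using fp unfolding forest_part_def pV by blast+
  show ?thesis
    unfolding bouquet_forest_def
  proof (intro exI[of _ \<S>] conjI ballI impI)
    show "partition_on ?V \<S>" by (rule part)
    show "\<exists>S\<in>\<S>. e \<subseteq> S" if eF: "e \<in> edges F" for e
    proof -
      obtain x y where e: "e = {x, y}" "adj F x y" using simple_graph_edgeE[OF F eF] by blast
      then show ?thesis using edge[of x y] simple_graph_adj[OF F e(2)] by blast
    qed
    show "tree (induced F S) \<or> bouquet (induced F S)" if "S \<in> \<S>" for S
      using tb[OF that] colored_bouquet_imp_bouquet[OF F] partition_onD1[OF part] that by blast
    fix S S' assume S: "S \<in> \<S>" "S' \<in> \<S>" "S \<noteq> S' \<and> bouquet (induced F S) \<and> bouquet (induced F S')"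
    show "\<not> color_isomorphic (induced F S) (induced F S')"
    proof
      assume "color_isomorphic (induced F S) (induced F S')"
      then obtain f where f: "bij_betw f S S'" "\<forall>v\<in>S. ?c (f v) = ?c v"
        unfolding color_isomorphic_def graph_iso_def by auto
      have "\<not> tree (induced F S)" using tree_not_bouquet S by blast
      \<comment> \<open>An isomorphism would send a vertex of this class into \<open>S'\<close>,
        although the class lies entirely in \<open>S\<close>.\<close>
      then obtain i where i: "{v \<in> ?V. ?c v = i} \<noteq> {}" "{v \<in> ?V. ?c v = i} \<subseteq> S" using tb[OF S(1)] by blast
      then obtain x where x: "x \<in> S" "?c x = i" by blast
      have "f x \<in> S'" using bij_betw_apply[OF f(1) x(1)] .
      moreover from this have "f x \<in> ?V" using partition_onD1[OF part] S(2) by blast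
      then have "f x \<in> S" using i(2) f(2) x by auto
      ultimately show False using partition_onD2[OF part] S unfolding disjoint_def by blast
    qed
  qed
qed

subsection \<open>Bouquet forests reduce to isolated vertices, perfect matchings and 5-cycles\<close>

text \<open>A longest path in \<open>U\<close> whose last vertex is not \<open>r\<close> cannot be extended, so it closes a cycle.\<close>

lemma acyclic_subset:
  assumes T: "simple_graph T" "\<nexists>vs. cycle_in T vs" and U: "U \<subseteq> verts T"
    and two: "\<And>x. x \<in> U \<Longrightarrow> x \<noteq> r \<Longrightarrow> \<exists>y\<in>U. \<exists>z\<in>U. y \<noteq> z \<and> adj T x y \<and> adj T x z"
  shows "U \<subseteq> {r}"
proof (rule ccontr)
  assume "\<not> U \<subseteq> {r}"
  then obtain x where x: "x \<in> U" "x \<noteq> r" by blast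
  have fin: "finite U" using T(1) U finite_subset by (auto simp: simple_graph_def)
  have irr: "\<not> adj T v v" for v using simple_graph_adj(1)[OF T(1)] by blast
  \<comment> \<open>Only the last vertex must differ from \<open>r\<close>: paths are prolonged at
    that end, and the two neighbours are granted only to vertices other than
    \<open>r\<close>.\<close>
  define P where "P p \<longleftrightarrow> 2 \<le> length p \<and> distinct p \<and> set p \<subseteq> U \<and> successively (adj T) p \<and> last p \<noteq> r" for p
  obtain y where y: "y \<in> U" "adj T x y" using two[OF x] by blast
  have "P [y, x]" using x y irr adj_sym[OF y(2)] by (auto simp: P_def)
  moreover have "length p < Suc (card U)" if "P p" for p
    using that fin card_mono[of U "set p"] by (simp add: P_def distinct_card)
  ultimately obtain p where p: "P p" and pmax: "\<And>q. P q \<Longrightarrow> length q \<le> length p"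
    using ex_has_greatest_nat[of P "[y, x]" length "Suc (card U)"] by blast
  define l where "l = last p"
  have "p \<noteq> []" "butlast p \<noteq> []" using p by (cases p rule: rev_cases; auto simp: P_def)+
  then obtain q a where "butlast p = q @ [a]" by (metis append_butlast_last_id)
  then have pq: "p = q @ [a, l]" using append_butlast_last_id[OF \<open>p \<noteq> []\<close>] by (simp add: l_def)
  have lU: "l \<in> U" "l \<noteq> r" using p last_in_set[OF \<open>p \<noteq> []\<close>] by (auto simp: P_def l_def)
  obtain w where w: "w \<in> U" "w \<noteq> a" "adj T l w" using two[OF lU] by metis
  have wl: "w \<noteq> l" using w(3) irr by blast
  have d: "distinct p" "successively (adj T) p" "set p \<subseteq> U" using p by (simp_all add: P_def)
  show False
  proof (cases "w \<in> set p")
    case True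
    then have "w \<in> set q" using pq w(2) wl by auto
    then obtain q1 q2 where q: "q = q1 @ w # q2" by (auto dest: split_list)
    let ?c = "w # q2 @ [a, l]"
    have pc: "p = q1 @ ?c" using pq q by simp
    have c: "distinct ?c" "successively (adj T) ?c" "set ?c \<subseteq> U"
      using d unfolding pc by (simp_all add: successively_append_iff)
    have "cycle_in T ?c"
      unfolding cycle_in_adj
    proof (intro conjI allI impI)
      fix i assume i: "i < length ?c"
      show "adj T (?c ! i) (?c ! ((i + 1) mod length ?c))"
      proof (cases "i + 1 < length ?c")
        case True
        then show ?thesis using successively_nth[OF c(2), of i] by (simp only: mod_less Suc_eq_plus1)
      next
        case False
        then have "i = length ?c - 1" using i by simp
        then have "?c ! i = l" "(i + 1) mod length ?c = 0" by (simp_all add: nth_append)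
        then show ?thesis using w(3) by simp
      qed
    qed (use c U in auto)
    then show False using T(2) by blast
  next
    case False
    show False
    proof (cases "w = r")
      case False
      have "P (p @ [w])"
        using p d \<open>w \<notin> set p\<close> w False unfolding P_def by (simp add: successively_append_iff l_def)
      then show False using pmax by fastforce
    next
      case True
      \<comment> \<open>Appending \<open>r\<close> would leave the family \<open>P\<close>. So
        \<open>r\<close> is put in front of the reversed path, whose last vertex is not
        \<open>r\<close>.\<close>
      have "hd p \<in> set p" using \<open>p \<noteq> []\<close> by simp
      then have h: "hd p \<noteq> r" using True \<open>w \<notin> set p\<close> by metis
      have sym: "successively (\<lambda>x y. adj T y x) p" using d(2) by (rule successively_mono) (rule adj_sym)
      have "P (w # rev p)"
        using p d \<open>w \<notin> set p\<close> w h \<open>p \<noteq> []\<close> sym adj_sym[OF w(3)] unfolding P_def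
        by (simp add: successively_Cons hd_rev last_rev l_def)
      then show False using pmax by fastforce
    qed
  qed
qed

text \<open>Connectedness as closure: inside a copy by the tree, from copy to copy around the cycle
  of roots.\<close>

lemma bouquet_connected:
  assumes T: "tree T" "v \<in> verts T" and A: "p \<in> A" "p \<in> verts (bouquet_of T v)"
    and closed: "\<And>p q. p \<in> A \<Longrightarrow> adj (bouquet_of T v) p q \<Longrightarrow> q \<in> A"
  shows "verts (bouquet_of T v) \<subseteq> A"
proof -
  have copy: "(y, m) \<in> A" if xy: "x \<in> verts T" "y \<in> verts T" and m: "m < 5" and xA: "(x, m) \<in> A" for x y m
  proof -
    have "(x, y) \<in> {(x, y). adj T x y}\<^sup>*" using T(1) xy by (simp add: tree_def connected_graph_adj)
    then show ?thesis
    proof (induction rule: rtrancl_induct)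
      case base
      then show ?case by (rule xA)
    next
      case (step y z)
      then have "adj (bouquet_of T v) (y, m) (z, m)" using m by (simp add: adj_bouquet)
      then show ?case using closed step.IH by blast
    qed
  qed
  obtain x m where p: "p = (x, m)" "x \<in> verts T" "m < 5" using A(2) by auto
  have 0: "(v, m) \<in> A" using copy[OF p(2) T(2) p(3)] A(1) p(1) by simp
  have rot: "(v, (m + k) mod 5) \<in> A" for k
  proof (induction k)
    case 0
    then show ?case using \<open>(v, m) \<in> A\<close> p(3) by simp
  next
    case (Suc k)
    have "adj (bouquet_of T v) (v, (m + k) mod 5) (v, (m + Suc k) mod 5)"
      by (simp add: adj_bouquet mod_Suc_eq)
    then show ?case using closed Suc.IH by blast
  qed
  show ?thesis
  proof
    fix q assume "q \<in> verts (bouquet_of T v)"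
    then obtain y n where q: "q = (y, n)" "y \<in> verts T" "n < 5" by auto
    have "(m + (n + 5 - m)) mod 5 = n" using p(3) q(3) by simp
    then have "(v, n) \<in> A" using rot[of "n + 5 - m"] by simp
    then show "q \<in> A" using copy[OF T(2) q(2,3)] q(1) by simp
  qed
qed

lemma bouquet_closed_subset:
  fixes B :: "('a, 'm) graph_scheme"
  assumes b: "bouquet B" and A: "x \<in> A" "x \<in> verts B" and closed: "\<And>a b. a \<in> A \<Longrightarrow> adj B a b \<Longrightarrow> b \<in> A"
  shows "verts B \<subseteq> A"
proof -
  obtain T :: "'a graph" and v f where T: "tree T" "v \<in> verts T" and f: "graph_iso f (bouquet_of T v) B"
    using b unfolding bouquet_def isomorphic_def by blast
  let ?W = "verts (bouquet_of T v)"
  have bij: "bij_betw f ?W (verts B)" using f by (simp add: graph_iso_def)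
  obtain p where p: "p \<in> ?W" "f p = x" using bij A(2) unfolding bij_betw_def by (metis imageE)
  have sub: "?W \<subseteq> {q \<in> ?W. f q \<in> A}"
  proof (rule bouquet_connected[OF T])
    show "p \<in> {q \<in> ?W. f q \<in> A}" using p A(1) by simp
    show "p \<in> ?W" by (rule p(1))
    fix q r assume q: "q \<in> {q \<in> ?W. f q \<in> A}" and qr: "adj (bouquet_of T v) q r"
    obtain y n z k where yz: "q = (y, n)" "r = (z, k)" by (metis surj_pair)
    have "r \<in> ?W" using qr T simple_graph_adj(3)[of T] unfolding yz adj_bouquet tree_def by auto
    then show "r \<in> {q \<in> ?W. f q \<in> A}" using closed f q qr unfolding graph_iso_adj by blast
  qed
  have img: "verts B = f ` ?W" using bij by (simp add: bij_betw_def)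
  show ?thesis unfolding img using sub by blast
qed

section \<open>Cores of bouquets\<close>

locale forest_graph =
  fixes F :: "('a, 'c) colored_graph" and D and \<S> and J
  assumes F: "simple_graph F" and E: "equitable (verts F) (color F) D (adj F)"
    and mino: "minority (verts F) (color F) D"
    and part\<S>: "partition_on (verts F) \<S>" and edge\<S>: "\<And>e. e \<in> edges F \<Longrightarrow> \<exists>S\<in>\<S>. e \<subseteq> S"
    and tb: "\<And>S. S \<in> \<S> \<Longrightarrow> tree (induced F S) \<or> bouquet (induced F S)"
    and noniso: "\<And>S S'. S \<in> \<S> \<Longrightarrow> S' \<in> \<S> \<Longrightarrow> S \<noteq> S' \<Longrightarrow> bouquet (induced F S) \<Longrightarrow> bouquet (induced F S') \<Longrightarrow>
      \<not> color_isomorphic (induced F S) (induced F S')"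
    and J: "reach D (color F ` verts F) J" and noleaf: "\<nexists>i. leaf_class D J i"
begin

abbreviation "V \<equiv> verts F"
abbreviation "c \<equiv> color F"

definition U :: "'a set" where
  "U = {x \<in> V. c x \<in> J \<and> big D J (c x)}"

lemma block_unique: "S \<in> \<S> \<Longrightarrow> S' \<in> \<S> \<Longrightarrow> x \<in> S \<Longrightarrow> x \<in> S' \<Longrightarrow> S = S'"
  using partition_onD2[OF part\<S>] unfolding disjoint_def by blast

lemma block_ex: "x \<in> V \<Longrightarrow> \<exists>S\<in>\<S>. x \<in> S"
  using partition_onD1[OF part\<S>] by blast

lemma block_closed:
  assumes "S \<in> \<S>" "x \<in> S" "adj F x y"
  shows "y \<in> S"
proof -
  obtain S' where "S' \<in> \<S>" "{x, y} \<subseteq> S'" using edge\<S>[of "{x, y}"] assms(3) by (auto simp: adj_def)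
  then show ?thesis using block_unique[of S S' x] assms by blast
qed

lemma fin: "finite V"
  using F by (simp add: simple_graph_def)

lemma irr: "\<not> adj F x x"
  using simple_graph_adj(1)[OF F] by blast

lemma U_nbr:
  assumes "x \<in> U" "adj F x y" "c y \<in> J"
  shows "y \<in> U"
proof -
  have y: "y \<in> V" using simple_graph_adj(3)[OF F assms(2)] .
  have "big D J (c y)"
  proof (cases "c y = c x")
    case True
    then show ?thesis using assms(1) by (simp add: U_def)
  next
    case False
    have "D (c y) (c x) > 0" using edge_degree_pos[OF E adj_sym[OF assms(2)]] .
    then show ?thesis using leafless_big[of D J "c x" "c y", OF noleaf] assms(1,3) False by (simp add: U_def)
  qed
  then show ?thesis using y assms(3) by (simp add: U_def)
qed

lemma U_two:
  assumes x: "x \<in> U"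
  shows "\<exists>y\<in>U. \<exists>z\<in>U. y \<noteq> z \<and> adj F x y \<and> adj F x z"
proof -
  have xV: "x \<in> V" and b: "big D J (c x)" using x by (simp_all add: U_def)
  from b obtain j where j: "j \<in> J" "2 \<le> D (c x) j \<or> (\<exists>j'\<in>J. j' \<noteq> j \<and> 1 \<le> D (c x) j \<and> 1 \<le> D (c x) j')"
    unfolding big_def by blast
  have "\<exists>y z. y \<noteq> z \<and> adj F x y \<and> adj F x z \<and> c y \<in> J \<and> c z \<in> J"
    using j(2)
  proof
    assume 2: "2 \<le> D (c x) j"
    let ?N = "{y \<in> V. c y = j \<and> adj F x y}"
    have "\<not> card ?N \<le> Suc 0" using equitableD(6)[OF E xV, of j] 2 by simp
    moreover have "finite ?N" using fin by simp
    ultimately obtain y z where yz: "y \<in> ?N" "z \<in> ?N" "y \<noteq> z" using card_le_Suc0_iff_eq[of ?N] by blast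
    then show ?thesis using j(1) by (intro exI[of _ y] exI[of _ z]) simp
  next
    assume "\<exists>j'\<in>J. j' \<noteq> j \<and> 1 \<le> D (c x) j \<and> 1 \<le> D (c x) j'"
    then obtain j' where j': "j' \<in> J" "j' \<noteq> j" "0 < D (c x) j" "0 < D (c x) j'" by auto
    obtain y where y: "c y = j" "adj F x y" using degree_pos[OF E xV j'(3)] by blast
    obtain z where z: "c z = j'" "adj F x z" using degree_pos[OF E xV j'(4)] by blast
    show ?thesis using y z j(1) j'(1,2) by (intro exI[of _ y] exI[of _ z]) auto
  qed
  then obtain y z where "y \<noteq> z" "adj F x y" "adj F x z" "c y \<in> J" "c z \<in> J" by blast
  moreover from this have "y \<in> U" "z \<in> U" using U_nbr[OF x] by blast+
  ultimately show ?thesis by blast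
qed

text \<open>Every vertex of \<open>U\<close> has two neighbours in \<open>U\<close>, necessarily in
  its own block, which a tree cannot accommodate.\<close>

lemma U_tree:
  assumes S: "S \<in> \<S>" and T: "tree (induced F S)"
  shows "U \<inter> S = {}"
proof (rule ccontr)
  assume "U \<inter> S \<noteq> {}"
  then obtain r where r: "r \<in> U" "r \<in> S" by blast
  have two: "\<exists>y\<in>U \<inter> S. \<exists>z\<in>U \<inter> S. y \<noteq> z \<and> adj (induced F S) x y \<and> adj (induced F S) x z"
    if x: "x \<in> U \<inter> S" for x
  proof -
    obtain y z where yz: "y \<in> U" "z \<in> U" "y \<noteq> z" "adj F x y" "adj F x z" using U_two x by blast
    then have "y \<in> S" "z \<in> S" using block_closed[OF S] x by blast+
    then show ?thesis using yz x by (auto simp: adj_induced)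
  qed
  have "U \<inter> S \<subseteq> {r}"
    by (rule acyclic_subset[of "induced F S"]) (use T two in \<open>auto simp: tree_def\<close>)
  moreover obtain y where "y \<in> U \<inter> S" "adj (induced F S) r y" using two[of r] r by blast
  then have "y \<in> U \<inter> S" "y \<noteq> r" using irr by (auto simp: adj_induced)
  ultimately show False by blast
qed

definition cyc5 :: "nat \<Rightarrow> nat \<Rightarrow> bool" where
  "cyc5 m n \<longleftrightarrow> n = (m + 1) mod 5 \<or> m = (n + 1) mod 5"

definition core :: "'a set \<Rightarrow> (nat \<Rightarrow> 'a) \<Rightarrow> bool" where
  "core S z \<longleftrightarrow> bij_betw z {..<5} (U \<inter> S) \<and> (\<forall>m<5. \<forall>n<5. adj F (z m) (z n) \<longleftrightarrow> cyc5 m n)"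

lemma less_5D: "(m::nat) < 5 \<Longrightarrow> m = 0 \<or> m = 1 \<or> m = 2 \<or> m = 3 \<or> m = 4"
  by linarith

text \<open>Adding 4 is subtracting 1, so \<open>(m + 4) mod 5\<close> is the predecessor from here
  on.\<close>

lemma cyc5_iff:
  assumes "m < 5" "n < 5"
  shows "cyc5 m n \<longleftrightarrow> n = (m + 1) mod 5 \<or> n = (m + 4) mod 5"
  using less_5D[OF assms(1)] less_5D[OF assms(2)] unfolding cyc5_def by (elim disjE) simp_all

lemma cyc5_rotate:
  assumes "m < 5" "n < 5" "k < 5"
  shows "cyc5 ((k + m) mod 5) ((k + n) mod 5) \<longleftrightarrow> cyc5 m n" "(k + m) mod 5 = (k + n) mod 5 \<longleftrightarrow> m = n"
    "(k + (m + 5 - k) mod 5) mod 5 = m"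
  using less_5D[OF assms(1)] less_5D[OF assms(2)] less_5D[OF assms(3)] unfolding cyc5_def
  by (elim disjE; simp)+

lemma cyc5_reflect:
  assumes "m < 5" "n < 5"
  shows "cyc5 ((5 - m) mod 5) ((5 - n) mod 5) \<longleftrightarrow> cyc5 m n" "(5 - (5 - m) mod 5) mod 5 = m"
  using less_5D[OF assms(1)] less_5D[OF assms(2)] unfolding cyc5_def
  by (elim disjE; simp)+

text \<open>Within a copy of the tree only the root may lack two neighbours in \<open>U\<close> in
  the same copy, so acyclicity leaves only roots. A root in \<open>U\<close> needs both its
  neighbours on the cycle, hence all five roots are in \<open>U\<close>. Rotation makes any of them
  the start.\<close>

lemma core_exists:
  assumes S: "S \<in> \<S>" and b: "bouquet (induced F S)" and x: "x \<in> U \<inter> S"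
  shows "\<exists>z. core S z \<and> z 0 = x"
proof -
  obtain T :: "'a graph" and v f where T: "tree T" "v \<in> verts T" and f: "graph_iso f (bouquet_of T v) (induced F S)"
    using b unfolding bouquet_def isomorphic_def by blast
  have bij: "bij_betw f (verts T \<times> {..<5}) S" using f by (simp add: graph_iso_def)
  have img: "f ` (verts T \<times> {..<5}) = S" using bij by (simp add: bij_betw_def)
  have fS: "f p \<in> S" if "p \<in> verts T \<times> {..<5}" for p using bij_betw_apply[OF bij that] .
  have adjf: "adj F (f p) (f q) \<longleftrightarrow> adj (bouquet_of T v) p q" if "p \<in> verts T \<times> {..<5}" "q \<in> verts T \<times> {..<5}" for p q
    using f fS that unfolding graph_iso_adj adj_induced verts_bouquet by blast
  have nbrs: "\<exists>q r. q \<in> verts T \<times> {..<5} \<and> r \<in> verts T \<times> {..<5} \<and> q \<noteq> r \<and> f q \<in> U \<and> f r \<in> U \<and>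
      adj (bouquet_of T v) p q \<and> adj (bouquet_of T v) p r"
    if p: "p \<in> verts T \<times> {..<5}" "f p \<in> U" for p
  proof -
    obtain y z where yz: "y \<in> U" "z \<in> U" "y \<noteq> z" "adj F (f p) y" "adj F (f p) z" using U_two[OF p(2)] by blast
    then have "y \<in> S" "z \<in> S" using block_closed[OF S fS[OF p(1)]] by blast+
    then obtain q r where qr: "q \<in> verts T \<times> {..<5}" "r \<in> verts T \<times> {..<5}" "y = f q" "z = f r"
      unfolding img[symmetric] by blast
    then have "adj (bouquet_of T v) p q" "adj (bouquet_of T v) p r" using yz(4,5) adjf[OF p(1)] by blast+
    moreover have "q \<noteq> r" using yz(3) qr(3,4) by blast
    ultimately show ?thesis using yz(1,2) qr by (intro exI[of _ q] exI[of _ r]) simp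
  qed
  have root: "y = v" if ym: "y \<in> verts T" "m < 5" "f (y, m) \<in> U" for y m
  proof -
    let ?W = "{x \<in> verts T. f (x, m) \<in> U}"
    have "?W \<subseteq> {v}"
    proof (rule acyclic_subset[of T])
      show "simple_graph T" "\<nexists>vs. cycle_in T vs" using T(1) by (auto simp: tree_def)
      show "?W \<subseteq> verts T" by blast
      fix x assume x: "x \<in> ?W" "x \<noteq> v"
      then obtain q r where qr: "q \<in> verts T \<times> {..<5}" "r \<in> verts T \<times> {..<5}" "q \<noteq> r" "f q \<in> U" "f r \<in> U"
        "adj (bouquet_of T v) (x, m) q" "adj (bouquet_of T v) (x, m) r" using nbrs[of "(x, m)"] ym(2) by blast
      obtain y n z k where yz: "q = (y, n)" "r = (z, k)" by (metis surj_pair)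
      have "n = m" "adj T x y" "k = m" "adj T x z" using qr(6,7) x(2) unfolding yz adj_bouquet by auto
      then show "\<exists>y\<in>?W. \<exists>z\<in>?W. y \<noteq> z \<and> adj T x y \<and> adj T x z" using qr(1-5) yz by auto
    qed
    then show ?thesis using ym by blast
  qed
  have step: "f (v, (m + 1) mod 5) \<in> U \<and> f (v, (m + 4) mod 5) \<in> U" if m: "m < 5" "f (v, m) \<in> U" for m
  proof -
    obtain q r where qr: "q \<in> verts T \<times> {..<5}" "r \<in> verts T \<times> {..<5}" "q \<noteq> r" "f q \<in> U" "f r \<in> U"
        "adj (bouquet_of T v) (v, m) q" "adj (bouquet_of T v) (v, m) r" using nbrs[of "(v, m)"] T(2) m by blast
    obtain y n y' k where "q = (y, n)" "r = (y', k)" by (metis surj_pair)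
    then have nk: "q = (v, n)" "r = (v, k)" "n < 5" "k < 5"
      using root[of y n] root[of y' k] qr(1,2,4,5) by auto
    have irrT: "\<not> adj T v v" using simple_graph_adj(1)[of T] T(1) by (auto simp: tree_def)
    have "cyc5 m n" "cyc5 m k" using qr(6,7) irrT unfolding nk adj_bouquet cyc5_def by blast+
    then have "n = (m + 1) mod 5 \<or> n = (m + 4) mod 5" "k = (m + 1) mod 5 \<or> k = (m + 4) mod 5"
      using cyc5_iff m(1) nk(3,4) by blast+
    moreover have "n \<noteq> k" using qr(3) nk by simp
    ultimately show ?thesis using qr(4,5) nk by auto
  qed
  obtain p where p: "p \<in> verts T \<times> {..<5}" "x = f p" using x unfolding img[symmetric] by blast
  obtain y k where "p = (y, k)" by (metis surj_pair)
  then have k: "k < 5" "x = f (v, k)" using root[of y k] p x by auto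
  have rot: "f (v, (k + n) mod 5) \<in> U" for n
  proof (induction n)
    case 0
    then show ?case using k x by simp
  next
    case (Suc n)
    then show ?case using step[of "(k + n) mod 5"] by (simp add: mod_Suc_eq)
  qed
  define z where "z n = f (v, (k + n) mod 5)" for n
  have "core S z"
    unfolding core_def
  proof (intro conjI allI impI)
    have "inj_on z {..<5}"
    proof (rule inj_onI)
      fix m n assume mn: "m \<in> {..<5}" "n \<in> {..<5}" "z m = z n"
      then have "(k + m) mod 5 = (k + n) mod 5"
        using bij T(2) unfolding z_def bij_betw_def by (auto dest!: inj_onD)
      then show "m = n" using cyc5_rotate(2)[of m n k] mn(1,2) k(1) by simp
    qed
    moreover have "z ` {..<5} = U \<inter> S"
    proof (intro equalityI subsetI)
      fix w assume "w \<in> z ` {..<5}"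
      then show "w \<in> U \<inter> S" using rot fS T(2) unfolding z_def by auto
    next
      fix w assume w: "w \<in> U \<inter> S"
      then obtain q where q: "q \<in> verts T \<times> {..<5}" "w = f q" unfolding img[symmetric] by blast
      obtain y n where yn: "q = (y, n)" by (metis surj_pair)
      then have n: "n < 5" "w = f (v, n)" using root[of y n] q w by auto
      have "(k + (n + 5 - k) mod 5) mod 5 = n" using cyc5_rotate(3)[OF n(1) n(1) k(1)] .
      then have "w = z ((n + 5 - k) mod 5)" using n(2) by (simp add: z_def)
      then show "w \<in> z ` {..<5}" by simp
    qed
    ultimately show "bij_betw z {..<5} (U \<inter> S)" by (simp add: bij_betw_def)
    fix m n :: nat assume mn: "m < 5" "n < 5"
    have "adj F (z m) (z n) \<longleftrightarrow> adj (bouquet_of T v) (v, (k + m) mod 5) (v, (k + n) mod 5)"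
      unfolding z_def by (rule adjf) (use T(2) in auto)
    also have "\<dots> \<longleftrightarrow> cyc5 ((k + m) mod 5) ((k + n) mod 5)"
      using simple_graph_adj(1)[of T v v] T(1) by (auto simp: adj_bouquet cyc5_def tree_def)
    also have "\<dots> \<longleftrightarrow> cyc5 m n" by (rule cyc5_rotate(1)[OF mn k(1)])
    finally show "adj F (z m) (z n) \<longleftrightarrow> cyc5 m n" .
  qed
  moreover have "z 0 = x" using k by (simp add: z_def)
  ultimately show ?thesis by blast
qed

lemma coreD:
  assumes "core S z"
  shows "m < 5 \<Longrightarrow> z m \<in> U \<inter> S" "m < 5 \<Longrightarrow> n < 5 \<Longrightarrow> adj F (z m) (z n) \<longleftrightarrow> cyc5 m n"
    "z ` {..<5} = U \<inter> S" "inj_on z {..<5}"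
  using assms unfolding core_def bij_betw_def by auto

text \<open>Neighbours of a core vertex with colour in \<open>J\<close> lie in \<open>U\<close> and
  in the block, so they are its two neighbours on the cycle.\<close>

lemma core_degree:
  assumes S: "S \<in> \<S>" and z: "core S z" and m: "m < 5" and j: "j \<in> J"
  shows "D (c (z m)) j = (if c (z ((m + 1) mod 5)) = j then 1 else 0) + (if c (z ((m + 4) mod 5)) = j then 1 else 0)"
proof -
  let ?a = "(m + 1) mod 5" and ?b = "(m + 4) mod 5"
  have ab: "?a < 5" "?b < 5" by simp_all
  have ab3: "?a \<noteq> ?b" using less_5D[OF m] by (elim disjE) simp_all
  have zm: "z m \<in> U" "z m \<in> S" using coreD(1)[OF z m] by simp_all
  have "y \<in> V \<and> c y = j \<and> adj F (z m) y \<longleftrightarrow> (y = z ?a \<or> y = z ?b) \<and> c y = j" for y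
  proof
    assume y: "y \<in> V \<and> c y = j \<and> adj F (z m) y"
    then have "y \<in> U \<inter> S" using U_nbr[OF zm(1)] j block_closed[OF S zm(2)] by blast
    then obtain n where n: "n < 5" "y = z n" using coreD(3)[OF z] by (metis imageE lessThan_iff)
    then show "(y = z ?a \<or> y = z ?b) \<and> c y = j"
      using y coreD(2)[OF z m n(1)] cyc5_iff[OF m n(1)] by auto
  next
    assume y: "(y = z ?a \<or> y = z ?b) \<and> c y = j"
    have "adj F (z m) (z ?a)" "adj F (z m) (z ?b)"
      using coreD(2)[OF z m] cyc5_iff[OF m] ab by blast+
    then show "y \<in> V \<and> c y = j \<and> adj F (z m) y" using y coreD(1)[OF z] ab by (auto simp: U_def)
  qed
  then have "{y \<in> V. c y = j \<and> adj F (z m) y} = {y \<in> {z ?a, z ?b}. c y = j}" by blast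
  moreover have "z ?a \<noteq> z ?b" using coreD(4)[OF z] ab ab3 by (meson inj_onD lessThan_iff)
  then have "card {y \<in> {z ?a, z ?b}. c y = j} = (if c (z ?a) = j then 1 else 0) + (if c (z ?b) = j then 1 else 0)"
    by (simp add: Collect_disj_eq conj_disj_distribR Collect_conv_if)
  moreover have "z m \<in> V" using zm by (simp add: U_def)
  ultimately show ?thesis using equitableD(6)[OF E, of "z m" j] by simp
qed

lemma core_reflect:
  assumes "core S z"
  shows "core S (\<lambda>n. z ((5 - n) mod 5))"
  unfolding core_def
proof (intro conjI allI impI)
  have "bij_betw (\<lambda>n::nat. (5 - n) mod 5) {..<5} {..<5}"
    by (rule bij_betw_byWitness[where f' = "\<lambda>n. (5 - n) mod 5"]) (auto simp: cyc5_reflect(2))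
  from bij_betw_trans[OF this, of z] show "bij_betw (\<lambda>n. z ((5 - n) mod 5)) {..<5} (U \<inter> S)"
    using assms by (simp add: core_def comp_def)
  fix m n :: nat assume mn: "m < 5" "n < 5"
  have "adj F (z ((5 - m) mod 5)) (z ((5 - n) mod 5)) \<longleftrightarrow> cyc5 ((5 - m) mod 5) ((5 - n) mod 5)"
    by (rule coreD(2)[OF assms]) simp_all
  also have "\<dots> \<longleftrightarrow> cyc5 m n" by (rule cyc5_reflect(1)[OF mn])
  finally show "adj F (z ((5 - m) mod 5)) (z ((5 - n) mod 5)) \<longleftrightarrow> cyc5 m n" .
qed

text \<open>The colour of a core vertex determines the two colours next to it as a multiset. Once
  the predecessor's colour is known so is the successor's, and agreement spreads around the
  cycle.\<close>

lemma core_same_colors: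
  assumes S: "S \<in> \<S>" "S' \<in> \<S>" and z: "core S z" "core S' z'"
    and 01: "c (z 0) = c (z' 0)" "c (z 1) = c (z' 1)" and m: "m < 5"
  shows "c (z m) = c (z' m)"
proof -
  have zJ: "c (z m) \<in> J" if "m < 5" for m using coreD(1)[OF z(1) that] by (simp add: U_def)
  have step: "c (z ((m + 1) mod 5)) = c (z' ((m + 1) mod 5))"
    if "m < 5" "c (z m) = c (z' m)" "c (z ((m + 4) mod 5)) = c (z' ((m + 4) mod 5))" for m
  proof -
    define j where "j = c (z ((m + 1) mod 5))"
    have j: "j \<in> J" unfolding j_def by (rule zJ) simp
    have "D (c (z m)) j = 1 + (if c (z ((m + 4) mod 5)) = j then 1 else 0)"
      using core_degree[OF S(1) z(1) that(1) j] by (simp add: j_def)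
    moreover have "D (c (z m)) j = (if c (z' ((m + 1) mod 5)) = j then 1 else 0) + (if c (z ((m + 4) mod 5)) = j then 1 else 0)"
      unfolding that(2,3) by (rule core_degree[OF S(2) z(2) that(1) j])
    ultimately have "(if c (z' ((m + 1) mod 5)) = j then 1 else 0) = (1::nat)" by linarith
    then show ?thesis by (simp add: j_def split: if_splits)
  qed
  have 2: "c (z 2) = c (z' 2)" using step[of 1] 01 by (simp add: numeral_2_eq_2)
  have 3: "c (z 3) = c (z' 3)" using step[of 2] 01 2 by simp
  have 4: "c (z 4) = c (z' 4)" using step[of 3] 2 3 by simp
  have "m = 0 \<or> m = 1 \<or> m = 2 \<or> m = 3 \<or> m = 4" using m by linarith
  then show ?thesis using 01 2 3 4 by blast
qed

text \<open>The cores are matched by their numberings, and the isomorphism grows as leaf classes are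
  put back. In the end its domain and range are closed under adjacency, hence whole blocks by
  connectedness.\<close>

lemma core_extend:
  assumes S: "S \<in> \<S>" "S' \<in> \<S>" and z: "core S z" "core S' z'"
    and b: "bouquet (induced F S)" "bouquet (induced F S')"
    and col: "\<And>m. m < 5 \<Longrightarrow> c (z m) = c (z' m)"
  shows "color_isomorphic (induced F S) (induced F S')"
proof -
  let ?closed = "\<lambda>J A. \<forall>a\<in>A. \<forall>y\<in>part V c J. adj F a y \<longrightarrow> y \<in> A"
  \<comment> \<open>Domain and range stay closed under adjacency within the classes present so far;
    \<open>z 0\<close> and \<open>z' 0\<close> witness that they are nonempty.\<close>
  define R where "R J A B g \<longleftrightarrow> (z 0 \<in> A \<and> A \<subseteq> S \<inter> part V c J \<and> ?closed J A) \<and>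
    (z' 0 \<in> B \<and> B \<subseteq> S' \<inter> part V c J \<and> ?closed J B) \<and>
    (bij_betw g A B \<and> (\<forall>x\<in>A. c (g x) = c x) \<and> (\<forall>x\<in>A. \<forall>y\<in>A. adj F x y \<longleftrightarrow> adj F (g x) (g y)))" for J A B g
  let ?Q = "\<lambda>J. \<exists>A B g. R J A B g"
  have "?Q (c ` V)"
  proof (rule reach_up[where P = ?Q, OF J])
    have base: "z 0 \<in> U \<inter> S" "U \<inter> S \<subseteq> S \<inter> part V c J" "?closed J (U \<inter> S)" if "S \<in> \<S>" "core S z" for S z
    proof -
      show "z 0 \<in> U \<inter> S" by (rule coreD(1)[OF that(2)]) simp
      show "U \<inter> S \<subseteq> S \<inter> part V c J" by (auto simp: U_def part_def)
      show "?closed J (U \<inter> S)"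
      proof (intro ballI impI)
        fix a y assume a: "a \<in> U \<inter> S" and y: "y \<in> part V c J" "adj F a y"
        have "c y \<in> J" using y(1) by (simp add: part_def)
        then have "y \<in> U" using U_nbr[of a y] a y(2) by blast
        moreover have "y \<in> S" using block_closed[OF that(1), of a y] a y(2) by blast
        ultimately show "y \<in> U \<inter> S" by blast
      qed
    qed
    let ?z = "the_inv_into {..<5} z"
    have zb: "bij_betw z {..<5} (U \<inter> S)" "bij_betw z' {..<5} (U \<inter> S')" using z by (simp_all add: core_def)
    have zi: "bij_betw ?z (U \<inter> S) {..<5}" by (rule bij_betw_the_inv_into[OF zb(1)])
    have zz: "?z x < 5" "z (?z x) = x" if "x \<in> U \<inter> S" for x
      using bij_betw_apply[OF zi that] f_the_inv_into_f_bij_betw[OF zb(1) that] by simp_all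
    have 1: "bij_betw (z' \<circ> ?z) (U \<inter> S) (U \<inter> S')" by (rule bij_betw_trans[OF zi zb(2)])
    have 2: "c ((z' \<circ> ?z) x) = c x" if "x \<in> U \<inter> S" for x using col[OF zz(1)[OF that]] zz(2)[OF that] by simp
    have 3: "adj F x y \<longleftrightarrow> adj F ((z' \<circ> ?z) x) ((z' \<circ> ?z) y)" if "x \<in> U \<inter> S" "y \<in> U \<inter> S" for x y
      using coreD(2)[OF z(1) zz(1)[OF that(1)] zz(1)[OF that(2)]] coreD(2)[OF z(2) zz(1)[OF that(1)] zz(1)[OF that(2)]]
        zz(2)[OF that(1)] zz(2)[OF that(2)] by simp
    show "?Q J"
      by (rule exI[of _ "U \<inter> S"], rule exI[of _ "U \<inter> S'"], rule exI[of _ "z' \<circ> ?z"], unfold R_def)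
        (intro conjI base[OF S(1) z(1)] base[OF S(2) z(2)] 1 ballI 2 3)
  next
    fix J i assume leaf: "leaf_class D J i" and "?Q (J - {i})"
    then obtain A B g where R: "R (J - {i}) A B g" by blast
    note RA = conjunct1[OF R[unfolded R_def]] and RB = conjunct1[OF conjunct2[OF R[unfolded R_def]]]
      and RG = conjunct2[OF conjunct2[OF R[unfolded R_def]]]
    note A = conjunct1[OF RA] conjunct1[OF conjunct2[OF RA]] conjunct2[OF conjunct2[OF RA]]
    note B = conjunct1[OF RB] conjunct1[OF conjunct2[OF RB]] conjunct2[OF conjunct2[OF RB]]
    note g = conjunct1[OF RG] bspec[OF conjunct1[OF conjunct2[OF RG]]] bspec[OF bspec[OF conjunct2[OF conjunct2[OF RG]]]]
    have iJ: "i \<in> J" using leaf by (simp add: leaf_class_def)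
    let ?L = "\<lambda>A. {l \<in> V. c l = i \<and> (\<exists>a\<in>A. adj F l a)}"
    have sub: "A \<union> ?L A \<subseteq> S \<inter> part V c J" if AS: "A \<subseteq> S \<inter> part V c (J - {i})" "S \<in> \<S>" for A S
    proof
      fix x assume "x \<in> A \<union> ?L A"
      then show "x \<in> S \<inter> part V c J"
      proof
        assume "x \<in> A"
        then show ?thesis using AS(1) by (auto simp: part_def)
      next
        assume "x \<in> ?L A"
        then obtain a where a: "a \<in> A" "adj F x a" "x \<in> V" "c x = i" by blast
        then have "x \<in> S" using block_closed[OF AS(2) _ adj_sym[OF a(2)]] AS(1) by blast
        then show ?thesis using a(3,4) iJ by (simp add: part_def)
      qed
    qed
    have cl: "?closed J (A \<union> ?L A)" if AQ: "A \<subseteq> part V c (J - {i})" and AC: "?closed (J - {i}) A" for A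
    proof (intro ballI impI)
      fix a y assume a: "a \<in> A \<union> ?L A" and y: "y \<in> part V c J" "adj F a y"
      have yV: "y \<in> V" using y(1) by (simp add: part_def)
      show "y \<in> A \<union> ?L A"
      proof (cases "a \<in> A")
        case True
        show ?thesis
        proof (cases "c y = i")
          case True
          then show ?thesis using yV \<open>a \<in> A\<close> adj_sym[OF y(2)] by blast
        next
          case False
          then have "y \<in> part V c (J - {i})" using y(1) by (simp add: part_def)
          then show ?thesis using AC True y(2) by blast
        qed
      next
        case False
        then obtain b where ab: "a \<in> V" "c a = i" "b \<in> A" "adj F a b" using a by blast
        have "c y \<noteq> i" using leaf_nbr(2)[OF E leaf ab(1,2) yV] y(2) by blast
        then have "y \<in> part V c (J - {i})" using y(1) by (simp add: part_def)
        then have "y = b" using leaf_nbr(1)[OF E leaf ab(1,2)] ab(3,4) AQ y(2) by blast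
        then show ?thesis using ab(3) by blast
      qed
    qed
    have AP: "A \<subseteq> part V c (J - {i})" "B \<subseteq> part V c (J - {i})" using A(2) B(2) by blast+
    obtain g' where g': "bij_betw g' (A \<union> ?L A) (B \<union> ?L B)" "\<forall>x\<in>A \<union> ?L A. c (g' x) = c x"
      "\<forall>x\<in>A \<union> ?L A. \<forall>y\<in>A \<union> ?L A. adj F x y \<longleftrightarrow> adj F (g' x) (g' y)"
      using extend_color_class[OF E E leaf AP g refl refl] by blast
    show "?Q J"
      by (rule exI[of _ "A \<union> ?L A"], rule exI[of _ "B \<union> ?L B"], rule exI[of _ g'], unfold R_def)
        (intro conjI g' sub[OF A(2) S(1)] sub[OF B(2) S(2)] cl[OF AP(1) A(3)] cl[OF AP(2) B(3)] UnI1 A(1) B(1))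
  qed
  moreover have pV: "part V c (c ` V) = V" by (auto simp: part_def)
  ultimately obtain A B g where R: "R (c ` V) A B g" by blast
  note RA = conjunct1[OF R[unfolded R_def pV]] and RB = conjunct1[OF conjunct2[OF R[unfolded R_def pV]]]
    and RG = conjunct2[OF conjunct2[OF R[unfolded R_def pV]]]
  note A = conjunct1[OF RA] conjunct1[OF conjunct2[OF RA]] conjunct2[OF conjunct2[OF RA]]
  note B = conjunct1[OF RB] conjunct1[OF conjunct2[OF RB]] conjunct2[OF conjunct2[OF RB]]
  note g = conjunct1[OF RG] conjunct1[OF conjunct2[OF RG]] conjunct2[OF conjunct2[OF RG]]
  have full: "A = S" if "S \<in> \<S>" "bouquet (induced F S)" "x \<in> A" "A \<subseteq> S \<inter> V" "\<forall>a\<in>A. \<forall>y\<in>V. adj F a y \<longrightarrow> y \<in> A"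
    for A S x
  proof -
    have "verts (induced F S) \<subseteq> A"
    proof (rule bouquet_closed_subset[OF that(2,3)])
      show "x \<in> verts (induced F S)" using that(3,4) by auto
      fix a y assume "a \<in> A" "adj (induced F S) a y"
      then show "y \<in> A" using that(5) simple_graph_adj(3)[OF F] by (auto simp: adj_induced)
    qed
    then show ?thesis using that(4) by auto
  qed
  have AS: "A = S" by (rule full[OF S(1) b(1) A])
  have BS: "B = S'" by (rule full[OF S(2) b(2) B])
  have "graph_iso g (induced F S) (induced F S')"
    using g bij_betw_apply[OF g(1)] unfolding graph_iso_adj AS BS by (auto simp: adj_induced)
  then show ?thesis unfolding color_isomorphic_def using g(2) AS by auto
qed

text \<open>Core vertices of equal colour have equally coloured neighbours in their cores. After a
  reflection, if necessary, the numberings agree in colour at 0 and 1, hence everywhere, and two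
  different blocks would be isomorphic bouquets.\<close>

lemma core_unique:
  assumes S: "S \<in> \<S>" "S' \<in> \<S>" and b: "bouquet (induced F S)" "bouquet (induced F S')"
    and x: "x \<in> U \<inter> S" "x' \<in> U \<inter> S'" "c x = c x'"
  shows "S = S'"
proof (rule ccontr)
  assume ne: "S \<noteq> S'"
  obtain z where z: "core S z" "z 0 = x" using core_exists[OF S(1) b(1) x(1)] by blast
  obtain z' where z': "core S' z'" "z' 0 = x'" using core_exists[OF S(2) b(2) x(2)] by blast
  have "c (z 1) \<in> J" using coreD(1)[OF z(1), of 1] by (simp add: U_def)
  then have "D (c x) (c (z 1)) = 1 + (if c (z 4) = c (z 1) then 1 else 0)"
    "D (c x') (c (z 1)) = (if c (z' 1) = c (z 1) then 1 else 0) + (if c (z' 4) = c (z 1) then 1 else 0)"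
    using core_degree[OF S(1) z(1), of 0 "c (z 1)"] core_degree[OF S(2) z'(1), of 0 "c (z 1)"] z(2) z'(2) by simp_all
  then have "(if c (z' 1) = c (z 1) then 1 else 0) + (if c (z' 4) = c (z 1) then 1 else 0) > (0::nat)"
    unfolding x(3) by linarith
  then have "c (z' 1) = c (z 1) \<or> c (z' 4) = c (z 1)"
    by (cases "c (z' 1) = c (z 1)"; cases "c (z' 4) = c (z 1)") simp_all
  then have "\<exists>w. core S' w \<and> w 0 = x' \<and> c (z 1) = c (w 1)"
  proof
    assume "c (z' 4) = c (z 1)"
    then show ?thesis using core_reflect[OF z'(1)] z'(2) by (intro exI[of _ "\<lambda>n. z' ((5 - n) mod 5)"]) simp
  next
    assume "c (z' 1) = c (z 1)"
    then show ?thesis using z' by (intro exI[of _ z']) simp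
  qed
  then obtain w where w: "core S' w" "w 0 = x'" "c (z 1) = c (w 1)" by blast
  have "c (z m) = c (w m)" if "m < 5" for m
    by (rule core_same_colors[OF S z(1) w(1) _ w(3) that]) (use x(3) z(2) w(2) in simp)
  then have "color_isomorphic (induced F S) (induced F S')" by (rule core_extend[OF S z(1) w(1) b])
  then show False using noniso[OF S ne b] by blast
qed

text \<open>By \<open>core_unique\<close> the colours of a core occur nowhere else, so their classes
  partition its five vertices. With more than one colour, each class would have at least two
  vertices, and two classes consecutive on the cycle exactly two each; the fifth vertex would then
  be alone in its class.\<close>

lemma big_class:
  assumes i: "i \<in> J" "big D J i"
  shows "D i i = 2 \<and> card {v \<in> V. c v = i} = 5 \<and> (\<forall>j\<in>J. j \<noteq> i \<longrightarrow> D i j = 0)"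
proof -
  let ?cl = "\<lambda>i. {v \<in> V. c v = i}"
  obtain x where x: "x \<in> V" "c x = i" using i(1) reach_subset[OF J] by blast
  then have xU: "x \<in> U" using i by (simp add: U_def)
  obtain S where S: "S \<in> \<S>" "x \<in> S" using block_ex[OF x(1)] by blast
  have bq: "bouquet (induced F S)" if "S \<in> \<S>" "y \<in> U \<inter> S" for S y
    using tb[OF that(1)] U_tree[OF that(1)] that(2) by blast
  have xS: "x \<in> U \<inter> S" using xU S(2) by blast
  obtain z where z: "core S z" "z 0 = x" using core_exists[OF S(1) bq[OF S(1) xS] xS] by blast
  let ?Z = "U \<inter> S"
  have cardZ: "card ?Z = 5" "finite ?Z"
    using bij_betw_same_card[of z "{..<5}" ?Z] z(1) fin by (auto simp: core_def U_def)
  have clZ: "?cl (c y) \<subseteq> ?Z" if y: "y \<in> ?Z" for y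
  proof
    fix w assume w: "w \<in> ?cl (c y)"
    then have wU: "w \<in> U" using y by (simp add: U_def)
    obtain S' where S': "S' \<in> \<S>" "w \<in> S'" using block_ex w by blast
    have wS: "w \<in> U \<inter> S'" using wU S'(2) by blast
    have "c y = c w" using w by simp
    then have "S = S'" by (rule core_unique[OF S(1) S'(1) bq[OF S(1) y] bq[OF S'(1) wS] y wS])
    then show "w \<in> ?Z" using wU S'(2) by blast
  qed
  have zZ: "z m \<in> ?Z" if "m < 5" for m using coreD(1)[OF z(1) that] .
  have zV: "z m \<in> V" if "m < 5" for m using zZ[OF that] by (simp add: U_def)
  have adj1: "adj F (z m) (z ((m + 1) mod 5))" if "m < 5" for m
    using coreD(2)[OF z(1) that, of "(m + 1) mod 5"] by (simp add: cyc5_def)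
  have mono: "c (z m) = c (z 0)" if "m < 5" for m
  proof (rule ccontr)
    assume nm: "c (z m) \<noteq> c (z 0)"
    \<comment> \<open>Going around the cycle, a colour that does not occur everywhere is left at
      some point.\<close>
    have change: "\<exists>n<5. c (z n) = a \<and> c (z ((n + 1) mod 5)) \<noteq> a" if a: "a \<in> c ` ?Z" for a
    proof (rule ccontr)
      assume no: "\<not> ?thesis"
      obtain k where k: "k < 5" "c (z k) = a" using a coreD(3)[OF z(1)] by (metis imageE lessThan_iff)
      have all: "c (z ((k + n) mod 5)) = a" for n
      proof (induction n)
        case (Suc n)
        have "(k + n) mod 5 < 5" by simp
        then have "c (z (((k + n) mod 5 + 1) mod 5)) = a" using no Suc by blast
        then show ?case by (simp add: mod_Suc_eq)
      qed (use k in simp)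
      have "(k + (m + 5 - k)) mod 5 = m" "(k + (0 + 5 - k)) mod 5 = 0" using k(1) \<open>m < 5\<close> by simp_all
      then show False using all[of "m + 5 - k"] all[of "0 + 5 - k"] nm by simp
    qed
    \<comment> \<open>The vertex after the change has another colour and some neighbour of colour
      \<open>a\<close>, and the flip bound doubles this degree.\<close>
    have size2: "2 \<le> card (?cl a)" if a: "a \<in> c ` ?Z" for a
    proof -
      obtain n where n: "n < 5" "c (z n) = a" "c (z ((n + 1) mod 5)) \<noteq> a" using change[OF a] by blast
      let ?y = "z ((n + 1) mod 5)"
      have "D (c ?y) (c (z n)) > 0" by (rule edge_degree_pos[OF E adj_sym[OF adj1[OF n(1)]]])
      moreover have "2 * D (c ?y) (c (z n)) \<le> card (?cl (c (z n)))"
      proof -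
        have "?y \<in> V" "z n \<in> V" using zV n(1) by simp_all
        then have "2 * D (c ?y) (c (z n)) + (if c ?y = c (z n) then 1 else 0) \<le> card (?cl (c (z n)))"
          using mino unfolding minority_def by blast
        then show ?thesis by linarith
      qed
      ultimately show ?thesis using n(2) by simp
    qed
    have "c (z 0) \<in> c ` ?Z" using zZ by simp
    from change[OF this] obtain n where "n < 5" "c (z n) = c (z 0)" "c (z ((n + 1) mod 5)) \<noteq> c (z 0)" by blast
    then have n: "n < 5" "c (z ((n + 1) mod 5)) \<noteq> c (z n)" by simp_all
    let ?y = "z ((n + 1) mod 5)"
    let ?a = "c (z n)" and ?b = "c ?y"
    have n1: "(n + 1) mod 5 < 5" by simp
    have ab: "?a \<in> c ` ?Z" "?b \<in> c ` ?Z" using zZ[OF n(1)] zZ[OF n1] by blast+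
    have dis: "?cl ?a \<inter> ?cl ?b = {}" using n(2) by auto
    have subZ: "?cl ?a \<union> ?cl ?b \<subseteq> ?Z" using clZ[OF zZ[OF n(1)]] clZ[OF zZ[OF n1]] by blast
    have finc: "finite (?cl k)" for k using fin by simp
    have "card (?cl ?a \<union> ?cl ?b) = card (?cl ?a) + card (?cl ?b)" using dis finc by (intro card_Un_disjoint)
    then have sum: "card (?cl ?a) + card (?cl ?b) \<le> 5" using card_mono[OF cardZ(2) subZ] cardZ(1) by simp
    have m1: "2 * D ?a ?b \<le> card (?cl ?b)" "2 * D ?b ?a \<le> card (?cl ?a)"
      using mino zV[OF n(1)] zV[OF n1] n(2) unfolding minority_def by force+
    have p1: "D ?a ?b > 0" "D ?b ?a > 0"
      using edge_degree_pos[OF E adj1[OF n(1)]] edge_degree_pos[OF E adj_sym[OF adj1[OF n(1)]]] by blast+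
    \<comment> \<open>Both classes have at least 2 and together at most 5 vertices, so neither
      exceeds 3 and no degree between them reaches 2.\<close>
    have "D ?a ?b = 1" "D ?b ?a = 1" using m1 p1 sum size2[OF ab(1)] size2[OF ab(2)] by linarith+
    then have eqc: "card (?cl ?a) = card (?cl ?b)" using degree_symmetry[OF E, of ?a ?b] by simp
    then have two: "card (?cl ?a) = 2" "card (?cl ?b) = 2" using sum size2[OF ab(1)] by linarith+
    then have "card (?cl ?a \<union> ?cl ?b) = 4" using \<open>card (?cl ?a \<union> ?cl ?b) = card (?cl ?a) + card (?cl ?b)\<close> by simp
    then have "?cl ?a \<union> ?cl ?b \<noteq> ?Z" using cardZ(1) by auto
    then obtain w where w: "w \<in> ?Z" "w \<notin> ?cl ?a \<union> ?cl ?b" using subZ by blast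
    have "c w \<in> c ` ?Z" using w(1) by blast
    then have w2: "2 \<le> card (?cl (c w))" by (rule size2)
    have "w \<in> V" using w(1) by (simp add: U_def)
    then have "(?cl ?a \<union> ?cl ?b) \<inter> ?cl (c w) = {}" using w(2) by auto
    then have "card ((?cl ?a \<union> ?cl ?b) \<union> ?cl (c w)) = card (?cl ?a \<union> ?cl ?b) + card (?cl (c w))"
      using finc by (intro card_Un_disjoint) auto
    moreover have "(?cl ?a \<union> ?cl ?b) \<union> ?cl (c w) \<subseteq> ?Z" using subZ clZ[OF w(1)] by blast
    then have "card ((?cl ?a \<union> ?cl ?b) \<union> ?cl (c w)) \<le> 5" unfolding cardZ(1)[symmetric] by (rule card_mono[OF cardZ(2)])
    ultimately show False using \<open>card (?cl ?a \<union> ?cl ?b) = 4\<close> w2 by linarith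
  qed
  have z0: "c (z 0) = i" using z(2) x(2) by simp
  then have zi: "c (z m) = i" if "m < 5" for m using mono[OF that] by simp
  have "?Z \<subseteq> ?cl i"
  proof
    fix w assume w: "w \<in> ?Z"
    then obtain m where "m < 5" "w = z m" unfolding coreD(3)[OF z(1), symmetric] by auto
    then show "w \<in> ?cl i" using zi zV by simp
  qed
  then have "?cl i = ?Z" using clZ[OF xS] x(2) by auto
  then have "card (?cl i) = 5" using cardZ(1) by simp
  moreover have D: "D i j = (if i = j then 2 else 0)" if "j \<in> J" for j
    using core_degree[OF S(1) z(1) _ that, of 0] zi[of 1] zi[of 4] z0 by simp
  ultimately show ?thesis using i(1) by auto
qed

lemma forest_reduced: "reduced V c D J"
  by (rule leafless_reducedI[OF noleaf big_class])

end

theorem theorem4p9: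
  fixes G :: "'a graph"
  assumes "simple_graph G"
  shows "identified_by_C 2 G \<longleftrightarrow> bouquet_forest (flip G)"
proof -
  let ?F = "flip G"
  have F: "simple_graph ?F" by (rule simple_graph_flip[OF assms])
  obtain D where D: "equitable (verts ?F) (color ?F) D (adj ?F)" "minority (verts ?F) (color ?F) D"
    and iff: "identified_by_C 2 G \<longleftrightarrow> rigid (verts ?F) (color ?F) D"
    using identified_iff_rigid_flip[OF assms] by auto
  have fin: "finite (verts ?F)" using F by (simp add: simple_graph_def)
  \<comment> \<open>One leafless remainder serves both directions, since it is found from colours
    and degrees alone.\<close>
  obtain J where J: "reach D (color ?F ` verts ?F) J" "\<nexists>i. leaf_class D J i"
    using reach_terminal[of "color ?F ` verts ?F" D] fin by auto
  have "rigid (verts ?F) (color ?F) D \<longleftrightarrow> bouquet_forest ?F"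
  proof
    assume "rigid (verts ?F) (color ?F) D"
    then interpret rigid_graph "verts ?F" "color ?F" D "adj ?F" using D by unfold_locales
    have "reduced (verts ?F) (color ?F) D J" by (rule terminal_reduced[OF reach_subset[OF J(1)] J(2)])
    then show "bouquet_forest ?F" by (rule reduced_imp_bouquet_forest[OF F D(1) J(1)])
  next
    assume "bouquet_forest ?F"
    then obtain \<S> where \<S>: "partition_on (verts ?F) \<S>" "\<forall>e\<in>edges ?F. \<exists>S\<in>\<S>. e \<subseteq> S"
      "\<forall>S\<in>\<S>. tree (induced ?F S) \<or> bouquet (induced ?F S)"
      "\<forall>S\<in>\<S>. \<forall>S'\<in>\<S>. S \<noteq> S' \<and> bouquet (induced ?F S) \<and> bouquet (induced ?F S') \<longrightarrow>
        \<not> color_isomorphic (induced ?F S) (induced ?F S')"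
      unfolding bouquet_forest_def by blast
    interpret forest_graph ?F D \<S> J
      using F D J \<S> by unfold_locales auto
    show "rigid (verts ?F) (color ?F) D" by (rule reduced_imp_rigid[OF fin J(1) forest_reduced])
  qed
  with iff show ?thesis by simp
qed

end
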